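(* The hybrid global expanded mixed multiscale problem (HG) has a unique solution $(\bar\theta_h^g,\bar u_h^g,\bar p_h^g,\lambda_h^g)\in X_{1,h}^g\times\tilde X_{2,h}^g\times Q_h\times\Pi_h^g$. Moreover, $((\bar\theta_h^g,\bar u_h^g),\bar p_h^g)=((\theta_h^g,u_h^g),p_h^g)$, where $((\theta_h^g,u_h^g),p_h^g)\in X_h^g\times Q_h$ is the unique solution of the global expanded mixed multiscale problem (G). (Problems (G) and (HG) are written out in the context.)
   Context: $\Omega\subset\mathbb R^d$ ($d=2,3$) is a bounded Lipschitz domain, $f\in L^2(\Omega)$, and $k$ is a symmetric matrix field with $k_{\min}|\zeta|^2\le\zeta^Tk(x)\zeta\le k_{\max}|\zeta|^2$ for all $\zeta\in\mathbb R^d$, $x\in\Omega$, with constants $0<k_{\min}\le k_{\max}$. $(\cdot,\cdot)_D$ is the $L^2(D)$ inner product, $(\cdot,\cdot)=(\cdot,\cdot)_\Omega$. $H(div,\Omega)=\{v\in[L^2(\Omega)]^d:div\,v\in L^2(\Omega)\}$. Mesh: $\mathfrak T_h$ is a quasi-uniform partition of $\Omega$ into cells $K$, $h$ the maximal cell diameter, $\mathcal F_h$ the set of interior faces. $RT_0$ is the lowest-order Raviart–Thomas space on $\mathfrak T_h$, with local basis $\chi_e^K$ (one for each face $e\subset\partial K$) satisfying $div\,\chi_e^K=1/|K|$, $\chi_e^K\cdot n=1/|e|$ on $e$ and $0$ on the other faces ($n$ the outward normal). $Q_h$ is the space of piecewise constants. Global multiscale spaces: $u_1,\dots,u_N$ are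 given vector fields (global fields) with $\int_e u_i\cdot n_e\,ds\ne0$ for all faces $e$. For each $i$ and each $\chi=\chi_e^K$, $(\eta_{i,\chi}^K,\psi_{i,\chi}^K,\phi_{i,\chi}^K)$ solves (with $\phi_{i,\chi}^K$ determined up to a constant) $\psi_{i,\chi}^K+k\eta_{i,\chi}^K=0$, $\eta_{i,\chi}^K-\nabla\phi_{i,\chi}^K=0$, $div\,\psi_{i,\chi}^K=div\,\chi$ in $K$, and on $\partial K$: $\psi_{i,\chi}^K\cdot n=\frac{\int_e\chi\cdot n\,ds}{\int_e u_i\cdot n\,ds}\,u_i\cdot n$ on $e$, and $\psi_{i,\chi}^K\cdot n=0$ on the other faces. $X_{1,h}^g=\{\theta\in[L^2(\Omega)]^d:\theta|_K\in\mathrm{span}\{\eta_{i,\chi}^K\}\ \forall K\}$, $\tilde X_{2,h}^g=\{u\in[L^2(\Omega)]^d:u|_K\in\mathrm{span}\{\psi_{i,\chi}^K\}\ \forall K\}$ (spans over all $i$ and $\chi$), $X_{2,h}^g=\tilde X_{2,h}^g\cap H(div,\Omega)$, $X_h^g=X_{1,h}^g\times X_{2,h}^g$. $\Pi_h^g=\{\pi\in L^2(\mathcal F_h):\pi|_e\in X_{2,h}^g\cdot n_e\ \forall e\in\mathcal F_h\}$, with $\pi=0$ on faces $e\subset\partial\Omega$. $[C_h^g(\tau_h),\pi_h]=\sum_K(\tau_h\cdot n_{\partial K},\pi_h)_{\partial K}$ for $\tau_h\in\tilde X_{2,h}^g$, $\pi_h\in\Pi_h^g$. Problem (G): find $((\theta_h^g,u_h^g),p_h^g)\in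 X_h^g\times Q_h$ with $(k\theta_h^g,\xi_h)+(u_h^g,\xi_h)=0$ for all $\xi_h\in X_{1,h}^g$; $(\theta_h^g,\tau_h)+(p_h^g,div\,\tau_h)=0$ for all $\tau_h\in X_{2,h}^g$; $(div\,u_h^g,q_h)=(f,q_h)$ for all $q_h\in Q_h$. Problem (HG): find $(\bar\theta_h^g,\bar u_h^g,\bar p_h^g,\lambda_h^g)\in X_{1,h}^g\times\tilde X_{2,h}^g\times Q_h\times\Pi_h^g$ with $(k\bar\theta_h^g,\xi_h)+(\bar u_h^g,\xi_h)=0$ for all $\xi_h\in X_{1,h}^g$; $(\bar\theta_h^g,\tau_h)+\sum_K(\bar p_h^g,div\,\tau_h)_K=[C_h^g(\tau_h),\lambda_h^g]$ for all $\tau_h\in\tilde X_{2,h}^g$; $\sum_K(div\,\bar u_h^g,q_h)_K=(f,q_h)$ for all $q_h\in Q_h$; $[C_h^g(\bar u_h^g),\pi_h]=0$ for all $\pi_h\in\Pi_h^g$. *)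

theory Defs
  imports "HOL-Analysis.Analysis"
begin

section \<open>Square-integrable functions, weak derivatives\<close>

text \<open>Elements of \<open>L\<^sup>2\<close> are represented by functions; equality in \<open>L\<^sup>2\<close> is equality almost everywhere.\<close>

definition square_integrable :: "'a measure \<Rightarrow> ('a \<Rightarrow> 'b::euclidean_space) \<Rightarrow> bool" where
  "square_integrable M v \<longleftrightarrow>
     v \<in> borel_measurable M \<and> integrable M (\<lambda>x. (norm (v x))\<^sup>2)"

definition ae_eq :: "'a measure \<Rightarrow> ('a \<Rightarrow> 'b) \<Rightarrow> ('a \<Rightarrow> 'b) \<Rightarrow> bool" where
  "ae_eq M v w \<longleftrightarrow> (AE x in M. v x = w x)"

text \<open>\<open>C1_gradient \<phi> D\<close>: \<open>\<phi>\<close> is continuously differentiable on the whole space, with gradient \<open>D\<close>.\<close>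

definition C1_gradient :: "('a::euclidean_space \<Rightarrow> real) \<Rightarrow> ('a \<Rightarrow> 'a) \<Rightarrow> bool" where
  "C1_gradient \<phi> D \<longleftrightarrow> (\<forall>x. GDERIV \<phi> x :> D x) \<and> continuous_on UNIV D"

text \<open>Weak derivatives on \<open>S\<close> are derivatives on the interior of \<open>S\<close> (cells are closed sets),
  tested with \<open>C\<^sup>1\<close> functions of compact support; this is equivalent to testing with smooth ones.\<close>

definition test_function :: "'a::euclidean_space set \<Rightarrow> ('a \<Rightarrow> real) \<Rightarrow> ('a \<Rightarrow> 'a) \<Rightarrow> bool" where
  "test_function S \<phi> D \<longleftrightarrow> C1_gradient \<phi> D \<and>
     compact (closure {x. \<phi> x \<noteq> 0}) \<and> closure {x. \<phi> x \<noteq> 0} \<subseteq> interior S"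

definition has_weak_div :: "'a::euclidean_space set \<Rightarrow> ('a \<Rightarrow> 'a) \<Rightarrow> ('a \<Rightarrow> real) \<Rightarrow> bool" where
  "has_weak_div S v w \<longleftrightarrow>
     square_integrable (lebesgue_on S) v \<and> square_integrable (lebesgue_on S) w \<and>
     (\<forall>\<phi> D. test_function S \<phi> D \<longrightarrow>
        (LINT x|lebesgue_on S. v x \<bullet> D x) = - (LINT x|lebesgue_on S. w x * \<phi> x))"

text \<open>The weak divergence, unique up to null sets.\<close>

definition wdiv :: "'a::euclidean_space set \<Rightarrow> ('a \<Rightarrow> 'a) \<Rightarrow> 'a \<Rightarrow> real" where
  "wdiv S v = (SOME w. has_weak_div S v w)"

definition Hdiv :: "'a::euclidean_space set \<Rightarrow> ('a \<Rightarrow> 'a) set" where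
  "Hdiv S = {v. \<exists>w. has_weak_div S v w}"

definition has_weak_grad :: "'a::euclidean_space set \<Rightarrow> ('a \<Rightarrow> real) \<Rightarrow> ('a \<Rightarrow> 'a) \<Rightarrow> bool" where
  "has_weak_grad S \<phi> g \<longleftrightarrow>
     square_integrable (lebesgue_on S) \<phi> \<and> square_integrable (lebesgue_on S) g \<and>
     (\<forall>\<zeta> D. test_function S \<zeta> D \<longrightarrow>
        (LINT x|lebesgue_on S. \<phi> x *\<^sub>R D x) = - (LINT x|lebesgue_on S. \<zeta> x *\<^sub>R g x))"


section \<open>Domain and mesh\<close>

text \<open>Near each boundary point the domain is the strict epigraph, in some direction \<open>\<nu>\<close>, of a
  Lipschitz function on the hyperplane orthogonal to \<open>\<nu>\<close>.\<close>

definition Lipschitz_domain :: "'a::euclidean_space set \<Rightarrow> bool" where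
  "Lipschitz_domain \<Omega> \<longleftrightarrow> open \<Omega> \<and> connected \<Omega> \<and> \<Omega> \<noteq> {} \<and>
     (\<forall>x0\<in>frontier \<Omega>. \<exists>r>0. \<exists>\<nu> L g. norm \<nu> = 1 \<and> L-lipschitz_on {y. y \<bullet> \<nu> = 0} g \<and>
        \<Omega> \<inter> ball x0 r = {x \<in> ball x0 r. x \<bullet> \<nu> > g (x - (x \<bullet> \<nu>) *\<^sub>R \<nu>)})"

text \<open>A face-to-face partition into closed convex polytopes.  Taking intersections to be faces of
  both cells forces distinct cells to have disjoint interiors.  With \<open>h\<close> the maximal cell diameter,
  quasi-uniformity with constant \<open>\<sigma>\<close> says that every cell contains a ball of radius \<open>\<sigma> h\<close>.\<close>

definition mesh_size :: "'a::euclidean_space set set \<Rightarrow> real" where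
  "mesh_size \<T> = Max (diameter ` \<T>)"

definition quasi_uniform_partition ::
    "real \<Rightarrow> 'a::euclidean_space set \<Rightarrow> 'a set set \<Rightarrow> bool" where
  "quasi_uniform_partition \<sigma> \<Omega> \<T> \<longleftrightarrow>
     finite \<T> \<and> \<Union>\<T> = closure \<Omega> \<and>
     (\<forall>K\<in>\<T>. polytope K \<and> interior K \<noteq> {}) \<and>
     (\<forall>K\<in>\<T>. \<forall>K'\<in>\<T>. (K \<inter> K') face_of K \<and> (K \<inter> K') face_of K') \<and>
     0 < \<sigma> \<and> (\<forall>K\<in>\<T>. \<exists>x. ball x (\<sigma> * mesh_size \<T>) \<subseteq> K)"

definition facets :: "'a::euclidean_space set \<Rightarrow> 'a set set" where
  "facets K = {e. e facet_of K}"

definition mesh_faces :: "'a::euclidean_space set set \<Rightarrow> 'a set set" where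
  "mesh_faces \<T> = (\<Union>K\<in>\<T>. facets K)"

definition interior_faces :: "'a::euclidean_space set \<Rightarrow> 'a set set \<Rightarrow> 'a set set" where
  "interior_faces \<Omega> \<T> = {e \<in> mesh_faces \<T>. \<not> e \<subseteq> frontier \<Omega>}"

definition boundary_faces :: "'a::euclidean_space set \<Rightarrow> 'a set set \<Rightarrow> 'a set set" where
  "boundary_faces \<Omega> \<T> = {e \<in> mesh_faces \<T>. e \<subseteq> frontier \<Omega>}"

definition outward_normal :: "'a::euclidean_space set \<Rightarrow> 'a set \<Rightarrow> 'a" where
  "outward_normal K e =
     (THE n. norm n = 1 \<and> (\<exists>b. K \<subseteq> {x. n \<bullet> x \<le> b} \<and> e = K \<inter> {x. n \<bullet> x = b}))"

text \<open>The surface measure \<open>ds\<close> on a flat face \<open>e\<close> of codimension one: project the Lebesgue measure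
  of the right prism with mid-section \<open>e\<close> and height \<open>1\<close> orthogonally onto the hyperplane of \<open>e\<close>.
  By Fubini this is the \<open>(d-1)\<close>-dimensional Lebesgue measure on \<open>e\<close>.\<close>

definition surface_measure :: "'a::euclidean_space set \<Rightarrow> 'a measure" where
  "surface_measure e =
     distr (lebesgue_on {y. closest_point (affine hull e) y \<in> e \<and>
                            dist y (closest_point (affine hull e) y) \<le> 1/2})
           borel (closest_point (affine hull e))"

definition face_area :: "'a::euclidean_space set \<Rightarrow> real" where
  "face_area e = measure (surface_measure e) UNIV"

text \<open>\<open>v \<cdot> n\<close> on \<open>\<partial>K\<close> (with \<open>n\<close> outward) for \<open>v \<in> H(div,K)\<close>, in the sense of Green's formula;
  the trace is required to be a square-integrable function \<open>\<gamma> e\<close> on every face \<open>e\<close> of \<open>K\<close>.\<close>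

definition has_normal_trace ::
    "'a::euclidean_space set \<Rightarrow> ('a \<Rightarrow> 'a) \<Rightarrow> ('a set \<Rightarrow> 'a \<Rightarrow> real) \<Rightarrow> bool" where
  "has_normal_trace K v \<gamma> \<longleftrightarrow>
     (\<forall>e\<in>facets K. square_integrable (surface_measure e) (\<gamma> e)) \<and>
     (\<exists>w. has_weak_div K v w \<and>
       (\<forall>\<phi> D. C1_gradient \<phi> D \<longrightarrow>
          (LINT x|lebesgue_on K. v x \<bullet> D x) + (LINT x|lebesgue_on K. w x * \<phi> x)
            = (\<Sum>e\<in>facets K. LINT x|surface_measure e. \<gamma> e x * \<phi> x)))"

definition normal_trace ::
    "'a::euclidean_space set \<Rightarrow> ('a \<Rightarrow> 'a) \<Rightarrow> 'a set \<Rightarrow> 'a \<Rightarrow> real" where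
  "normal_trace K v = (SOME \<gamma>. has_normal_trace K v \<gamma>)"

text \<open>The fixed normal \<open>n\<^sub>e\<close> of a mesh face is the outward normal of one (arbitrarily chosen) cell
  having \<open>e\<close> as a face.  For \<open>v \<in> H(div,\<Omega>)\<close> the other choice only changes the sign of \<open>v \<cdot> n\<^sub>e\<close>.\<close>

definition face_cell :: "'a::euclidean_space set set \<Rightarrow> 'a set \<Rightarrow> 'a set" where
  "face_cell \<T> e = (SOME K. K \<in> \<T> \<and> e \<in> facets K)"

definition face_trace ::
    "'a::euclidean_space set set \<Rightarrow> ('a \<Rightarrow> 'a) \<Rightarrow> 'a set \<Rightarrow> 'a \<Rightarrow> real" where
  "face_trace \<T> v e = normal_trace (face_cell \<T> e) v e"


section \<open>Raviart--Thomas basis and local problems\<close>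

text \<open>The lowest-order Raviart--Thomas space on a cell: affine fields whose normal component is
  constant on each face.  On a simplex these are the fields \<open>a + b x\<close> with a vector \<open>a\<close> and a scalar
  \<open>b\<close> (every face normal is an eigenvector of the transposed linear part); on an axis-parallel box
  they are the fields whose \<open>i\<close>-th component is an affine function of \<open>x\<^sub>i\<close> alone.\<close>

definition RT0 :: "(real^'n) set \<Rightarrow> (real^'n \<Rightarrow> real^'n) set" where
  "RT0 K = {v. (\<exists>a (M :: real^'n^'n). \<forall>x\<in>K. v x = a + M *v x) \<and>
               (\<forall>e\<in>facets K. \<exists>c. \<forall>x\<in>e. v x \<bullet> outward_normal K e = c)}"

definition RT0_basis_function ::
    "(real^'n) set \<Rightarrow> (real^'n) set \<Rightarrow> (real^'n \<Rightarrow> real^'n) \<Rightarrow> bool" where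
  "RT0_basis_function K e rt \<longleftrightarrow>
     rt \<in> RT0 K \<and>
     has_weak_div K rt (\<lambda>_. 1 / measure lebesgue K) \<and>
     (\<forall>x\<in>e. rt x \<bullet> outward_normal K e = 1 / face_area e) \<and>
     (\<forall>e'\<in>facets K. e' \<noteq> e \<longrightarrow> (\<forall>x\<in>e'. rt x \<bullet> outward_normal K e' = 0))"

definition local_problem ::
    "(real^'n \<Rightarrow> real^'n^'n) \<Rightarrow> (real^'n) set \<Rightarrow> (real^'n) set \<Rightarrow>
     (real^'n \<Rightarrow> real^'n) \<Rightarrow> (real^'n \<Rightarrow> real^'n) \<Rightarrow>
     (real^'n \<Rightarrow> real^'n) \<Rightarrow> (real^'n \<Rightarrow> real^'n) \<Rightarrow> (real^'n \<Rightarrow> real) \<Rightarrow> bool" where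
  "local_problem k K e ui rt \<eta> \<psi> \<phi> \<longleftrightarrow>
     (AE x in lebesgue_on K. \<psi> x + k x *v \<eta> x = 0) \<and>
     has_weak_grad K \<phi> \<eta> \<and>
     has_weak_div K \<psi> (wdiv K rt) \<and>
     has_normal_trace K \<psi>
       (\<lambda>e' x. if e' = e
          then (LINT y|surface_measure e. rt y \<bullet> outward_normal K e)
               / (LINT y|surface_measure e. normal_trace K ui e y) * normal_trace K ui e x
          else 0)"


section \<open>Multiscale spaces and discrete problems\<close>

text \<open>Piecewise linear combinations of the local fields \<open>\<eta> i K e\<close>, where \<open>e\<close> stands for
  the basis function of the face \<open>e\<close> of \<open>K\<close>.  The spaces \<open>X1\<close> and \<open>X2t\<close> arise from the
  fields \<open>\<eta>\<close> and \<open>\<psi>\<close>; \<open>X2t\<close> is the one without interelement continuity.\<close>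

definition broken_space ::
    "(real^'n) set \<Rightarrow> (real^'n) set set \<Rightarrow> nat \<Rightarrow>
     (nat \<Rightarrow> (real^'n) set \<Rightarrow> (real^'n) set \<Rightarrow> real^'n \<Rightarrow> real^'n) \<Rightarrow> (real^'n \<Rightarrow> real^'n) set" where
  "broken_space \<Omega> \<T> N \<eta> =
     {v. square_integrable (lebesgue_on \<Omega>) v \<and>
         (\<forall>K\<in>\<T>. \<exists>c. AE x in lebesgue_on K.
            v x = (\<Sum>i=1..N. \<Sum>e\<in>facets K. c i e *\<^sub>R \<eta> i K e x))}"

abbreviation (input) "X1 \<equiv> broken_space"
abbreviation (input) "X2t \<equiv> broken_space"

definition X2 ::
    "(real^'n) set \<Rightarrow> (real^'n) set set \<Rightarrow> nat \<Rightarrow>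
     (nat \<Rightarrow> (real^'n) set \<Rightarrow> (real^'n) set \<Rightarrow> real^'n \<Rightarrow> real^'n) \<Rightarrow> (real^'n \<Rightarrow> real^'n) set" where
  "X2 \<Omega> \<T> N \<psi> = X2t \<Omega> \<T> N \<psi> \<inter> Hdiv \<Omega>"

definition Qh :: "(real^'n) set set \<Rightarrow> (real^'n \<Rightarrow> real) set" where
  "Qh \<T> = {q. \<forall>K\<in>\<T>. \<exists>c. AE x in lebesgue_on K. q x = c}"

text \<open>A function on the union of the faces is given by its restrictions \<open>\<pi> e\<close> to the faces.\<close>

definition Pih ::
    "(real^'n) set \<Rightarrow> (real^'n) set set \<Rightarrow> nat \<Rightarrow>
     (nat \<Rightarrow> (real^'n) set \<Rightarrow> (real^'n) set \<Rightarrow> real^'n \<Rightarrow> real^'n) \<Rightarrow>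
     ((real^'n) set \<Rightarrow> real^'n \<Rightarrow> real) set" where
  "Pih \<Omega> \<T> N \<psi> =
     {\<pi>. (\<forall>e\<in>mesh_faces \<T>. square_integrable (surface_measure e) (\<pi> e)) \<and>
         (\<forall>e\<in>interior_faces \<Omega> \<T>. \<exists>\<tau>\<in>X2 \<Omega> \<T> N \<psi>.
             ae_eq (surface_measure e) (\<pi> e) (face_trace \<T> \<tau> e)) \<and>
         (\<forall>e\<in>boundary_faces \<Omega> \<T>. ae_eq (surface_measure e) (\<pi> e) (\<lambda>_. 0))}"

definition Ch ::
    "(real^'n) set set \<Rightarrow> (real^'n \<Rightarrow> real^'n) \<Rightarrow> ((real^'n) set \<Rightarrow> real^'n \<Rightarrow> real) \<Rightarrow> real" where
  "Ch \<T> \<tau> \<pi> =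
     (\<Sum>K\<in>\<T>. \<Sum>e\<in>facets K. LINT x|surface_measure e. normal_trace K \<tau> e x * \<pi> e x)"

definition solves_G ::
    "(real^'n) set \<Rightarrow> (real^'n \<Rightarrow> real^'n^'n) \<Rightarrow> (real^'n \<Rightarrow> real) \<Rightarrow> (real^'n) set set \<Rightarrow> nat \<Rightarrow>
     (nat \<Rightarrow> (real^'n) set \<Rightarrow> (real^'n) set \<Rightarrow> real^'n \<Rightarrow> real^'n) \<Rightarrow>
     (nat \<Rightarrow> (real^'n) set \<Rightarrow> (real^'n) set \<Rightarrow> real^'n \<Rightarrow> real^'n) \<Rightarrow>
     (real^'n \<Rightarrow> real^'n) \<Rightarrow> (real^'n \<Rightarrow> real^'n) \<Rightarrow> (real^'n \<Rightarrow> real) \<Rightarrow> bool" where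
  "solves_G \<Omega> k f \<T> N \<eta> \<psi> \<theta> u p \<longleftrightarrow>
     \<theta> \<in> X1 \<Omega> \<T> N \<eta> \<and> u \<in> X2 \<Omega> \<T> N \<psi> \<and> p \<in> Qh \<T> \<and>
     (\<forall>\<xi>\<in>X1 \<Omega> \<T> N \<eta>.
        (LINT x|lebesgue_on \<Omega>. (k x *v \<theta> x) \<bullet> \<xi> x) + (LINT x|lebesgue_on \<Omega>. u x \<bullet> \<xi> x) = 0) \<and>
     (\<forall>\<tau>\<in>X2 \<Omega> \<T> N \<psi>.
        (LINT x|lebesgue_on \<Omega>. \<theta> x \<bullet> \<tau> x) + (LINT x|lebesgue_on \<Omega>. p x * wdiv \<Omega> \<tau> x) = 0) \<and>
     (\<forall>q\<in>Qh \<T>. (LINT x|lebesgue_on \<Omega>. wdiv \<Omega> u x * q x) = (LINT x|lebesgue_on \<Omega>. f x * q x))"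

definition solves_HG ::
    "(real^'n) set \<Rightarrow> (real^'n \<Rightarrow> real^'n^'n) \<Rightarrow> (real^'n \<Rightarrow> real) \<Rightarrow> (real^'n) set set \<Rightarrow> nat \<Rightarrow>
     (nat \<Rightarrow> (real^'n) set \<Rightarrow> (real^'n) set \<Rightarrow> real^'n \<Rightarrow> real^'n) \<Rightarrow>
     (nat \<Rightarrow> (real^'n) set \<Rightarrow> (real^'n) set \<Rightarrow> real^'n \<Rightarrow> real^'n) \<Rightarrow>
     (real^'n \<Rightarrow> real^'n) \<Rightarrow> (real^'n \<Rightarrow> real^'n) \<Rightarrow> (real^'n \<Rightarrow> real) \<Rightarrow>
     ((real^'n) set \<Rightarrow> real^'n \<Rightarrow> real) \<Rightarrow> bool" where
  "solves_HG \<Omega> k f \<T> N \<eta> \<psi> \<theta> u p lam \<longleftrightarrow>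
     \<theta> \<in> X1 \<Omega> \<T> N \<eta> \<and> u \<in> X2t \<Omega> \<T> N \<psi> \<and> p \<in> Qh \<T> \<and> lam \<in> Pih \<Omega> \<T> N \<psi> \<and>
     (\<forall>\<xi>\<in>X1 \<Omega> \<T> N \<eta>.
        (LINT x|lebesgue_on \<Omega>. (k x *v \<theta> x) \<bullet> \<xi> x) + (LINT x|lebesgue_on \<Omega>. u x \<bullet> \<xi> x) = 0) \<and>
     (\<forall>\<tau>\<in>X2t \<Omega> \<T> N \<psi>.
        (LINT x|lebesgue_on \<Omega>. \<theta> x \<bullet> \<tau> x) + (\<Sum>K\<in>\<T>. LINT x|lebesgue_on K. p x * wdiv K \<tau> x)
          = Ch \<T> \<tau> lam) \<and>
     (\<forall>q\<in>Qh \<T>. (\<Sum>K\<in>\<T>. LINT x|lebesgue_on K. wdiv K u x * q x) = (LINT x|lebesgue_on \<Omega>. f x * q x)) \<and>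
     (\<forall>\<pi>\<in>Pih \<Omega> \<T> N \<psi>. Ch \<T> u \<pi> = 0)"

end

theory Submission
  imports Defs
begin

text \<open>Both problems reduce to finite linear algebra on the cells.

  On a cell \<open>K\<close> the field \<open>\<psi> i K e\<close> has divergence \<open>1 / |K|\<close>, and its normal trace is concentrated on
  \<open>e\<close>, where it is the trace of the global field \<open>ug i\<close> scaled to integral one (\<open>psi_green\<close>).  As
  \<open>ug i\<close> has a weak divergence on \<open>\<Omega>\<close>, its outward traces from the two cells at an interior face are
  opposite, so the scaled trace is the same function \<open>flux i e\<close> from both sides (\<open>unit_flux_eq\<close>).
  If a field \<open>\<tau>\<close> has coefficients \<open>C K i e\<close> with respect to the \<open>\<psi> i K e\<close>, then the integral over \<open>K\<close>
  of \<open>p\<close> times the divergence of \<open>\<tau>\<close> is the value of \<open>p\<close> on \<open>K\<close> times the sum of the coefficients on \<open>K\<close>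
  (\<open>div_moment\<close>), and the interface term \<open>Ch \<T> \<tau> \<pi>\<close> is the sum of the coefficients times the
  moments \<open>\<integral> flux i e * \<pi> e\<close> (\<open>Ch_moments\<close>).

  Uniqueness.  Since \<open>k \<eta> = - \<psi>\<close>, the first equation says \<open>k \<theta> = - u\<close> almost everywhere
  (\<open>constitutive_iff\<close>).  Testing the difference of two solutions with itself leaves
  \<open>\<integral> \<theta> \<bullet> u = 0\<close>, so both fields vanish by ellipticity (\<open>zero_of_energy_zero\<close>).  In the hybrid problem a
  test with a single \<open>\<psi> i K e\<close> then says that \<open>p\<close> on \<open>K\<close> equals the moment of the multiplier against
  \<open>flux i e\<close>; in the conforming problem one tests with differences of two such fields across an
  interior face, and with a single one at a boundary face.  In both cases \<open>p\<close> has equal values on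
  cells sharing a face and vanishes next to the boundary, hence everywhere (\<open>cell_values_zero\<close>).
  The multiplier is then orthogonal to the functions \<open>flux i e\<close>, which span it.

  Existence.  A functional that vanishes on the common kernel of finitely many functionals is a
  linear combination of them (\<open>functional_in_span\<close>).  So the hybrid system is solvable as soon as
  the adjoint homogeneous system annihilates the load, and that system yields to the same energy
  argument (\<open>HG_exists\<close>).

  Equivalence.  A field with normal traces on all cells lies in \<open>Hdiv \<Omega>\<close> exactly if its traces
  cancel on the interior faces (\<open>Hdiv_jump\<close>, \<open>Hdiv_of_jump\<close>).  Hence the last hybrid equation puts \<open>u\<close>
  into \<open>X2\<close>, and the multiplier term vanishes for test fields in \<open>X2\<close> (\<open>HG_imp_G\<close>).

  The analytic input is the uniqueness of traces: face densities whose integrals against all test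
  functions cancel are zero almost everywhere (\<open>facet_densities_vanish\<close>).  The geometric input is
  that an interior face belongs to exactly two cells (\<open>interior_face_two_cells\<close>), and that a connected
  open set stays connected after removing finitely many sets of codimension two
  (\<open>connected_diff_lowdim\<close>).\<close>

section \<open>Test functions determine densities\<close>

text \<open>The squared distance to a closed convex set is continuously differentiable, because the closest
  point depends on \<open>x\<close> in a 1-Lipschitz way.  This makes it easy to write down \<open>C\<^sup>1\<close> cut-off functions.\<close>

lemma GDERIV_dist_closest_point_sq:
  fixes C :: "'a::euclidean_space set"
  assumes "convex C" "closed C" "C \<noteq> {}"
  shows "GDERIV (\<lambda>x. (dist x (closest_point C x))\<^sup>2) x :> 2 *\<^sub>R (x - closest_point C x)"
proof -
  let ?P = "closest_point C" and ?r = "\<lambda>x. (dist x (closest_point C x))\<^sup>2"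
  have sq: "?r y = (y - ?P y) \<bullet> (y - ?P y)" for y
    by (simp add: dist_norm power2_norm_eq_inner)
  have le: "?r y \<le> (y - ?P x) \<bullet> (y - ?P x)" for x y
    using closest_point_le[OF assms(2) closest_point_in_set[OF assms(2,3), of x], of y]
    by (metis dist_norm power2_norm_eq_inner power_mono zero_le_dist)
  have upper: "?r y - ?r x - (y - x) \<bullet> (2 *\<^sub>R (x - ?P x)) \<le> (norm (y - x))\<^sup>2" for y
    using le[of y x] unfolding sq power2_norm_eq_inner
    by (simp add: inner_diff inner_commute algebra_simps)
  have lower: "- (4 * (norm (y - x))\<^sup>2) \<le> ?r y - ?r x - (y - x) \<bullet> (2 *\<^sub>R (x - ?P x))" for y
  proof -
    have a: "?r x - ?r y \<le> 2 * ((y - ?P y) \<bullet> (x - y)) + (norm (y - x))\<^sup>2"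
      using le[of x y] unfolding sq power2_norm_eq_inner
      by (simp add: inner_diff inner_commute algebra_simps)
    have "(?P y - ?P x) \<bullet> (y - x) \<le> norm (?P y - ?P x) * norm (y - x)"
      by (rule norm_cauchy_schwarz)
    also have "\<dots> \<le> norm (y - x) * norm (y - x)"
      using closest_point_lipschitz[OF assms, of y x]
      by (intro mult_right_mono) (auto simp: dist_norm)
    finally have "(?P y - ?P x) \<bullet> (y - x) \<le> (norm (y - x))\<^sup>2"
      by (simp add: power2_eq_square)
    moreover have "(y - ?P y) \<bullet> (x - y)
        = - ((x - ?P x) \<bullet> (y - x)) - (norm (y - x))\<^sup>2 + (?P y - ?P x) \<bullet> (y - x)"
      unfolding power2_norm_eq_inner
      by (simp add: inner_diff_left inner_diff_right inner_commute)
    moreover have "(y - x) \<bullet> (2 *\<^sub>R (x - ?P x)) = 2 * ((x - ?P x) \<bullet> (y - x))"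
      by (simp add: inner_commute)
    ultimately show ?thesis using a zero_le_power2[of "norm (y - x)"] by linarith
  qed
  have bound: "norm (?r y - ?r x - (y - x) \<bullet> (2 *\<^sub>R (x - ?P x))) \<le> 4 * (norm (y - x))\<^sup>2" for y
    using upper[of y] lower[of y] zero_le_power2[of "norm (y - x)"]
    unfolding real_norm_def abs_le_iff by linarith
  show ?thesis
    unfolding gderiv_def has_derivative_at'
  proof (intro conjI allI impI)
    show "bounded_linear (\<lambda>h. h \<bullet> (2 *\<^sub>R (x - ?P x)))"
      by (rule bounded_linear_inner_left)
    fix e :: real assume "e > 0"
    show "\<exists>d>0. \<forall>x'. 0 < norm (x' - x) \<and> norm (x' - x) < d \<longrightarrow>
        norm (?r x' - ?r x - (x' - x) \<bullet> (2 *\<^sub>R (x - ?P x))) / norm (x' - x) < e"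
    proof (intro exI[of _ "e / 4"] conjI allI impI)
      show "0 < e / 4" using \<open>e > 0\<close> by simp
      fix y assume y: "0 < norm (y - x) \<and> norm (y - x) < e / 4"
      have "norm (?r y - ?r x - (y - x) \<bullet> (2 *\<^sub>R (x - ?P x))) / norm (y - x)
          \<le> 4 * (norm (y - x))\<^sup>2 / norm (y - x)"
        using bound by (rule divide_right_mono) simp
      also have "\<dots> = 4 * norm (y - x)" using y by (simp add: power2_eq_square)
      also have "\<dots> < e" using y by simp
      finally show "norm (?r y - ?r x - (y - x) \<bullet> (2 *\<^sub>R (x - ?P x))) / norm (y - x) < e" .
    qed
  qed
qed

lemma DERIV_pos_part_sq:
  "DERIV (\<lambda>t::real. (max 0 (1 - t))\<^sup>2) t :> - 2 * max 0 (1 - t)"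
proof -
  have c: "max 1 t = closest_point {1..} t" for t :: real
    by (rule closest_point_unique) (auto simp: dist_real_def)
  have "DERIV (\<lambda>t. (dist t (closest_point {1::real..} t))\<^sup>2) t :> 2 *\<^sub>R (t - closest_point {1..} t)"
    using GDERIV_dist_closest_point_sq[of "{1::real..}" t] by simp
  moreover have "(\<lambda>t. (dist t (closest_point {1::real..} t))\<^sup>2) = (\<lambda>t::real. (max 0 (1 - t))\<^sup>2)"
    by (auto simp: c[symmetric] dist_real_def max_def)
  moreover have "2 *\<^sub>R (t - closest_point {1..} t) = - 2 * max 0 (1 - t)"
    by (auto simp: c[symmetric] max_def)
  ultimately show ?thesis by simp
qed

text \<open>A \<open>C\<^sup>1\<close> cut-off function for the convex set \<open>C\<close>: it is \<open>1\<close> on \<open>C\<close> and vanishes where the squared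
  distance to \<open>C\<close> exceeds \<open>1 / r\<close>.\<close>

definition bump :: "'a::euclidean_space set \<Rightarrow> real \<Rightarrow> 'a \<Rightarrow> real" where
  "bump C r x = (max 0 (1 - r * (dist x (closest_point C x))\<^sup>2))\<^sup>2"

lemma bump_C1:
  fixes C :: "'a::euclidean_space set"
  assumes "convex C" "closed C" "C \<noteq> {}"
  shows "\<exists>D. C1_gradient (bump C r) D"
proof (intro exI)
  let ?s = "\<lambda>x. r * (dist x (closest_point C x))\<^sup>2"
  let ?D = "\<lambda>x. (- 2 * max 0 (1 - ?s x)) *\<^sub>R (r *\<^sub>R (2 *\<^sub>R (x - closest_point C x)))"
  show "C1_gradient (bump C r) ?D"
    unfolding C1_gradient_def
  proof (intro conjI allI)
    fix x
    have "GDERIV ?s x :> r *\<^sub>R (2 *\<^sub>R (x - closest_point C x))"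
      using GDERIV_mult[OF GDERIV_const[of r x] GDERIV_dist_closest_point_sq[OF assms, of x]]
      by simp
    from GDERIV_DERIV_compose[OF this DERIV_pos_part_sq]
    show "GDERIV (bump C r) x :> ?D x"
      by (simp add: bump_def[abs_def])
    show "continuous_on UNIV ?D"
      by (intro continuous_intros continuous_on_closest_point assms)
  qed
qed

lemma bump_bounds: "r \<ge> 0 \<Longrightarrow> 0 \<le> bump C r x \<and> bump C r x \<le> 1"
proof -
  assume "r \<ge> 0"
  then have "0 \<le> max 0 (1 - r * (dist x (closest_point C x))\<^sup>2)"
    "max 0 (1 - r * (dist x (closest_point C x))\<^sup>2) \<le> 1" by auto
  then show ?thesis unfolding bump_def by (simp add: power_le_one)
qed

lemma bump_tendsto:
  assumes "closed C" "C \<noteq> {}"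
  shows "(\<lambda>n. bump C (real n) x) \<longlonglongrightarrow> indicator C x"
proof (cases "x \<in> C")
  case True
  then show ?thesis by (simp add: bump_def closest_point_self)
next
  case False
  then have "dist x (closest_point C x) > 0"
    using closest_point_in_set[OF assms, of x] by auto
  then have d: "(dist x (closest_point C x))\<^sup>2 > 0" (is "?d > 0") by simp
  obtain n0 :: nat where n0: "1 / ?d < n0" using reals_Archimedean2 by blast
  have "bump C (real n) x = 0" if "n \<ge> n0" for n
  proof -
    have "1 < n0 * ?d" using n0 d by (simp add: field_simps)
    also have "\<dots> \<le> n * ?d" using that d by (intro mult_right_mono) auto
    finally show ?thesis by (simp add: bump_def)
  qed
  then have "eventually (\<lambda>n. bump C (real n) x = 0) sequentially"
    by (auto simp: eventually_sequentially)
  then show ?thesis using False by (simp add: tendsto_eventually)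
qed

lemma bump_support:
  fixes C :: "'a::euclidean_space set"
  assumes "convex C" "compact C" "C \<noteq> {}" "open U" "C \<subseteq> U"
  shows "\<exists>n0. \<forall>n\<ge>n0. compact (closure {x. bump C (real n) x \<noteq> 0})
             \<and> closure {x. bump C (real n) x \<noteq> 0} \<subseteq> U"
proof -
  have cl: "closed C" using assms(2) compact_imp_closed by blast
  obtain \<epsilon> where e: "\<epsilon> > 0" "(\<Union>x\<in>C. cball x \<epsilon>) \<subseteq> U"
    by (rule compact_subset_open_imp_cball_epsilon_subset[OF assms(2,4,5)])
  let ?V = "{x. dist x (closest_point C x) \<le> \<epsilon>}"
  have Vcl: "closed ?V"
    by (intro closed_Collect_le continuous_intros continuous_on_closest_point assms cl)
  have VU: "?V \<subseteq> U"
  proof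
    fix x assume "x \<in> ?V"
    then have "x \<in> cball (closest_point C x) \<epsilon>" by (simp add: dist_commute)
    with e(2) closest_point_in_set[OF cl assms(3), of x] show "x \<in> U" by blast
  qed
  obtain B where B: "\<And>x. x \<in> C \<Longrightarrow> norm x \<le> B"
    using compact_imp_bounded[OF assms(2)] bounded_iff by blast
  have Vbd: "bounded ?V"
  proof (rule boundedI)
    fix x assume "x \<in> ?V"
    then have "norm (x - closest_point C x) \<le> \<epsilon>" by (simp add: dist_norm)
    with B[OF closest_point_in_set[OF cl assms(3), of x]]
    show "norm x \<le> B + \<epsilon>"
      using norm_triangle_ineq[of "closest_point C x" "x - closest_point C x"] by simp
  qed
  have Vco: "compact ?V" using Vcl Vbd by (simp add: compact_eq_bounded_closed)
  obtain n0 :: nat where n0: "1 / \<epsilon>\<^sup>2 < n0" using reals_Archimedean2 by blast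
  show ?thesis
  proof (intro exI allI impI)
    fix n assume n: "n \<ge> n0"
    have "{x. bump C (real n) x \<noteq> 0} \<subseteq> ?V"
    proof
      fix x assume "x \<in> {x. bump C (real n) x \<noteq> 0}"
      then have *: "n * (dist x (closest_point C x))\<^sup>2 < 1"
        by (simp add: bump_def max_def split: if_splits)
      have "\<not> \<epsilon> < dist x (closest_point C x)"
      proof
        assume "\<epsilon> < dist x (closest_point C x)"
        then have "\<epsilon>\<^sup>2 < (dist x (closest_point C x))\<^sup>2" using e by (intro power_strict_mono) auto
        then have "n0 * \<epsilon>\<^sup>2 \<le> n * (dist x (closest_point C x))\<^sup>2"
          using n by (intro mult_mono) auto
        moreover have "1 < n0 * \<epsilon>\<^sup>2" using n0 e by (simp add: field_simps)
        ultimately show False using * by simp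
      qed
      then show "x \<in> ?V" by simp
    qed
    then have "closure {x. bump C (real n) x \<noteq> 0} \<subseteq> ?V" using Vcl by (rule closure_minimal)
    then show "compact (closure {x. bump C (real n) x \<noteq> 0}) \<and> closure {x. bump C (real n) x \<noteq> 0} \<subseteq> U"
      using VU bounded_subset[OF Vbd] by (simp only: compact_eq_bounded_closed closed_closure) blast
  qed
qed

lemma C1_gradient_continuous: "C1_gradient \<phi> D \<Longrightarrow> continuous_on UNIV \<phi>"
  unfolding C1_gradient_def gderiv_def
  by (auto intro!: continuous_at_imp_continuous_on intro: has_derivative_continuous)

text \<open>Let a functional be a finite sum of integrals \<open>\<integral> g j * \<phi> \<partial>\<mu> j\<close>.  If it vanishes for the test functions
  on \<open>U\<close>, it vanishes for the indicator of every compact convex \<open>C \<subseteq> U\<close>, by dominated convergence of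
  the cut-off functions.\<close>

lemma vanishing_functional_compact_convex:
  fixes \<mu> :: "'j \<Rightarrow> 'a::euclidean_space measure" and g :: "'j \<Rightarrow> 'a \<Rightarrow> real"
  assumes J: "finite J" and int: "\<And>j. j \<in> J \<Longrightarrow> integrable (\<mu> j) (g j)"
    and meas: "\<And>j. j \<in> J \<Longrightarrow> (\<lambda>x. x) \<in> measurable (\<mu> j) borel"
    and U: "open U"
    and zero: "\<And>\<phi> D. test_function U \<phi> D \<Longrightarrow> (\<Sum>j\<in>J. LINT x|\<mu> j. g j x * \<phi> x) = 0"
    and C: "convex C" "compact C" "C \<subseteq> U"
  shows "(\<Sum>j\<in>J. LINT x|\<mu> j. indicator C x * g j x) = 0"
proof (cases "C = {}")
  case False
  have cl: "closed C" using C compact_imp_closed by blast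
  obtain n0 where n0: "\<And>n. n \<ge> n0 \<Longrightarrow> compact (closure {x. bump C (real n) x \<noteq> 0})
             \<and> closure {x. bump C (real n) x \<noteq> 0} \<subseteq> U"
    using bump_support[OF C(1,2) False U C(3)] by blast
  let ?\<phi> = "\<lambda>n. bump C (real (n + n0))"
  have C1: "\<exists>D. C1_gradient (?\<phi> n) D" for n
    by (rule bump_C1) (use C cl False in auto)
  have z: "(\<Sum>j\<in>J. LINT x|\<mu> j. g j x * ?\<phi> n x) = 0" for n
  proof -
    obtain D where "C1_gradient (?\<phi> n) D" using C1 by blast
    then have "test_function U (?\<phi> n) D"
      unfolding test_function_def using n0[of "n + n0"] interior_open[OF U] by auto
    then show ?thesis by (rule zero)
  qed
  have lim: "(\<lambda>n. LINT x|\<mu> j. g j x * ?\<phi> n x) \<longlonglongrightarrow> (LINT x|\<mu> j. indicator C x * g j x)"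
    if j: "j \<in> J" for j
  proof (rule integral_dominated_convergence[where w = "\<lambda>x. norm (g j x)"])
    have [measurable]: "g j \<in> borel_measurable (\<mu> j)" using int[OF j] by auto
    have m: "\<phi> \<in> borel_measurable borel \<Longrightarrow> (\<lambda>x. \<phi> x) \<in> borel_measurable (\<mu> j)" for \<phi> :: "'a \<Rightarrow> real"
      using measurable_compose[OF meas[OF j]] by blast
    have "indicator C \<in> borel_measurable (borel :: 'a measure)" using cl by auto
    from m[OF this] show "(\<lambda>x. indicator C x * g j x) \<in> borel_measurable (\<mu> j)" by measurable
    show "(\<lambda>x. g j x * ?\<phi> n x) \<in> borel_measurable (\<mu> j)" for n
    proof -
      have "?\<phi> n \<in> borel_measurable borel"
        using C1[of n] C1_gradient_continuous borel_measurable_continuous_onI by blast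
      from m[OF this] show ?thesis by measurable
    qed
    show "integrable (\<mu> j) (\<lambda>x. norm (g j x))" using int[OF j] by auto
    show "AE x in \<mu> j. (\<lambda>n. g j x * ?\<phi> n x) \<longlonglongrightarrow> indicator C x * g j x"
    proof (rule AE_I2)
      fix x
      have "(\<lambda>n. ?\<phi> n x) \<longlonglongrightarrow> indicator C x"
        using LIMSEQ_ignore_initial_segment[OF bump_tendsto[OF cl False, of x], of n0] .
      from tendsto_mult[OF tendsto_const[of "g j x"] this]
      show "(\<lambda>n. g j x * ?\<phi> n x) \<longlonglongrightarrow> indicator C x * g j x" by (simp add: mult.commute)
    qed
    show "AE x in \<mu> j. norm (g j x * ?\<phi> n x) \<le> norm (g j x)" for n
      using bump_bounds[of "real (n + n0)" C] by (auto simp: abs_mult intro!: mult_left_le)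
  qed
  have "(\<lambda>n. \<Sum>j\<in>J. LINT x|\<mu> j. g j x * ?\<phi> n x) \<longlonglongrightarrow> (\<Sum>j\<in>J. LINT x|\<mu> j. indicator C x * g j x)"
    by (rule tendsto_sum) (rule lim)
  then show ?thesis unfolding z LIMSEQ_const_iff by (rule sym)
qed simp

lemma sets_borel_eq_closed_convex:
  "sets (borel :: 'a::euclidean_space measure) = sigma_sets UNIV {C. closed C \<and> convex C}"
proof -
  have *: "(borel :: 'a measure) = sigma UNIV {C. closed C \<and> convex C}"
  proof (rule borel_eq_sigmaI1[OF borel_eq_halfspace_le, where F = "\<lambda>x. x", simplified])
    fix X :: "'a set"
    assume "X \<in> (\<lambda>(a, i). {x. x \<bullet> i \<le> a}) ` (UNIV \<times> Basis)"
    then obtain a i where "X = {x. i \<bullet> x \<le> a}" by (auto simp: inner_commute)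
    then show "X \<in> sigma_sets UNIV {C. closed C \<and> convex C}"
      by (auto simp: closed_halfspace_le convex_halfspace_le)
  qed auto
  show ?thesis by (subst *) simp
qed

text \<open>The closed convex sets are stable under intersection and generate the Borel sets, so the
  \<open>\<pi>\<close>-\<open>\<lambda>\<close> theorem extends the previous lemma from compact convex subsets of \<open>U\<close> to their Borel parts.\<close>

lemma vanishing_functional:
  fixes \<mu> :: "'j \<Rightarrow> 'a::euclidean_space measure" and g :: "'j \<Rightarrow> 'a \<Rightarrow> real"
  assumes J: "finite J" and int: "\<And>j. j \<in> J \<Longrightarrow> integrable (\<mu> j) (g j)"
    and meas: "\<And>j. j \<in> J \<Longrightarrow> (\<lambda>x. x) \<in> measurable (\<mu> j) borel"
    and U: "open U"
    and zero: "\<And>\<phi> D. test_function U \<phi> D \<Longrightarrow> (\<Sum>j\<in>J. LINT x|\<mu> j. g j x * \<phi> x) = 0"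
    and C: "convex C" "compact C" "C \<subseteq> U" and A: "A \<in> sets borel"
  shows "(\<Sum>j\<in>J. LINT x|\<mu> j. indicator (A \<inter> C) x * g j x) = 0"
proof -
  have clC: "closed C" using C compact_imp_closed by blast
  have ii: "integrable (\<mu> j) (\<lambda>x. indicator B x * g j x)" if "j \<in> J" "B \<in> sets borel" for j B
  proof -
    have "B \<inter> space (\<mu> j) \<in> sets (\<mu> j)"
      using measurable_sets[OF meas[OF that(1)] that(2)] by (simp add: vimage_def Int_def)
    then have "integrable (\<mu> j) (\<lambda>x. indicator (B \<inter> space (\<mu> j)) x * g j x)"
      using integrable_mult_indicator[OF _ int[OF that(1)]] by simp
    then show ?thesis
      by (rule Bochner_Integration.integrable_cong[OF refl, THEN iffD1, rotated]) (auto simp: indicator_def)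
  qed
  have base: "(\<Sum>j\<in>J. LINT x|\<mu> j. indicator (B \<inter> C) x * g j x) = 0"
    if "closed B" "convex B" for B
    by (rule vanishing_functional_compact_convex[OF J int meas U zero])
       (use that C in \<open>auto intro: convex_Int compact_Int_closed closed_Int_compact\<close>)
  have "Int_stable {C::'a set. closed C \<and> convex C}"
    by (auto simp: Int_stable_def convex_Int)
  moreover have "{C::'a set. closed C \<and> convex C} \<subseteq> Pow UNIV" by simp
  moreover have "A \<in> sigma_sets UNIV {C. closed C \<and> convex C}"
    using A sets_borel_eq_closed_convex by auto
  ultimately show ?thesis
  proof (induction rule: sigma_sets_induct_disjoint)
    case (basic B) then show ?case using base by auto
  next
    case empty then show ?case by simp
  next
    case (compl B)
    then have B: "B \<in> sets borel" using sets_borel_eq_closed_convex by auto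
    have "(LINT x|\<mu> j. indicator ((UNIV - B) \<inter> C) x * g j x)
       = (LINT x|\<mu> j. indicator C x * g j x) - (LINT x|\<mu> j. indicator (B \<inter> C) x * g j x)"
      if "j \<in> J" for j
    proof -
      have "(LINT x|\<mu> j. indicator C x * g j x) - (LINT x|\<mu> j. indicator (B \<inter> C) x * g j x)
        = (LINT x|\<mu> j. indicator C x * g j x - indicator (B \<inter> C) x * g j x)"
        using ii[OF that] B clC by (intro Bochner_Integration.integral_diff[symmetric]) auto
      also have "\<dots> = (LINT x|\<mu> j. indicator ((UNIV - B) \<inter> C) x * g j x)"
        by (rule Bochner_Integration.integral_cong) (auto simp: indicator_def)
      finally show ?thesis by simp
    qed
    then show ?case
      using compl(2) base[of UNIV] by (simp add: sum_subtractf)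
  next
    case (union F)
    then have F: "F i \<in> sets borel" for i using sets_borel_eq_closed_convex by auto
    have s: "(\<lambda>i. LINT x|\<mu> j. indicator (F i \<inter> C) x * g j x) sums
             (LINT x|\<mu> j. indicator ((\<Union>i. F i) \<inter> C) x * g j x)" if "j \<in> J" for j
    proof -
      let ?A = "\<lambda>n. (\<Union>i<n. F i) \<inter> C"
      have part: "(\<Sum>i<n. LINT x|\<mu> j. indicator (F i \<inter> C) x * g j x)
          = (LINT x|\<mu> j. indicator (?A n) x * g j x)" for n
      proof -
        have "(\<Sum>i<n. LINT x|\<mu> j. indicator (F i \<inter> C) x * g j x)
          = (LINT x|\<mu> j. (\<Sum>i<n. indicator (F i \<inter> C) x * g j x))"
          using ii[OF that] F clC by (intro Bochner_Integration.integral_sum[symmetric]) auto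
        also have "\<dots> = (LINT x|\<mu> j. indicator (?A n) x * g j x)"
        proof (rule Bochner_Integration.integral_cong[OF refl])
          fix x
          have "disjoint_family_on (\<lambda>i. F i \<inter> C) {..<n}"
            using union(1) by (auto simp: disjoint_family_on_def)
          from indicator_UN_disjoint[OF _ this, of x]
          have "(\<Sum>i<n. indicator (F i \<inter> C) x) = (indicator (\<Union>i<n. F i \<inter> C) x :: real)"
            by (metis finite_lessThan)
          moreover have "(\<Union>i<n. F i \<inter> C) = ?A n" by auto
          ultimately have "(\<Sum>i<n. indicator (F i \<inter> C) x) = (indicator (?A n) x :: real)"
            by simp
          then show "(\<Sum>i<n. indicator (F i \<inter> C) x * g j x) = indicator (?A n) x * g j x"
            by (simp flip: sum_distrib_right)
        qed
        finally show ?thesis .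
      qed
      have "(\<lambda>n. LINT x|\<mu> j. indicator (?A n) x * g j x) \<longlonglongrightarrow>
             (LINT x|\<mu> j. indicator ((\<Union>i. F i) \<inter> C) x * g j x)"
      proof (rule integral_dominated_convergence[where w = "\<lambda>x. norm (g j x)"])
        show "(\<lambda>x. indicator ((\<Union>i. F i) \<inter> C) x * g j x) \<in> borel_measurable (\<mu> j)"
          using ii[OF that, of "(\<Union>i. F i) \<inter> C"] F clC by auto
        show "(\<lambda>x. indicator (?A n) x * g j x) \<in> borel_measurable (\<mu> j)" for n
          using ii[OF that, of "?A n"] F clC by auto
        show "integrable (\<mu> j) (\<lambda>x. norm (g j x))" using int[OF that] by auto
        show "AE x in \<mu> j. (\<lambda>n. indicator (?A n) x * g j x) \<longlonglongrightarrow> indicator ((\<Union>i. F i) \<inter> C) x * g j x"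
        proof (rule AE_I2)
          fix x
          have "(\<lambda>n. indicator (?A n) x) \<longlonglongrightarrow> (indicator (\<Union>n. ?A n) x :: real)"
            by (rule LIMSEQ_indicator_incseq) (force simp: incseq_def)
          moreover have "(\<Union>n. ?A n) = (\<Union>i. F i) \<inter> C" by auto
          ultimately show "(\<lambda>n. indicator (?A n) x * g j x) \<longlonglongrightarrow> indicator ((\<Union>i. F i) \<inter> C) x * g j x"
            by (intro tendsto_mult) auto
        qed
        show "AE x in \<mu> j. norm (indicator (?A n) x * g j x) \<le> norm (g j x)" for n
          by (auto simp: indicator_def)
      qed
      then show ?thesis unfolding sums_def part .
    qed
    have "(\<lambda>i. \<Sum>j\<in>J. LINT x|\<mu> j. indicator (F i \<inter> C) x * g j x) sums
          (\<Sum>j\<in>J. LINT x|\<mu> j. indicator ((\<Union>i. F i) \<inter> C) x * g j x)"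
      by (rule sums_sum) (rule s)
    then have "(\<lambda>i::nat. 0) sums (\<Sum>j\<in>J. LINT x|\<mu> j. indicator ((\<Union>i. F i) \<inter> C) x * g j x)"
      unfolding union(3) .
    then show ?case by (rule sums_unique2[OF _ sums_zero])
  qed
qed

lemma AE_eq_zero_of_set_integrals:
  fixes g :: "'a \<Rightarrow> real"
  assumes int: "integrable M g"
    and zero: "\<And>A. A \<in> sets M \<Longrightarrow> (LINT x|M. indicator A x * g x) = 0"
  shows "AE x in M. g x = 0"
proof -
  have [measurable]: "g \<in> borel_measurable M" using int by auto
  have half: "AE x in M. \<not> 0 < s * g x" if s: "s = 1 \<or> s = -1" for s :: real
  proof -
    let ?A = "{x \<in> space M. 0 < s * g x}"
    have A: "?A \<in> sets M" by measurable
    have "integrable M (\<lambda>x. s * (indicator ?A x * g x))"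
      using integrable_mult_indicator[OF A int] by simp
    moreover have "(LINT x|M. s * (indicator ?A x * g x)) = 0"
      using zero[OF A] by simp
    ultimately have "AE x in M. s * (indicator ?A x * g x) = 0"
      by (subst (asm) integral_nonneg_eq_0_iff_AE) (auto simp: indicator_def)
    then show ?thesis
      using AE_space by eventually_elim (auto simp: indicator_def split: if_splits)
  qed
  have "AE x in M. \<not> 0 < g x" "AE x in M. \<not> 0 < - g x"
    using half[of 1] half[of "-1"] by simp_all
  then show ?thesis by eventually_elim auto
qed

lemma AE_open_of_cbox:
  fixes U :: "'a::euclidean_space set"
  assumes "open U" and "\<And>a b. cbox a b \<subseteq> U \<Longrightarrow> AE x in M. x \<in> cbox a b \<longrightarrow> P x"
  shows "AE x in M. x \<in> U \<longrightarrow> P x"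
proof -
  obtain \<D> where D: "countable \<D>" "\<D> \<subseteq> Pow U" "\<And>X. X \<in> \<D> \<Longrightarrow> \<exists>a b. X = cbox a b" "\<Union>\<D> = U"
    using open_countable_Union_open_cbox[OF assms(1)] by metis
  have "\<forall>X\<in>\<D>. AE x in M. x \<in> X \<longrightarrow> P x"
  proof
    fix X assume X: "X \<in> \<D>"
    then obtain a b where "X = cbox a b" using D(3) by blast
    with X D(2) show "AE x in M. x \<in> X \<longrightarrow> P x" using assms(2)[of a b] by auto
  qed
  then have "AE x in M. \<forall>X\<in>\<D>. x \<in> X \<longrightarrow> P x"
    by (subst AE_ball_countable[OF D(1)])
  then show ?thesis unfolding D(4)[symmetric] by eventually_elim auto
qed

section \<open>Square-integrable functions and the surface measure\<close>

lemma square_integrable_inner: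
  fixes v w :: "'a \<Rightarrow> 'b::euclidean_space"
  assumes "square_integrable M v" "square_integrable M w"
  shows "integrable M (\<lambda>x. v x \<bullet> w x)"
proof (rule Bochner_Integration.integrable_bound)
  have [measurable]: "v \<in> borel_measurable M" "w \<in> borel_measurable M"
    using assms by (auto simp: square_integrable_def)
  show "integrable M (\<lambda>x. (norm (v x))\<^sup>2 + (norm (w x))\<^sup>2)"
    using assms by (auto simp: square_integrable_def)
  show "(\<lambda>x. v x \<bullet> w x) \<in> borel_measurable M" by measurable
  show "AE x in M. norm (v x \<bullet> w x) \<le> norm ((norm (v x))\<^sup>2 + (norm (w x))\<^sup>2)"
  proof (rule AE_I2)
    fix x
    have "norm (v x \<bullet> w x) \<le> norm (v x) * norm (w x)" by (simp add: Cauchy_Schwarz_ineq2)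
    also have "\<dots> \<le> (norm (v x))\<^sup>2 + (norm (w x))\<^sup>2"
      using sum_squares_bound[of "norm (v x)" "norm (w x)"]
        mult_nonneg_nonneg[OF norm_ge_zero[of "v x"] norm_ge_zero[of "w x"]] by linarith
    finally show "norm (v x \<bullet> w x) \<le> norm ((norm (v x))\<^sup>2 + (norm (w x))\<^sup>2)" by simp
  qed
qed

lemma square_integrable_mult:
  fixes v w :: "'a \<Rightarrow> real"
  assumes "square_integrable M v" "square_integrable M w"
  shows "integrable M (\<lambda>x. v x * w x)"
  using square_integrable_inner[OF assms] by simp

lemma square_integrable_add:
  fixes v w :: "'a \<Rightarrow> 'b::euclidean_space"
  assumes "square_integrable M v" "square_integrable M w"
  shows "square_integrable M (\<lambda>x. v x + w x)"
proof -
  have [measurable]: "v \<in> borel_measurable M" "w \<in> borel_measurable M"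
    using assms by (auto simp: square_integrable_def)
  have "(\<lambda>x. (norm (v x + w x))\<^sup>2) = (\<lambda>x. (norm (v x))\<^sup>2 + 2 * (v x \<bullet> w x) + (norm (w x))\<^sup>2)"
    by (auto simp: power2_norm_eq_inner inner_add inner_commute)
  moreover have "integrable M (\<lambda>x. (norm (v x))\<^sup>2 + 2 * (v x \<bullet> w x) + (norm (w x))\<^sup>2)"
    using assms square_integrable_inner[OF assms] by (auto simp: square_integrable_def)
  ultimately show ?thesis by (simp add: square_integrable_def)
qed

lemma square_integrable_scaleR:
  fixes v :: "'a \<Rightarrow> 'b::euclidean_space"
  assumes "square_integrable M v"
  shows "square_integrable M (\<lambda>x. c *\<^sub>R v x)"
  using assms by (auto simp: square_integrable_def power_mult_distrib)

lemma square_integrable_cmult: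
  fixes v :: "'a \<Rightarrow> real"
  assumes "square_integrable M v"
  shows "square_integrable M (\<lambda>x. c * v x)"
  using square_integrable_scaleR[OF assms, of c] by simp

lemma square_integrable_zero [simp]: "square_integrable M (\<lambda>x. 0)"
  by (simp add: square_integrable_def)

lemma square_integrable_sum:
  fixes v :: "'i \<Rightarrow> 'a \<Rightarrow> 'b::euclidean_space"
  assumes "\<And>i. i \<in> I \<Longrightarrow> square_integrable M (v i)"
  shows "square_integrable M (\<lambda>x. \<Sum>i\<in>I. v i x)"
  using assms
  by (induction I rule: infinite_finite_induct) (auto intro: square_integrable_add)

lemma square_integrable_bounded:
  fixes v :: "'a \<Rightarrow> 'b::euclidean_space"
  assumes "finite_measure M" "v \<in> borel_measurable M" "AE x in M. norm (v x) \<le> B"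
  shows "square_integrable M v"
  unfolding square_integrable_def
proof
  interpret finite_measure M by fact
  have [measurable]: "v \<in> borel_measurable M" by fact
  show "integrable M (\<lambda>x. (norm (v x))\<^sup>2)"
  proof (rule integrable_const_bound)
    show "AE x in M. norm ((norm (v x))\<^sup>2) \<le> B\<^sup>2"
      using assms(3) by eventually_elim (simp add: power_mono)
  qed measurable
qed fact

lemma square_integrable_imp_integrable:
  fixes v :: "'a \<Rightarrow> real"
  assumes "finite_measure M" "square_integrable M v"
  shows "integrable M v"
proof -
  interpret finite_measure M by fact
  have "square_integrable M (\<lambda>x. 1 :: real)"
    by (rule square_integrable_bounded[OF assms(1), of _ 1]) auto
  from square_integrable_mult[OF assms(2) this] show ?thesis by simp
qed

lemma square_integrable_cong_AE:
  fixes v w :: "'a \<Rightarrow> 'b::euclidean_space"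
  assumes "square_integrable M v" "w \<in> borel_measurable M" "AE x in M. v x = w x"
  shows "square_integrable M w"
  unfolding square_integrable_def
proof
  have [measurable]: "v \<in> borel_measurable M" "w \<in> borel_measurable M"
    using assms by (auto simp: square_integrable_def)
  have "integrable M (\<lambda>x. (norm (v x))\<^sup>2) \<longleftrightarrow> integrable M (\<lambda>x. (norm (w x))\<^sup>2)"
    by (rule Bochner_Integration.integrable_cong_AE)
       (use assms(3) in \<open>auto elim: eventually_mono\<close>)
  then show "integrable M (\<lambda>x. (norm (w x))\<^sup>2)" using assms(1) by (simp add: square_integrable_def)
qed fact

lemma AE_zero_of_square_integral_zero:
  fixes v :: "'a \<Rightarrow> 'b::euclidean_space"
  assumes "square_integrable M v" "(LINT x|M. v x \<bullet> v x) = 0"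
  shows "AE x in M. v x = 0"
proof -
  have "AE x in M. v x \<bullet> v x = 0"
    using assms(2) square_integrable_inner[OF assms(1,1)]
    by (subst (asm) integral_nonneg_eq_0_iff_AE) auto
  then show ?thesis by simp
qed

lemma finite_measure_lebesgue_on_compact:
  fixes K :: "'a::euclidean_space set"
  assumes "compact K" shows "finite_measure (lebesgue_on K)"
  using assms lmeasurable_compact finite_measure_lebesgue_on by blast

lemma square_integrable_lebesgue_on_continuous:
  fixes f :: "'a::euclidean_space \<Rightarrow> 'b::euclidean_space"
  assumes "continuous_on UNIV f" "bounded S" "S \<in> sets lebesgue"
  shows "square_integrable (lebesgue_on S) f"
proof -
  have "compact (f ` closure S)"
    using assms by (intro compact_continuous_image) (auto intro: continuous_on_subset)
  then obtain B where B: "\<And>x. x \<in> closure S \<Longrightarrow> norm (f x) \<le> B"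
    using compact_imp_bounded bounded_iff by (metis imageI)
  have "S \<in> lmeasurable" using assms bounded_set_imp_lmeasurable by blast
  then have "finite_measure (lebesgue_on S)" by (rule finite_measure_lebesgue_on)
  moreover have "f \<in> borel_measurable (lebesgue_on S)"
    using assms continuous_on_subset
    by (intro continuous_imp_measurable_on_sets_lebesgue) auto
  moreover have "AE x in lebesgue_on S. norm (f x) \<le> B"
    using B closure_subset by (intro AE_I2) (auto simp: space_restrict_space)
  ultimately show ?thesis by (rule square_integrable_bounded)
qed

lemma sets_surface_measure [simp, measurable_cong]: "sets (surface_measure e) = sets borel"
  by (simp add: surface_measure_def)

lemma space_surface_measure [simp]: "space (surface_measure e) = UNIV"
  by (simp add: surface_measure_def)

text \<open>The prism of height one around the flat face \<open>e\<close>, on which the surface measure of \<open>e\<close> lives before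
  it is projected to the affine hull of \<open>e\<close>.\<close>

definition slab :: "'a::euclidean_space set \<Rightarrow> 'a set" where
  "slab e = {y. closest_point (affine hull e) y \<in> e \<and> dist y (closest_point (affine hull e) y) \<le> 1/2}"

lemma surface_measure_slab:
  "surface_measure e = distr (lebesgue_on (slab e)) borel (closest_point (affine hull e))"
  by (simp add: surface_measure_def slab_def)

context
  fixes e :: "'a::euclidean_space set"
  assumes e: "compact e" "e \<noteq> {}"
begin

lemma continuous_on_proj: "continuous_on S (closest_point (affine hull e))"
  by (rule continuous_on_closest_point) (use e in \<open>auto simp: affine_imp_convex\<close>)

lemma compact_slab: "compact (slab e)"
proof -
  have "closed (closest_point (affine hull e) -` e)"
    by (rule closed_vimage) (use e in \<open>auto simp: compact_imp_closed continuous_on_proj\<close>)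
  moreover have "closed {y. dist y (closest_point (affine hull e) y) \<le> 1/2}"
    by (intro closed_Collect_le continuous_intros continuous_on_proj)
  moreover have "slab e = closest_point (affine hull e) -` e \<inter> {y. dist y (closest_point (affine hull e) y) \<le> 1/2}"
    by (auto simp: slab_def)
  ultimately have "closed (slab e)" by (metis closed_Int)
  moreover obtain B where B: "\<And>x. x \<in> e \<Longrightarrow> norm x \<le> B"
    using compact_imp_bounded[OF e(1)] bounded_iff by blast
  have "norm y \<le> B + 1/2" if "y \<in> slab e" for y
    using that B norm_triangle_ineq[of "closest_point (affine hull e) y" "y - closest_point (affine hull e) y"]
    by (fastforce simp: slab_def dist_norm)
  then have "bounded (slab e)" unfolding bounded_iff by blast
  ultimately show ?thesis by (simp add: compact_eq_bounded_closed)
qed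

lemma measurable_proj: "closest_point (affine hull e) \<in> borel_measurable (lebesgue_on (slab e))"
  using continuous_on_proj compact_slab
  by (intro continuous_imp_measurable_on_sets_lebesgue) (auto simp: lmeasurable_compact fmeasurableD)

lemma finite_surface_measure: "finite_measure (surface_measure e)"
  unfolding surface_measure_slab
  using finite_measure.finite_measure_distr[OF finite_measure_lebesgue_on_compact[OF compact_slab] measurable_proj] .

lemma AE_surface_measure_iff:
  assumes "{x. P x} \<in> sets borel"
  shows "(AE x in surface_measure e. P x) \<longleftrightarrow> (AE y in lebesgue. y \<in> slab e \<longrightarrow> P (closest_point (affine hull e) y))"
proof -
  have "slab e \<in> sets lebesgue" using compact_slab by (simp add: lmeasurable_compact fmeasurableD)
  then show ?thesis
  unfolding surface_measure_slab
  by (subst AE_distr_iff[OF measurable_proj]) (use assms in \<open>auto simp: AE_restrict_space_iff\<close>)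
qed

lemma AE_surface_measure_mem: "AE x in surface_measure e. x \<in> e"
  by (subst AE_surface_measure_iff) (use e in \<open>auto simp: slab_def compact_imp_closed\<close>)

lemma square_integrable_surface_continuous:
  fixes f :: "'a \<Rightarrow> 'b::euclidean_space"
  assumes "continuous_on UNIV f"
  shows "square_integrable (surface_measure e) f"
proof -
  have "compact (f ` e)"
    using assms e by (intro compact_continuous_image) (auto intro: continuous_on_subset)
  then obtain B where B: "\<And>x. x \<in> e \<Longrightarrow> norm (f x) \<le> B"
    using compact_imp_bounded bounded_iff by (metis imageI)
  show ?thesis
  proof (rule square_integrable_bounded[OF finite_surface_measure])
    show "f \<in> borel_measurable (surface_measure e)"
      using borel_measurable_continuous_onI[OF assms] by simp
    show "AE x in surface_measure e. norm (f x) \<le> B"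
      using AE_surface_measure_mem by eventually_elim (rule B)
  qed
qed

end

lemma closest_point_hyperplane:
  fixes a :: "'a::euclidean_space"
  assumes "a \<noteq> 0"
  shows "closest_point {x. a \<bullet> x = b} y = y - ((a \<bullet> y - b) / (a \<bullet> a)) *\<^sub>R a"
proof (rule closest_point_unique[symmetric])
  let ?z = "y - ((a \<bullet> y - b) / (a \<bullet> a)) *\<^sub>R a"
  show "convex {x. a \<bullet> x = b}" "closed {x. a \<bullet> x = b}"
    by (simp_all add: convex_hyperplane closed_hyperplane)
  show "?z \<in> {x. a \<bullet> x = b}" using assms by (simp add: inner_diff_right)
  show "\<forall>h\<in>{x. a \<bullet> x = b}. dist y ?z \<le> dist y h"
  proof
    fix h assume "h \<in> {x. a \<bullet> x = b}"
    then have "\<bar>a \<bullet> y - b\<bar> = \<bar>a \<bullet> (y - h)\<bar>" by (simp add: inner_diff_right)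
    also have "\<dots> \<le> norm a * dist y h" unfolding dist_norm by (rule Cauchy_Schwarz_ineq2)
    finally have "\<bar>a \<bullet> y - b\<bar> / norm a \<le> dist y h" using assms by (simp add: field_simps)
    moreover have "dist y ?z = \<bar>a \<bullet> y - b\<bar> / norm a"
      using assms by (simp add: dist_norm abs_divide power2_norm_eq_inner[symmetric] power2_eq_square)
    ultimately show "dist y ?z \<le> dist y h" by simp
  qed
qed

lemma negligible_aff_dim:
  fixes S :: "'a::euclidean_space set"
  assumes "aff_dim S < DIM('a)"
  shows "negligible S"
proof -
  have "interior (affine hull S) = {}"
    by (rule low_dim_interior) (use assms in \<open>simp\<close>)
  then have "negligible (affine hull S)"
    by (simp add: negligible_convex_interior affine_imp_convex)
  then show ?thesis using hull_subset negligible_subset by metis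
qed

text \<open>The orthogonal projection onto a hyperplane pulls a set of codimension two in the whole space
  back into an affine set of codimension one, hence into a null set.\<close>

lemma AE_surface_measure_not_mem:
  fixes e A :: "'a::euclidean_space set"
  assumes e: "compact e" "e \<noteq> {}" "aff_dim e = int DIM('a) - 1"
    and A: "closed A" "aff_dim A \<le> int DIM('a) - 2"
  shows "AE x in surface_measure e. x \<notin> A"
proof -
  obtain a b where a: "a \<noteq> 0" and H: "affine hull e = {x. a \<bullet> x = b}"
    using e(3) aff_dim_eq_hyperplane[of e] by auto
  have "{x. x \<notin> A} \<in> sets borel" using A(1) by (simp add: Compl_eq[symmetric])
  moreover have "negligible {y. closest_point (affine hull e) y \<in> A}"
  proof (cases "A = {}")
    case False
    then obtain l where l: "l \<in> A" by blast
    have "{y. closest_point (affine hull e) y \<in> A} \<subseteq> affine hull (insert (l + a) A)"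
    proof
      fix y assume "y \<in> {y. closest_point (affine hull e) y \<in> A}"
      then have p: "y - ((a \<bullet> y - b) / (a \<bullet> a)) *\<^sub>R a \<in> A" (is "y - ?t *\<^sub>R a \<in> A")
        unfolding H closest_point_hyperplane[OF a] by simp
      let ?L = "affine hull (insert (l + a) A)"
      have "1 *\<^sub>R (y - ?t *\<^sub>R a) + ?t *\<^sub>R (l + a) + (- ?t) *\<^sub>R l \<in> ?L"
        by (rule mem_affine_3) (use p l in \<open>auto intro: hull_inc\<close>)
      then show "y \<in> ?L" by (simp add: algebra_simps)
    qed
    moreover have "negligible (affine hull (insert (l + a) A))"
      by (rule negligible_aff_dim) (use A(2) in \<open>simp add: aff_dim_insert\<close>)
    ultimately show ?thesis using negligible_subset by blast
  qed simp
  then have "AE y in lebesgue. \<not> closest_point (affine hull e) y \<in> A"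
    by (simp add: negligible_iff_null_sets completion.AE_iff_null_sets AE_iff_null_sets
        eventually_ae_filter) blast
  ultimately show ?thesis
    by (subst AE_surface_measure_iff[OF e(1,2)]) auto
qed

section \<open>Weak divergence and normal traces on a cell\<close>

lemma AE_lebesgue_on_eq_zero:
  fixes S U :: "'a::euclidean_space set"
  assumes S: "S \<in> sets lebesgue" and int: "integrable (lebesgue_on S) g" and U: "open U"
    and zero: "\<And>A C. A \<in> sets borel \<Longrightarrow> convex C \<Longrightarrow> compact C \<Longrightarrow> C \<subseteq> U \<Longrightarrow>
      (LINT x|lebesgue_on S. indicator (A \<inter> C) x * g x) = 0"
  shows "AE x in lebesgue_on S. x \<in> U \<longrightarrow> g x = (0::real)"
proof (rule AE_open_of_cbox[OF U])
  fix a b :: 'a assume ab: "cbox a b \<subseteq> U"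
  let ?C = "cbox a b" let ?M = "lebesgue_on S"
  have C: "?C \<inter> S \<in> sets ?M" using S by (auto simp: sets_restrict_space)
  have "AE x in ?M. indicator (?C \<inter> S) x * g x = 0"
  proof (rule AE_eq_zero_of_set_integrals)
    show "integrable ?M (\<lambda>x. indicator (?C \<inter> S) x * g x)"
      using integrable_mult_indicator[OF C int] by simp
    fix A assume A: "A \<in> sets ?M"
    then have "A \<in> sets lebesgue" using S by (auto simp: sets_restrict_space)
    then obtain B N N' where B: "A = B \<union> N" "N \<subseteq> N'" "N' \<in> null_sets lborel" "B \<in> sets lborel"
      using sets_completionE[of A lborel] by metis
    have "AE x in lborel. x \<notin> N'" using B(3) by (rule AE_not_in)
    then have "AE x in lebesgue. x \<notin> N'" by (rule AE_completion)
    then have "AE x in ?M. x \<notin> N'" using S by (auto simp: AE_restrict_space_iff elim: eventually_mono)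
    then have "AE x in ?M. indicator A x * (indicator (?C \<inter> S) x * g x) = indicator (B \<inter> ?C) x * g x"
      using AE_space
    proof eventually_elim
      case (elim x)
      then show ?case using B(1,2) by (auto simp: indicator_def space_restrict_space)
    qed
    moreover have "(\<lambda>x. indicator A x * (indicator (?C \<inter> S) x * g x)) \<in> borel_measurable ?M"
      using int C A by (intro borel_measurable_times borel_measurable_indicator) auto
    moreover have "(\<lambda>x. indicator (B \<inter> ?C) x * g x) \<in> borel_measurable ?M"
    proof (intro borel_measurable_times)
      have "indicator (B \<inter> ?C) \<in> borel_measurable (borel :: 'a measure)"
        using B(4) by (intro borel_measurable_indicator) auto
      then show "indicator (B \<inter> ?C) \<in> borel_measurable ?M"
        by (intro measurable_restrict_space1 measurable_completion) simp
    qed (use int in auto)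
    ultimately have "(LINT x|?M. indicator A x * (indicator (?C \<inter> S) x * g x)) =
        (LINT x|?M. indicator (B \<inter> ?C) x * g x)"
      by (intro integral_cong_AE) auto
    also have "\<dots> = 0" using B(4) ab by (intro zero) auto
    finally show "(LINT x|?M. indicator A x * (indicator (?C \<inter> S) x * g x)) = 0" .
  qed
  then show "AE x in ?M. x \<in> ?C \<longrightarrow> g x = 0"
    using AE_space by eventually_elim (auto simp: indicator_def space_restrict_space)
qed

lemma measurable_ident_lebesgue_on: "(\<lambda>x. x) \<in> measurable (lebesgue_on S) borel"
  by (intro measurable_restrict_space1 measurable_completion) simp

lemma test_functionD:
  assumes "test_function S \<phi> D"
  shows "C1_gradient \<phi> D" "continuous_on UNIV \<phi>" "continuous_on UNIV D"
    "\<And>x. x \<notin> interior S \<Longrightarrow> \<phi> x = 0" "\<And>x. x \<notin> interior S \<Longrightarrow> D x = 0"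
proof -
  show C: "C1_gradient \<phi> D" and "continuous_on UNIV \<phi>" and cD: "continuous_on UNIV D"
    using assms C1_gradient_continuous by (auto simp: test_function_def C1_gradient_def)
  have sub: "closure {x. \<phi> x \<noteq> 0} \<subseteq> interior S" using assms by (simp add: test_function_def)
  then show "x \<notin> interior S \<Longrightarrow> \<phi> x = 0" for x
    using closure_subset[of "{x. \<phi> x \<noteq> 0}"] by auto
  show "D x = 0" if "x \<notin> interior S" for x
  proof -
    let ?V = "- closure {x. \<phi> x \<noteq> 0}"
    have x: "open ?V" "x \<in> ?V" using sub that by auto
    have z: "\<phi> y = 0" if "y \<in> ?V" for y using that closure_subset[of "{x. \<phi> x \<noteq> 0}"] by auto
    have "(\<phi> has_derivative (\<lambda>h. h \<bullet> D x)) (at x)" using C by (simp add: C1_gradient_def gderiv_def)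
    moreover have "(\<phi> has_derivative (\<lambda>h. 0)) (at x)"
    proof (rule has_derivative_transform_within_open[OF _ x])
      show "((\<lambda>_. 0) has_derivative (\<lambda>h. 0)) (at x)" by (rule has_derivative_const)
      show "0 = \<phi> y" if "y \<in> ?V" for y using z[OF that] by (rule sym)
    qed
    ultimately have "(\<lambda>h. h \<bullet> D x) = (\<lambda>h. 0)" by (rule has_derivative_unique)
    then have "D x \<bullet> D x = 0" by metis
    then show ?thesis by simp
  qed
qed

text \<open>The weak divergence is unique up to null sets in the interior, also when the field is changed
  on a null set.\<close>

lemma weak_div_unique:
  fixes S :: "'a::euclidean_space set"
  assumes S: "bounded S" "S \<in> sets lebesgue"
    and v: "has_weak_div S v w" "has_weak_div S v' w'" and eq: "AE x in lebesgue_on S. v x = v' x"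
  shows "AE x in lebesgue_on S. x \<in> interior S \<longrightarrow> w x = w' x"
proof -
  let ?M = "lebesgue_on S"
  have finM: "finite_measure ?M"
    using S bounded_set_imp_lmeasurable finite_measure_lebesgue_on by blast
  have sq: "square_integrable ?M w" "square_integrable ?M w'" "square_integrable ?M v" "square_integrable ?M v'"
    using v by (auto simp: has_weak_div_def)
  have int: "integrable ?M (\<lambda>x. w x - w' x)"
    using sq square_integrable_imp_integrable[OF finM] by auto
  have zero: "(\<Sum>j\<in>{()}. LINT x|?M. (w x - w' x) * \<phi> x) = 0" if t: "test_function (interior S) \<phi> D" for \<phi> D
  proof -
    have t': "test_function S \<phi> D" using t by (simp add: test_function_def)
    have sqD: "square_integrable ?M \<phi>"
      by (rule square_integrable_lebesgue_on_continuous[OF _ S]) (use test_functionD[OF t'] in auto)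
    have "D \<in> borel_measurable ?M"
      using square_integrable_lebesgue_on_continuous[OF _ S] test_functionD[OF t'] by (auto simp: square_integrable_def)
    then have "(LINT x|?M. v x \<bullet> D x) = (LINT x|?M. v' x \<bullet> D x)"
      using eq sq by (intro integral_cong_AE) (auto simp: square_integrable_def elim: eventually_mono)
    then have "(LINT x|?M. w x * \<phi> x) = (LINT x|?M. w' x * \<phi> x)"
      using v t' by (simp add: has_weak_div_def)
    then show ?thesis
      using square_integrable_mult[OF sq(1) sqD] square_integrable_mult[OF sq(2) sqD]
      by (simp add: left_diff_distrib)
  qed
  have "AE x in ?M. x \<in> interior S \<longrightarrow> w x - w' x = 0"
  proof (rule AE_lebesgue_on_eq_zero[OF S(2) int open_interior])
    fix A C :: "'a set"
    assume "A \<in> sets borel" "convex C" "compact C" "C \<subseteq> interior S"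
    then have "(\<Sum>j\<in>{()}. LINT x|?M. indicator (A \<inter> C) x * (w x - w' x)) = 0"
      by (intro vanishing_functional[where U = "interior S"])
         (use int measurable_ident_lebesgue_on zero in auto)
    then show "(LINT x|?M. indicator (A \<inter> C) x * (w x - w' x)) = 0" by simp
  qed
  then show ?thesis by eventually_elim auto
qed

lemma AE_lebesgue_on_interior:
  fixes K :: "'a::euclidean_space set"
  assumes "convex K" "compact K"
  shows "AE x in lebesgue_on K. x \<in> interior K"
proof -
  have "negligible (frontier K)" using assms by (simp add: negligible_convex_frontier)
  then have "AE x in lebesgue. x \<notin> frontier K"
    by (auto simp: negligible_iff_null_sets intro: AE_not_in)
  moreover have "K \<in> sets lebesgue" using assms by (simp add: lmeasurable_compact fmeasurableD)
  ultimately show ?thesis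
    using assms(2) closure_closed[OF compact_imp_closed[OF assms(2)]]
    by (auto simp: AE_restrict_space_iff frontier_def elim: eventually_mono)
qed

text \<open>\<open>green_data K v w \<gamma>\<close>: the field \<open>v\<close> has weak divergence \<open>w\<close> on \<open>K\<close> and normal trace \<open>\<gamma>\<close> on the facets,
  related by Green's formula for all \<open>C\<^sup>1\<close> functions on the whole space.  Keeping \<open>w\<close> as an argument
  makes the relation linear in \<open>(v, w, \<gamma>)\<close>.\<close>

definition green_data ::
    "'a::euclidean_space set \<Rightarrow> ('a \<Rightarrow> 'a) \<Rightarrow> ('a \<Rightarrow> real) \<Rightarrow> ('a set \<Rightarrow> 'a \<Rightarrow> real) \<Rightarrow> bool" where
  "green_data K v w \<gamma> \<longleftrightarrow> has_weak_div K v w \<and>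
     (\<forall>e\<in>facets K. square_integrable (surface_measure e) (\<gamma> e)) \<and>
     (\<forall>\<phi> D. C1_gradient \<phi> D \<longrightarrow>
        (LINT x|lebesgue_on K. v x \<bullet> D x) + (LINT x|lebesgue_on K. w x * \<phi> x)
          = (\<Sum>e\<in>facets K. LINT x|surface_measure e. \<gamma> e x * \<phi> x))"

lemma has_normal_trace_iff_green: "has_normal_trace K v \<gamma> \<longleftrightarrow> (\<exists>w. green_data K v w \<gamma>)"
  by (auto simp: has_normal_trace_def green_data_def)

lemma integral_cong_lebesgue_on_AE:
  fixes f g :: "'a::euclidean_space \<Rightarrow> real"
  assumes "integrable (lebesgue_on K) f" "integrable (lebesgue_on K) g"
    "AE x in lebesgue_on K. f x = g x"
  shows "(LINT x|lebesgue_on K. f x) = (LINT x|lebesgue_on K. g x)"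
  using assms by (intro integral_cong_AE) auto

text \<open>A mesh cell in isolation: a full-dimensional polytope.\<close>

locale cell =
  fixes K :: "'a::euclidean_space set"
  assumes polytope: "polytope K" and interior_ne: "interior K \<noteq> {}"
begin

lemma compact_cell: "compact K" and convex_cell: "convex K" and closed_cell: "closed K"
  and bounded_cell: "bounded K" and sets_cell [measurable]: "K \<in> sets lebesgue"
  using polytope_imp_compact[OF polytope] polytope_imp_convex[OF polytope]
    polytope_imp_closed[OF polytope] polytope_imp_bounded[OF polytope]
    fmeasurableD[OF lmeasurable_compact[OF polytope_imp_compact[OF polytope]]]
  by auto

lemma aff_dim_cell: "aff_dim K = DIM('a)"
  using interior_ne by (simp add: aff_dim_nonempty_interior)

lemma finite_facets: "finite (facets K)"
  unfolding facets_def
  using finite_polytope_faces[OF polytope] by (rule rev_finite_subset) (auto simp: facet_of_imp_face_of)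

lemma facet_facts:
  assumes "e \<in> facets K"
  shows "e facet_of K" "e face_of K" "polytope e" "compact e" "e \<noteq> {}" "convex e" "closed e" "e \<subseteq> K"
    "aff_dim e = int DIM('a) - 1" "e \<noteq> K"
proof -
  show f: "e facet_of K" using assms by (simp add: facets_def)
  then show g: "e face_of K" and "e \<noteq> {}" and "e \<subseteq> K" by (auto simp: facet_of_def facet_of_imp_subset)
  show "polytope e" using g polytope face_of_polytope_polytope by blast
  then show "compact e" "convex e" "closed e"
    by (auto simp: polytope_imp_compact polytope_imp_convex polytope_imp_closed)
  show "aff_dim e = int DIM('a) - 1" using f aff_dim_cell by (simp add: facet_of_def)
  then show "e \<noteq> K" using aff_dim_cell by auto
qed

lemma square_integrable_cell_continuous:
  fixes f :: "'a \<Rightarrow> 'b::euclidean_space"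
  shows "continuous_on UNIV f \<Longrightarrow> square_integrable (lebesgue_on K) f"
  by (rule square_integrable_lebesgue_on_continuous) (use bounded_cell sets_cell in auto)

lemma finite_measure_cell: "finite_measure (lebesgue_on K)"
  by (rule finite_measure_lebesgue_on_compact[OF compact_cell])

lemma finite_measure_facet: "e \<in> facets K \<Longrightarrow> finite_measure (surface_measure e)"
  by (rule finite_surface_measure) (auto dest: facet_facts)

lemma square_integrable_facet_continuous:
  fixes f :: "'a \<Rightarrow> 'b::euclidean_space"
  shows "e \<in> facets K \<Longrightarrow> continuous_on UNIV f \<Longrightarrow> square_integrable (surface_measure e) f"
  by (rule square_integrable_surface_continuous) (auto dest: facet_facts)

lemma AE_facet_other:
  assumes "e \<in> facets K" "closed A" "aff_dim A \<le> int DIM('a) - 2"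
  shows "AE x in surface_measure e. x \<notin> A"
  by (rule AE_surface_measure_not_mem) (use assms facet_facts[OF assms(1)] in auto)

lemma weak_div_cell_unique:
  assumes "has_weak_div K v w" "has_weak_div K v' w'" "AE x in lebesgue_on K. v x = v' x"
  shows "AE x in lebesgue_on K. w x = w' x"
  using weak_div_unique[OF bounded_cell sets_cell assms] AE_lebesgue_on_interior[OF convex_cell compact_cell]
  by eventually_elim auto

lemma wdiv_cell: "has_weak_div K v w \<Longrightarrow> has_weak_div K v (wdiv K v)"
  unfolding wdiv_def by (rule someI[of "has_weak_div K v"])

lemma wdiv_cell_AE: "has_weak_div K v w \<Longrightarrow> AE x in lebesgue_on K. wdiv K v x = w x"
  by (rule weak_div_cell_unique[OF wdiv_cell]) auto

lemma has_weak_div_linear: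
  assumes "has_weak_div K v w" "has_weak_div K v' w'"
  shows "has_weak_div K (\<lambda>x. v x + c *\<^sub>R v' x) (\<lambda>x. w x + c * w' x)"
proof -
  have sq: "square_integrable (lebesgue_on K) v" "square_integrable (lebesgue_on K) v'"
      "square_integrable (lebesgue_on K) w" "square_integrable (lebesgue_on K) w'"
    using assms by (auto simp: has_weak_div_def)
  show ?thesis
    unfolding has_weak_div_def
  proof (intro conjI allI impI)
    show "square_integrable (lebesgue_on K) (\<lambda>x. v x + c *\<^sub>R v' x)"
      "square_integrable (lebesgue_on K) (\<lambda>x. w x + c * w' x)"
      by (intro square_integrable_add square_integrable_scaleR square_integrable_cmult sq)+
    fix \<phi> :: "'a \<Rightarrow> real" and D assume t: "test_function K \<phi> D"
    note s\<phi> = square_integrable_cell_continuous[OF test_functionD(2)[OF t]]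
    note sD = square_integrable_cell_continuous[OF test_functionD(3)[OF t]]
    show "(LINT x|lebesgue_on K. (v x + c *\<^sub>R v' x) \<bullet> D x) = - (LINT x|lebesgue_on K. (w x + c * w' x) * \<phi> x)"
      using assms t square_integrable_inner[OF sq(1) sD] square_integrable_inner[OF sq(2) sD]
        square_integrable_mult[OF sq(3) s\<phi>] square_integrable_mult[OF sq(4) s\<phi>]
      by (simp add: has_weak_div_def inner_add_left distrib_right mult.assoc)
  qed
qed

lemma green_linear:
  assumes "green_data K v w \<gamma>" "green_data K v' w' \<gamma>'"
  shows "green_data K (\<lambda>x. v x + c *\<^sub>R v' x) (\<lambda>x. w x + c * w' x) (\<lambda>e x. \<gamma> e x + c * \<gamma>' e x)"
proof -
  have sq: "square_integrable (lebesgue_on K) v" "square_integrable (lebesgue_on K) v'"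
      "square_integrable (lebesgue_on K) w" "square_integrable (lebesgue_on K) w'"
    using assms by (auto simp: has_weak_div_def green_data_def)
  have sqe: "square_integrable (surface_measure e) (\<gamma> e)" "square_integrable (surface_measure e) (\<gamma>' e)"
    if "e \<in> facets K" for e using assms that by (auto simp: green_data_def)
  show ?thesis
    unfolding green_data_def
  proof (intro conjI allI impI ballI)
    show "has_weak_div K (\<lambda>x. v x + c *\<^sub>R v' x) (\<lambda>x. w x + c * w' x)"
      using assms has_weak_div_linear by (auto simp: green_data_def)
    show "square_integrable (surface_measure e) (\<lambda>x. \<gamma> e x + c * \<gamma>' e x)" if "e \<in> facets K" for e
      by (intro square_integrable_add square_integrable_cmult sqe that)
    fix \<phi> :: "'a \<Rightarrow> real" and D assume t: "C1_gradient \<phi> D"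
    then have cD: "continuous_on UNIV D" by (simp add: C1_gradient_def)
    note s\<phi> = square_integrable_cell_continuous[OF C1_gradient_continuous[OF t]]
    note sD = square_integrable_cell_continuous[OF cD]
    have pt: "(LINT x|surface_measure e. (\<gamma> e x + c * \<gamma>' e x) * \<phi> x)
        = (LINT x|surface_measure e. \<gamma> e x * \<phi> x) + c * (LINT x|surface_measure e. \<gamma>' e x * \<phi> x)"
      if e: "e \<in> facets K" for e
    proof -
      have i: "integrable (surface_measure e) (\<lambda>x. \<gamma> e x * \<phi> x)" "integrable (surface_measure e) (\<lambda>x. \<gamma>' e x * \<phi> x)"
        using square_integrable_mult sqe[OF e] square_integrable_facet_continuous[OF e C1_gradient_continuous[OF t]] by blast+
      have "(LINT x|surface_measure e. (\<gamma> e x + c * \<gamma>' e x) * \<phi> x)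
        = (LINT x|surface_measure e. \<gamma> e x * \<phi> x + c * (\<gamma>' e x * \<phi> x))"
        by (simp only: distrib_right mult.assoc)
      also have "\<dots> = (LINT x|surface_measure e. \<gamma> e x * \<phi> x) + c * (LINT x|surface_measure e. \<gamma>' e x * \<phi> x)"
        by (subst Bochner_Integration.integral_add) (use i in auto)
      finally show ?thesis .
    qed
    have "(\<Sum>e\<in>facets K. LINT x|surface_measure e. (\<gamma> e x + c * \<gamma>' e x) * \<phi> x)
      = (\<Sum>e\<in>facets K. (LINT x|surface_measure e. \<gamma> e x * \<phi> x)
        + c * (LINT x|surface_measure e. \<gamma>' e x * \<phi> x))"
      by (rule sum.cong[OF refl pt])
    also have "\<dots> = (\<Sum>e\<in>facets K. LINT x|surface_measure e. \<gamma> e x * \<phi> x)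
        + c * (\<Sum>e\<in>facets K. LINT x|surface_measure e. \<gamma>' e x * \<phi> x)"
      by (simp only: sum_distrib_left sum.distrib)
    also have "\<dots> = ((LINT x|lebesgue_on K. v x \<bullet> D x) + (LINT x|lebesgue_on K. w x * \<phi> x))
        + c * ((LINT x|lebesgue_on K. v' x \<bullet> D x) + (LINT x|lebesgue_on K. w' x * \<phi> x))"
      using assms t by (simp add: green_data_def)
    also have "\<dots> = (LINT x|lebesgue_on K. (v x + c *\<^sub>R v' x) \<bullet> D x) + (LINT x|lebesgue_on K. (w x + c * w' x) * \<phi> x)"
      using square_integrable_inner[OF sq(1) sD] square_integrable_inner[OF sq(2) sD]
        square_integrable_mult[OF sq(3) s\<phi>] square_integrable_mult[OF sq(4) s\<phi>]
      by (simp add: inner_add_left distrib_right mult.assoc distrib_left)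
    finally show "(LINT x|lebesgue_on K. (v x + c *\<^sub>R v' x) \<bullet> D x) + (LINT x|lebesgue_on K. (w x + c * w' x) * \<phi> x)
      = (\<Sum>e\<in>facets K. LINT x|surface_measure e. (\<gamma> e x + c * \<gamma>' e x) * \<phi> x)" by (rule sym)
  qed
qed

lemma green_zero: "green_data K (\<lambda>x. 0) (\<lambda>x. 0) (\<lambda>e x. 0)"
  by (simp add: green_data_def has_weak_div_def)

lemma green_sum:
  assumes "\<And>j. j \<in> J \<Longrightarrow> green_data K (v j) (w j) (\<gamma> j)"
  shows "green_data K (\<lambda>x. \<Sum>j\<in>J. c j *\<^sub>R v j x) (\<lambda>x. \<Sum>j\<in>J. c j * w j x) (\<lambda>e x. \<Sum>j\<in>J. c j * \<gamma> j e x)"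
  using assms
proof (induction J rule: infinite_finite_induct)
  case (insert j J)
  then show ?case
    using green_linear[of "\<lambda>x. \<Sum>j\<in>J. c j *\<^sub>R v j x" "\<lambda>x. \<Sum>j\<in>J. c j * w j x" "\<lambda>e x. \<Sum>j\<in>J. c j * \<gamma> j e x"
        "v j" "w j" "\<gamma> j" "c j"] by (simp add: add.commute)
qed (auto simp: green_zero)

lemma green_cong:
  assumes g: "green_data K v w \<gamma>" and v': "square_integrable (lebesgue_on K) v'" "AE x in lebesgue_on K. v' x = v x"
  shows "green_data K v' w \<gamma>"
proof -
  have eq: "(LINT x|lebesgue_on K. v' x \<bullet> D x) = (LINT x|lebesgue_on K. v x \<bullet> D x)" if "continuous_on UNIV D" for D
  proof (rule integral_cong_lebesgue_on_AE)
    show "integrable (lebesgue_on K) (\<lambda>x. v' x \<bullet> D x)"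
      using square_integrable_inner[OF v'(1) square_integrable_cell_continuous[OF that]] .
    have "square_integrable (lebesgue_on K) v" using g by (simp add: green_data_def has_weak_div_def)
    then show "integrable (lebesgue_on K) (\<lambda>x. v x \<bullet> D x)"
      using square_integrable_inner square_integrable_cell_continuous[OF that] by blast
    show "AE x in lebesgue_on K. v' x \<bullet> D x = v x \<bullet> D x" using v'(2) by eventually_elim simp
  qed
  show ?thesis
    unfolding green_data_def has_weak_div_def
  proof (intro conjI allI impI ballI)
    fix \<phi> :: "'a \<Rightarrow> real" and D
    show "(LINT x|lebesgue_on K. v' x \<bullet> D x) = - (LINT x|lebesgue_on K. w x * \<phi> x)" if "test_function K \<phi> D"
      using g that unfolding eq[OF test_functionD(3)[OF that]] by (simp add: green_data_def has_weak_div_def)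
    assume C: "C1_gradient \<phi> D"
    then have "continuous_on UNIV D" by (simp add: C1_gradient_def)
    from eq[OF this] show "(LINT x|lebesgue_on K. v' x \<bullet> D x) + (LINT x|lebesgue_on K. w x * \<phi> x)
          = (\<Sum>e\<in>facets K. LINT x|surface_measure e. \<gamma> e x * \<phi> x)"
      using g C by (simp add: green_data_def)
  qed (use g v' in \<open>auto simp: green_data_def has_weak_div_def\<close>)
qed

lemma facets_inter_aff_dim:
  assumes "e \<in> facets K" "e' \<in> facets K" "e \<noteq> e'"
  shows "aff_dim (e \<inter> e') \<le> int DIM('a) - 2"
proof -
  have "(e \<inter> e') face_of K"
    using facet_facts(2)[OF assms(1)] facet_facts(2)[OF assms(2)] by (rule face_of_Int)
  then have f: "(e \<inter> e') face_of e" "(e \<inter> e') face_of e'"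
    using facet_facts(8)[OF assms(1)] facet_facts(8)[OF assms(2)] by (auto intro: face_of_subset)
  have "e \<inter> e' \<noteq> e \<or> e \<inter> e' \<noteq> e'" using assms(3) by blast
  then have "aff_dim (e \<inter> e') < int DIM('a) - 1"
    using face_of_aff_dim_lt[OF facet_facts(6)[OF assms(1)] f(1)] face_of_aff_dim_lt[OF facet_facts(6)[OF assms(2)] f(2)]
      facet_facts(9)[OF assms(1)] facet_facts(9)[OF assms(2)] by auto
  then show ?thesis by simp
qed

end

text \<open>The members of \<open>E\<close> meet in null sets of their surface measures.  Restricting the vanishing functional to
  Borel subsets of one member therefore isolates the density on it.\<close>

lemma facet_densities_vanish:
  fixes E :: "'a::euclidean_space set set" and g :: "'a set \<Rightarrow> 'a \<Rightarrow> real"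
  assumes E: "finite E" "\<And>e. e \<in> E \<Longrightarrow> compact e \<and> e \<noteq> {}"
    and sing: "\<And>e e'. e \<in> E \<Longrightarrow> e' \<in> E \<Longrightarrow> e \<noteq> e' \<Longrightarrow> AE x in surface_measure e. x \<notin> e'"
    and sq: "\<And>e. e \<in> E \<Longrightarrow> square_integrable (surface_measure e) (g e)"
    and U: "open U"
    and zero: "\<And>\<phi> D. test_function U \<phi> D \<Longrightarrow> (\<Sum>e\<in>E. LINT x|surface_measure e. g e x * \<phi> x) = 0"
    and e: "e \<in> E"
  shows "AE x in surface_measure e. x \<in> U \<longrightarrow> g e x = 0"
proof (rule AE_open_of_cbox[OF U])
  fix a b :: 'a assume ab: "cbox a b \<subseteq> U"
  have int: "integrable (surface_measure e') (g e')" if "e' \<in> E" for e'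
    by (rule square_integrable_imp_integrable[OF finite_surface_measure sq]) (use E(2) that in auto)
  let ?A0 = "e - \<Union>(E - {e})"
  have cl: "closed e'" if "e' \<in> E" for e' using E(2)[OF that] compact_imp_closed by blast
  then have "closed (\<Union>(E - {e}))" using E(1) by (intro closed_Union) auto
  then have A0: "?A0 \<in> sets borel" using cl[OF e] by auto
  have "AE x in surface_measure e. indicator (cbox a b) x * g e x = 0"
  proof (rule AE_eq_zero_of_set_integrals)
    show "integrable (surface_measure e) (\<lambda>x. indicator (cbox a b) x * g e x)"
      using integrable_mult_indicator[OF _ int[OF e], of "cbox a b"] by simp
    fix A assume A: "A \<in> sets (surface_measure e)"
    have "(\<Sum>e'\<in>E. LINT x|surface_measure e'. indicator ((A \<inter> ?A0) \<inter> cbox a b) x * g e' x) = 0"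
    proof (rule vanishing_functional[OF E(1) int _ U zero])
      show "A \<inter> ?A0 \<in> sets borel" using A A0 by auto
    qed (use ab in \<open>auto intro: measurable_ident_sets\<close>)
    moreover have "(LINT x|surface_measure e'. indicator ((A \<inter> ?A0) \<inter> cbox a b) x * g e' x) = 0"
      if e': "e' \<in> E" "e' \<noteq> e" for e'
    proof -
      have "AE x in surface_measure e'. x \<in> e'" using E(2) e' by (intro AE_surface_measure_mem) auto
      then have "AE x in surface_measure e'. indicator ((A \<inter> ?A0) \<inter> cbox a b) x * g e' x = 0"
        by eventually_elim (use e' in \<open>auto simp: indicator_def\<close>)
      then show ?thesis by (rule integral_eq_zero_AE)
    qed
    ultimately have z: "(LINT x|surface_measure e. indicator ((A \<inter> ?A0) \<inter> cbox a b) x * g e x) = 0"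
      using sum.remove[OF E(1) e, of "\<lambda>e'. LINT x|surface_measure e'. indicator ((A \<inter> ?A0) \<inter> cbox a b) x * g e' x"]
      by simp
    have "AE x in surface_measure e. \<forall>e'\<in>E-{e}. x \<notin> e'"
      by (rule AE_finite_allI) (use E(1) sing e in auto)
    moreover have "AE x in surface_measure e. x \<in> e" using E(2) e by (intro AE_surface_measure_mem) auto
    ultimately have "AE x in surface_measure e. indicator A x * (indicator (cbox a b) x * g e x)
        = indicator ((A \<inter> ?A0) \<inter> cbox a b) x * g e x"
      by eventually_elim (auto simp: indicator_def)
    then have "(LINT x|surface_measure e. indicator A x * (indicator (cbox a b) x * g e x))
        = (LINT x|surface_measure e. indicator ((A \<inter> ?A0) \<inter> cbox a b) x * g e x)"
    proof (rule integral_cong_AE[rotated 2])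
      have [measurable]: "g e \<in> borel_measurable borel" using int[OF e] by auto
      show "(\<lambda>x. indicator A x * (indicator (cbox a b) x * g e x)) \<in> borel_measurable (surface_measure e)"
        using A by measurable
      have "A \<inter> ?A0 \<inter> cbox a b \<in> sets borel" using A A0 by auto
      then show "(\<lambda>x. indicator ((A \<inter> ?A0) \<inter> cbox a b) x * g e x) \<in> borel_measurable (surface_measure e)"
        by measurable
    qed
    then show "(LINT x|surface_measure e. indicator A x * (indicator (cbox a b) x * g e x)) = 0"
      using z by simp
  qed
  then show "AE x in surface_measure e. x \<in> cbox a b \<longrightarrow> g e x = 0"
    by eventually_elim (auto simp: indicator_def)
qed

context cell
begin

text \<open>Normal traces are unique almost everywhere on each facet.\<close>

lemma green_unique:
  assumes g: "green_data K v w \<gamma>" "green_data K v' w' \<gamma>'" and eq: "AE x in lebesgue_on K. v x = v' x" and e: "e \<in> facets K"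
  shows "AE x in surface_measure e. \<gamma> e x = \<gamma>' e x"
proof -
  have sqv: "square_integrable (lebesgue_on K) v" "square_integrable (lebesgue_on K) v'"
    and sqw: "square_integrable (lebesgue_on K) w" "square_integrable (lebesgue_on K) w'"
    using g by (auto simp: green_data_def has_weak_div_def)
  have w: "AE x in lebesgue_on K. w x = w' x"
    by (rule weak_div_cell_unique[OF _ _ eq]) (use g in \<open>auto simp: green_data_def\<close>)
  have "AE x in surface_measure e. x \<in> UNIV \<longrightarrow> \<gamma> e x + (-1) * \<gamma>' e x = 0"
  proof (rule facet_densities_vanish[where E = "facets K"])
    fix \<phi> :: "'a \<Rightarrow> real" and D assume "test_function UNIV \<phi> D"
    then have t: "C1_gradient \<phi> D" by (simp add: test_function_def)
    then have cD: "continuous_on UNIV D" by (simp add: C1_gradient_def)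
    note s\<phi> = square_integrable_cell_continuous[OF C1_gradient_continuous[OF t]]
    note sD = square_integrable_cell_continuous[OF cD]
    have "(\<Sum>e\<in>facets K. LINT x|surface_measure e. (\<gamma> e x + (-1) * \<gamma>' e x) * \<phi> x)
      = (LINT x|lebesgue_on K. (v x + (-1) *\<^sub>R v' x) \<bullet> D x) + (LINT x|lebesgue_on K. (w x + (-1) * w' x) * \<phi> x)"
      using green_linear[OF g, of "-1"] t unfolding green_data_def by (blast intro: sym)
    also have "\<dots> = 0"
    proof -
      have "AE x in lebesgue_on K. (v x + (-1) *\<^sub>R v' x) \<bullet> D x = 0" using eq by eventually_elim simp
      moreover have "AE x in lebesgue_on K. (w x + (-1) * w' x) * \<phi> x = 0" using w by eventually_elim simp
      ultimately show ?thesis by (simp only: integral_eq_zero_AE)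
    qed
    finally show "(\<Sum>e\<in>facets K. LINT x|surface_measure e. (\<gamma> e x + (-1) * \<gamma>' e x) * \<phi> x) = 0" .
  next
    fix e e' assume ee: "e \<in> facets K" "e' \<in> facets K" "e \<noteq> e'"
    have "AE x in surface_measure e. x \<notin> e \<inter> e'"
      by (rule AE_facet_other[OF ee(1)]) (use facets_inter_aff_dim[OF ee] facet_facts ee in auto)
    moreover have "AE x in surface_measure e. x \<in> e"
      by (rule AE_surface_measure_mem) (use facet_facts[OF ee(1)] in auto)
    ultimately show "AE x in surface_measure e. x \<notin> e'" by eventually_elim auto
  next
    fix e assume e: "e \<in> facets K"
    show "square_integrable (surface_measure e) (\<lambda>x. \<gamma> e x + (-1) * \<gamma>' e x)"
      by (intro square_integrable_add square_integrable_cmult) (use g e in \<open>auto simp: green_data_def\<close>)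
    show "compact e \<and> e \<noteq> {}" using facet_facts[OF e] by auto
  qed (use finite_facets e in auto)
  then show ?thesis by eventually_elim auto
qed

text \<open>The chosen representatives \<open>wdiv\<close> and \<open>normal_trace\<close> agree with any Green data.\<close>

lemma green_normal_trace:
  assumes "green_data K v w \<gamma>"
  shows "green_data K v (wdiv K v) (normal_trace K v)"
    and "\<And>e. e \<in> facets K \<Longrightarrow> AE x in surface_measure e. normal_trace K v e x = \<gamma> e x"
    and "AE x in lebesgue_on K. wdiv K v x = w x"
proof -
  have "has_normal_trace K v (normal_trace K v)"
    unfolding normal_trace_def by (rule someI[of _ \<gamma>]) (use assms has_normal_trace_iff_green in blast)
  then obtain w' where w': "green_data K v w' (normal_trace K v)" using has_normal_trace_iff_green by blast
  then show "AE x in surface_measure e. normal_trace K v e x = \<gamma> e x" if "e \<in> facets K" for e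
    using green_unique[OF w' assms] that by simp
  show d: "AE x in lebesgue_on K. wdiv K v x = w x"
    using assms wdiv_cell_AE by (auto simp: green_data_def)
  have wd: "has_weak_div K v (wdiv K v)" using wdiv_cell w' by (auto simp: green_data_def)
  have "AE x in lebesgue_on K. wdiv K v x = w' x" using w' wdiv_cell_AE by (auto simp: green_data_def)
  then have eq: "(LINT x|lebesgue_on K. wdiv K v x * \<phi> x) = (LINT x|lebesgue_on K. w' x * \<phi> x)"
    if "C1_gradient \<phi> D" for \<phi> :: "'a \<Rightarrow> real" and D
    using wd w' that
      square_integrable_mult[OF _ square_integrable_cell_continuous[OF C1_gradient_continuous[OF that]], of "wdiv K v"]
      square_integrable_mult[OF _ square_integrable_cell_continuous[OF C1_gradient_continuous[OF that]], of w']
    by (intro integral_cong_lebesgue_on_AE) (auto simp: has_weak_div_def green_data_def elim: eventually_mono)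
  show "green_data K v (wdiv K v) (normal_trace K v)"
    unfolding green_data_def using w' wd by (auto simp: green_data_def eq)
qed

lemma green_of_trace: "has_normal_trace K v \<gamma> \<Longrightarrow> green_data K v (wdiv K v) (normal_trace K v)"
  using green_normal_trace(1) has_normal_trace_iff_green by blast

end

section \<open>Geometry of the mesh\<close>

lemma connected_component_segment_pair:
  fixes x y z :: "'a::euclidean_space"
  assumes "closed_segment x z \<subseteq> S" "closed_segment z y \<subseteq> S"
  shows "connected_component S x y"
proof -
  have "connected_component S x z" "connected_component S z y"
    using connected_componentI[OF connected_segment assms(1)] connected_componentI[OF connected_segment assms(2)]
    by auto
  then show ?thesis using connected_component_trans by metis
qed

text \<open>A generic point \<open>z\<close> can be joined to \<open>x\<close> and to \<open>y\<close> by segments that avoid all sets of codimension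
  two: the points that fail lie in finitely many affine sets of positive codimension.\<close>

lemma connected_component_convex_diff_lowdim:
  fixes U :: "'a::euclidean_space set"
  assumes U: "convex U" "open U" and finA: "finite \<A>"
    and dimA: "\<And>A. A \<in> \<A> \<Longrightarrow> aff_dim A \<le> int DIM('a) - 2"
    and x: "x \<in> U - \<Union>\<A>" and y: "y \<in> U - \<Union>\<A>"
  shows "connected_component (U - \<Union>\<A>) x y"
proof -
  let ?B = "\<Union>A\<in>\<A>. affine hull (insert x A) \<union> affine hull (insert y A)"
  have neg: "negligible (affine hull (insert p A))" if "A \<in> \<A>" for p A
    by (rule negligible_aff_dim) (use dimA[OF that] in \<open>simp add: aff_dim_insert\<close>)
  have "negligible ?B" using finA neg by (intro negligible_Union) auto
  moreover have "\<not> negligible U" using U x by (intro open_not_negligible) auto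
  ultimately obtain z where z: "z \<in> U" "z \<notin> ?B" using negligible_subset by blast
  have seg: "closed_segment p z \<subseteq> U - \<Union>\<A>"
    if p: "p \<in> U - \<Union>\<A>" "\<And>A. A \<in> \<A> \<Longrightarrow> z \<notin> affine hull (insert p A)" for p
  proof
    fix w assume w: "w \<in> closed_segment p z"
    have "w \<in> U" using w p z U closed_segment_subset by blast
    moreover have "w \<notin> A" if A: "A \<in> \<A>" for A
    proof
      assume wA: "w \<in> A"
      obtain u where u: "w = (1 - u) *\<^sub>R p + u *\<^sub>R z" using w by (auto simp: in_segment)
      have "u \<noteq> 0" using u wA A p by auto
      then have "z = (1 / u) *\<^sub>R w + (1 - 1 / u) *\<^sub>R p"
        unfolding u by (simp add: algebra_simps)
      moreover have "(1 / u) *\<^sub>R w + (1 - 1 / u) *\<^sub>R p \<in> affine hull (insert p A)"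
        by (rule mem_affine) (use wA in \<open>auto intro: hull_inc\<close>)
      ultimately show False using p(2)[OF A] by simp
    qed
    ultimately show "w \<in> U - \<Union>\<A>" by blast
  qed
  show ?thesis
    by (rule connected_component_segment_pair[of _ z])
      (use seg[of x] seg[of y] x y z in \<open>auto simp: closed_segment_commute\<close>)
qed

lemma connected_diff_lowdim:
  fixes U :: "'a::euclidean_space set"
  assumes U: "connected U" "open U" and finA: "finite \<A>"
    and dimA: "\<And>A. A \<in> \<A> \<Longrightarrow> aff_dim A \<le> int DIM('a) - 2"
  shows "connected (U - \<Union>\<A>)"
  unfolding connected_iff_connected_component
proof (intro ballI)
  fix x y assume xy: "x \<in> U - \<Union>\<A>" "y \<in> U - \<Union>\<A>"
  have neg: "negligible (\<Union>\<A>)"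
    using finA dimA by (intro negligible_Union) (force intro: negligible_aff_dim)+
  show "connected_component (U - \<Union>\<A>) x y"
  proof (rule connected_equivalence_relation_gen[OF U(1), where P = "\<lambda>x. x \<notin> \<Union>\<A>"])
    show "connected_component (U - \<Union>\<A>) a c"
      if "connected_component (U - \<Union>\<A>) a b" "connected_component (U - \<Union>\<A>) b c" for a b c
      using that connected_component_trans by metis
    show "\<exists>z. z \<in> T \<and> z \<notin> \<Union>\<A>" if T: "openin (top_of_set U) T" "a \<in> T" for T a
    proof -
      have "open T" using T U openin_open_trans by blast
      then have "\<not> negligible T" using T open_not_negligible by blast
      then show ?thesis using neg negligible_subset by blast
    qed
    fix a assume "a \<in> U"
    then obtain r where r: "r > 0" "ball a r \<subseteq> U" using U(2) open_contains_ball by blast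
    show "\<exists>T. openin (top_of_set U) T \<and> a \<in> T \<and>
        (\<forall>x\<in>T. \<forall>y\<in>T. x \<notin> \<Union>\<A> \<and> y \<notin> \<Union>\<A> \<longrightarrow> connected_component (U - \<Union>\<A>) x y)"
    proof (intro exI conjI ballI impI)
      show "openin (top_of_set U) (ball a r)" using r U by (simp add: openin_open_eq)
      show "a \<in> ball a r" using r by simp
      fix x y assume "x \<in> ball a r" "y \<in> ball a r" "x \<notin> \<Union>\<A> \<and> y \<notin> \<Union>\<A>"
      then have "connected_component (ball a r - \<Union>\<A>) x y"
        by (intro connected_component_convex_diff_lowdim finA dimA) auto
      then show "connected_component (U - \<Union>\<A>) x y"
        by (rule connected_component_of_subset) (use r in auto)
    qed
  qed (use xy in auto)
qed

text \<open>Points of the frontier are approached from below the graph by points outside the closure, so a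
  Lipschitz domain has no slits.\<close>

lemma Lipschitz_domain_interior_closure:
  fixes \<Omega> :: "'a::euclidean_space set"
  assumes "Lipschitz_domain \<Omega>"
  shows "interior (closure \<Omega>) = \<Omega>"
proof
  have op: "open \<Omega>" using assms by (simp add: Lipschitz_domain_def)
  then show "\<Omega> \<subseteq> interior (closure \<Omega>)" by (simp add: interior_maximal closure_subset)
  show "interior (closure \<Omega>) \<subseteq> \<Omega>"
  proof
    fix x assume x: "x \<in> interior (closure \<Omega>)"
    show "x \<in> \<Omega>"
    proof (rule ccontr)
      assume nx: "x \<notin> \<Omega>"
      then have "x \<in> frontier \<Omega>" using x op interior_subset by (auto simp: frontier_def interior_open)
      then obtain r \<nu> L g where r: "r > 0" "norm \<nu> = 1" and g: "L-lipschitz_on {y. y \<bullet> \<nu> = 0} g"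
        and eq: "\<Omega> \<inter> ball x r = {y \<in> ball x r. y \<bullet> \<nu> > g (y - (y \<bullet> \<nu>) *\<^sub>R \<nu>)}"
        using assms unfolding Lipschitz_domain_def by blast
      have \<nu>: "\<nu> \<bullet> \<nu> = 1" using r(2) by (simp add: norm_eq_1)
      let ?h = "\<lambda>y. g (y - (y \<bullet> \<nu>) *\<^sub>R \<nu>)"
      have "continuous_on UNIV (g \<circ> (\<lambda>y. y - (y \<bullet> \<nu>) *\<^sub>R \<nu>))"
      proof (rule continuous_on_compose)
        show "continuous_on UNIV (\<lambda>y. y - (y \<bullet> \<nu>) *\<^sub>R \<nu>)" by (intro continuous_intros)
        show "continuous_on (range (\<lambda>y. y - (y \<bullet> \<nu>) *\<^sub>R \<nu>)) g"
          by (rule continuous_on_subset[OF lipschitz_on_continuous_on[OF g]])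
             (auto simp: inner_diff_left \<nu>)
      qed
      then have h: "continuous_on UNIV ?h" by (simp add: o_def)
      obtain s where s: "s > 0" "ball x s \<subseteq> interior (closure \<Omega>)"
        using x open_contains_ball open_interior by metis
      let ?t = "min r s / 2"
      let ?y = "x - ?t *\<^sub>R \<nu>"
      have t: "?t > 0" "?t < r" "?t < s" using r s by auto
      have dy: "dist x ?y = ?t" using t r(2) by (simp add: dist_norm)
      have hx: "\<not> x \<bullet> \<nu> > ?h x"
      proof
        assume "x \<bullet> \<nu> > ?h x"
        then have "x \<in> \<Omega> \<inter> ball x r" unfolding eq using r(1) by simp
        with nx show False by simp
      qed
      have y\<nu>: "?y \<bullet> \<nu> = x \<bullet> \<nu> - ?t" by (simp add: inner_diff_left \<nu>)
      have "?y - (?y \<bullet> \<nu>) *\<^sub>R \<nu> = x - (x \<bullet> \<nu>) *\<^sub>R \<nu>"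
        unfolding y\<nu> by (simp add: scaleR_diff_left)
      then have "?h ?y = ?h x" by (rule arg_cong[where f = g])
      with hx y\<nu> t(1) have yh: "?y \<bullet> \<nu> < ?h ?y" by linarith
      let ?W = "ball x r \<inter> {y. y \<bullet> \<nu> < ?h y}"
      have W: "open ?W" by (intro open_Int open_ball open_Collect_less continuous_intros h)
      have yW: "?y \<in> ?W" using dy t yh by simp
      have "?W \<inter> \<Omega> = {}"
      proof -
        have False if "w \<in> ?W" "w \<in> \<Omega>" for w
        proof -
          from that have "w \<in> \<Omega> \<inter> ball x r" by auto
          then have "w \<bullet> \<nu> > ?h w" using eq by blast
          then show False using that by auto
        qed
        then show ?thesis by blast
      qed
      then have "?W \<inter> closure \<Omega> = {}" using W open_Int_closure_eq_empty by blast
      moreover have "?y \<in> closure \<Omega>"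
      proof -
        have "?y \<in> ball x s" using dy t by simp
        then show ?thesis using s(2) interior_subset by blast
      qed
      ultimately show False using yW by blast
    qed
  qed
qed

context cell
begin

lemma frontier_cell: "frontier K = \<Union>(facets K)"
proof -
  have "frontier K = K - rel_interior K"
    using closed_cell interior_ne by (simp add: frontier_def closure_closed rel_interior_nonempty_interior)
  also have "\<dots> = \<Union>(facets K)"
    unfolding facets_def
    by (rule rel_boundary_of_polyhedron) (simp add: polytope polytope_imp_polyhedron)
  finally show ?thesis .
qed

lemma facet_eq_face:
  assumes e: "e \<in> facets K" and F: "F face_of K" "F \<noteq> K" and d: "aff_dim (e \<inter> F) \<ge> int DIM('a) - 1"
  shows "e = F"
proof -
  note fe = facet_facts[OF e]
  have "(e \<inter> F) face_of K" using fe(2) F(1) by (rule face_of_Int)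
  then have "(e \<inter> F) face_of e" using face_of_subset fe(8) by blast
  then have eF: "e \<inter> F = e" using face_of_aff_dim_lt[OF fe(6)] d fe(9) by force
  then have "e \<subseteq> F" by blast
  then have "e face_of F" using face_of_subset[OF fe(2)] face_of_imp_subset[OF F(1)] by blast
  moreover have "convex F" using F(1) face_of_imp_convex by blast
  moreover have "aff_dim F < int DIM('a)"
    using face_of_aff_dim_lt[OF convex_cell F] aff_dim_cell by simp
  ultimately show "e = F" using face_of_aff_dim_lt[of F e] fe(9) by force
qed

text \<open>Near a relative interior point \<open>x\<close> of a facet, the cell contains the half ball on the inner side
  of the facet.  The half ball is connected, meets \<open>K\<close>, and misses the frontier of \<open>K\<close> as \<open>x\<close> lies on
  no other facet.\<close>

lemma half_ball:
  assumes e: "e \<in> facets K" and x: "x \<in> rel_interior e"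
  shows "\<exists>n r. norm n = 1 \<and> r > 0 \<and> (\<forall>y. dist x y < r \<and> n \<bullet> (y - x) < 0 \<longrightarrow> y \<in> interior K)"
proof -
  note fe = facet_facts[OF e]
  obtain a b where a: "a \<noteq> 0" and Ka: "K \<subseteq> {y. a \<bullet> y \<le> b}" and ea: "e = K \<inter> {y. a \<bullet> y = b}"
    using facet_of_polyhedron[OF polytope_imp_polyhedron[OF polytope] fe(1)] by metis
  have xe: "x \<in> e" using x rel_interior_subset by blast
  have ax: "a \<bullet> x = b" using xe ea by simp
  let ?O = "\<Union>(facets K - {e})"
  have "closed ?O" using finite_facets facet_facts(7) by (intro closed_Union) auto
  moreover have "x \<notin> ?O"
  proof
    assume "x \<in> ?O"
    then obtain e' where e': "e' \<in> facets K" "e' \<noteq> e" "x \<in> e'" by blast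
    have "(e \<inter> e') face_of K" using fe(2) facet_facts(2)[OF e'(1)] by (rule face_of_Int)
    then have f: "(e \<inter> e') face_of e" using face_of_subset fe(8) by blast
    have "e \<inter> e' \<noteq> e" using facets_inter_aff_dim[OF e e'(1)] e'(2) fe(9) by force
    from face_of_disjoint_rel_interior[OF f this] show False using x xe e' by blast
  qed
  ultimately obtain r where r: "r > 0" "ball x r \<subseteq> - ?O"
    by (metis ComplI open_Compl open_contains_ball)
  let ?H = "ball x r \<inter> {y. a \<bullet> y < b}"
  \<comment> \<open>The point \<open>?w\<close> below lies on the segment from \<open>x\<close> to an interior point \<open>z\<close>, close enough to \<open>x\<close> to be in \<open>?H\<close>.\<close>
  have conn: "connected ?H"
    by (intro convex_connected convex_Int convex_ball convex_halfspace_lt)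
  have fr: "?H \<inter> frontier K = {}"
    using r(2) ea unfolding frontier_cell by fastforce
  obtain z where z: "z \<in> interior K" using interior_ne by blast
  have zK: "z \<in> K" using z interior_subset by blast
  have "z \<notin> e" using z frontier_cell e by (auto simp: frontier_def)
  then have az: "a \<bullet> z < b" using zK Ka ea by force
  let ?t = "min 1 (r / (2 * (norm (z - x) + 1)))"
  let ?w = "x + ?t *\<^sub>R (z - x)"
  have np: "0 < 2 * (norm (z - x) + 1)" by (simp add: add_nonneg_pos)
  have t: "?t > 0" "?t \<le> 1" using divide_pos_pos[OF r(1) np] by auto
  have "?w = (1 - ?t) *\<^sub>R x + ?t *\<^sub>R z" by (simp add: algebra_simps)
  moreover have "(1 - ?t) *\<^sub>R x + ?t *\<^sub>R z \<in> K"
    by (rule convexD_alt[OF convex_cell]) (use xe fe zK t in auto)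
  ultimately have wK: "?w \<in> K" by simp
  have "dist x ?w = ?t * norm (z - x)" using t by (simp add: dist_norm)
  also have "\<dots> \<le> (r / (2 * (norm (z - x) + 1))) * norm (z - x)"
    by (intro mult_right_mono min.cobounded2 norm_ge_zero)
  also have "\<dots> = r * (norm (z - x) / (2 * (norm (z - x) + 1)))" by simp
  also have "\<dots> < r * 1"
  proof (rule mult_strict_left_mono[OF _ r(1)])
    show "norm (z - x) / (2 * (norm (z - x) + 1)) < 1"
      unfolding divide_less_eq using np by simp
  qed
  also have "r * 1 = r" by simp
  finally have dw: "dist x ?w < r" .
  have "a \<bullet> ?w = b + ?t * (a \<bullet> z - b)" by (simp add: inner_add_right inner_diff_right ax)
  also have "\<dots> < b" using t az by (simp add: mult_pos_neg)
  finally have "?w \<in> ?H" using dw by simp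
  then have HK: "?H \<subseteq> K" using connected_Int_frontier[OF conn, of K] fr wK by blast
  have Hi: "?H \<subseteq> interior K" using HK fr closure_subset by (fastforce simp: frontier_def)
  let ?n = "a /\<^sub>R norm a"
  show ?thesis
  proof (intro exI conjI allI impI)
    show "norm ?n = 1" using a by simp
    fix y assume y: "dist x y < r \<and> ?n \<bullet> (y - x) < 0"
    have "?n \<bullet> (y - x) = (a \<bullet> y - b) / norm a" using ax by (simp add: inner_diff_right divide_inverse algebra_simps)
    then have "a \<bullet> y < b" using y a by (simp add: divide_less_0_iff)
    then show "y \<in> interior K" using y Hi by auto
  qed fact
qed

end

text \<open>A quasi-uniform partition of a bounded Lipschitz domain, in dimension at least two.\<close>

locale mesh =
  fixes \<sigma> :: real and \<Omega> :: "'a::euclidean_space set" and \<T> :: "'a set set"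
  assumes dom: "Lipschitz_domain \<Omega>" and bdd: "bounded \<Omega>"
    and part: "quasi_uniform_partition \<sigma> \<Omega> \<T>" and dim2: "DIM('a) \<ge> 2"
begin

lemma finite_cells: "finite \<T>" and Union_cells: "\<Union>\<T> = closure \<Omega>"
  and cell_of_mesh: "\<And>K. K \<in> \<T> \<Longrightarrow> cell K"
  and inter_face_of: "\<And>K K'. K \<in> \<T> \<Longrightarrow> K' \<in> \<T> \<Longrightarrow> (K \<inter> K') face_of K"
  using part by (auto simp: quasi_uniform_partition_def cell_def)

lemma open_dom: "open \<Omega>" and conn_dom: "connected \<Omega>" and dom_nonempty: "\<Omega> \<noteq> {}"
  using dom by (auto simp: Lipschitz_domain_def)

lemma inter_ne_cell:
  assumes "K \<in> \<T>" "K' \<in> \<T>" "K \<noteq> K'"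
  shows "K \<inter> K' \<noteq> K"
proof
  assume "K \<inter> K' = K"
  then have "K face_of K'" using inter_face_of[OF assms(2,1)] by (simp add: Int_commute)
  then have "K \<inter> interior K' = {}" using face_of_disjoint_interior assms(3) by blast
  moreover have "interior K \<subseteq> interior K'" using \<open>K \<inter> K' = K\<close> by (intro interior_mono) blast
  ultimately show False using cell.interior_ne[OF cell_of_mesh[OF assms(1)]] interior_subset by blast
qed

lemma inter_disjoint_interior:
  assumes "K \<in> \<T>" "K' \<in> \<T>" "K \<noteq> K'"
  shows "K' \<inter> interior K = {}"
  using face_of_disjoint_interior[OF inter_face_of[OF assms(1,2)] inter_ne_cell[OF assms]] interior_subset by blast

lemma inter_aff_dim:
  assumes "K \<in> \<T>" "K' \<in> \<T>" "K \<noteq> K'"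
  shows "aff_dim (K \<inter> K') < int DIM('a)"
  using face_of_aff_dim_lt[OF cell.convex_cell[OF cell_of_mesh[OF assms(1)]] inter_face_of[OF assms(1,2)] inter_ne_cell[OF assms]]
  unfolding cell.aff_dim_cell[OF cell_of_mesh[OF assms(1)]] .

lemma inter_facet:
  assumes "K \<in> \<T>" "K' \<in> \<T>" "K \<noteq> K'" "aff_dim (K \<inter> K') \<ge> int DIM('a) - 1"
  shows "K \<inter> K' \<in> facets K"
proof -
  have "aff_dim (K \<inter> K') = int DIM('a) - 1" using assms inter_aff_dim by force
  moreover have "K \<inter> K' \<noteq> {}" using assms(4) dim2 by auto
  ultimately show ?thesis
    using inter_face_of[OF assms(1,2)] cell.aff_dim_cell[OF cell_of_mesh[OF assms(1)]] by (simp add: facets_def facet_of_def)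
qed

lemma interior_cell_subset: "K \<in> \<T> \<Longrightarrow> interior K \<subseteq> \<Omega>"
  using Union_cells interior_mono[of K "closure \<Omega>"] Lipschitz_domain_interior_closure[OF dom] by blast

lemma finite_mesh_faces: "finite (mesh_faces \<T>)"
  using finite_cells cell.finite_facets cell_of_mesh by (auto simp: mesh_faces_def)

lemma mesh_faceE:
  assumes "e \<in> mesh_faces \<T>"
  obtains K where "K \<in> \<T>" "e \<in> facets K"
  using assms by (auto simp: mesh_faces_def)

lemma mesh_face_facts:
  assumes "e \<in> mesh_faces \<T>"
  shows "polytope e" "compact e" "e \<noteq> {}" "convex e" "closed e" "aff_dim e = int DIM('a) - 1"
    "finite_measure (surface_measure e)" "AE x in surface_measure e. x \<in> e"
proof -
  obtain K where K: "K \<in> \<T>" "e \<in> facets K" using assms by (rule mesh_faceE)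
  interpret cell K by (rule cell_of_mesh) fact
  note f = facet_facts[OF K(2)]
  show "polytope e" "compact e" "e \<noteq> {}" "convex e" "closed e" "aff_dim e = int DIM('a) - 1"
    using f by blast+
  show "finite_measure (surface_measure e)" "AE x in surface_measure e. x \<in> e"
    using finite_measure_facet[OF K(2)] AE_surface_measure_mem[OF f(4,5)] by blast+
qed

lemma mesh_faces_inter:
  assumes "e \<in> mesh_faces \<T>" "e' \<in> mesh_faces \<T>" "e \<noteq> e'"
  shows "aff_dim (e \<inter> e') \<le> int DIM('a) - 2"
proof (rule ccontr)
  assume neg: "\<not> ?thesis"
  obtain K K' where K: "K \<in> \<T>" "e \<in> facets K" and K': "K' \<in> \<T>" "e' \<in> facets K'"
    using assms by (metis mesh_faceE)
  interpret K: cell K by (rule cell_of_mesh) fact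
  interpret K': cell K' by (rule cell_of_mesh) fact
  show False
  proof (cases "K = K'")
    case True
    then show ?thesis using K.facets_inter_aff_dim[OF K(2), of e'] K' assms(3) neg by simp
  next
    case False
    have sub: "e \<inter> e' \<subseteq> e \<inter> (K \<inter> K')" "e \<inter> e' \<subseteq> e' \<inter> (K' \<inter> K)"
      using K.facet_facts(8)[OF K(2)] K'.facet_facts(8)[OF K'(2)] by auto
    have "e = K \<inter> K'"
      by (rule K.facet_eq_face[OF K(2) inter_face_of[OF K(1) K'(1)] inter_ne_cell[OF K(1) K'(1) False]])
         (use aff_dim_subset[OF sub(1)] neg in simp)
    moreover have "e' = K' \<inter> K"
      by (rule K'.facet_eq_face[OF K'(2) inter_face_of[OF K'(1) K(1)] inter_ne_cell[OF K'(1) K(1) False[symmetric]]])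
         (use aff_dim_subset[OF sub(2)] neg in simp)
    ultimately show False using assms(3) by blast
  qed
qed

lemma AE_mesh_face_other:
  assumes "e \<in> mesh_faces \<T>" "e' \<in> mesh_faces \<T>" "e \<noteq> e'"
  shows "AE x in surface_measure e. x \<notin> e'"
proof -
  have "AE x in surface_measure e. x \<notin> e \<inter> e'"
    by (rule AE_surface_measure_not_mem) (use mesh_face_facts assms mesh_faces_inter in auto)
  then show ?thesis using mesh_face_facts(8)[OF assms(1)] by eventually_elim auto
qed

text \<open>The relative boundary of a face is a union of finitely many sets of codimension two.\<close>

lemma AE_rel_interior:
  assumes e: "e \<in> mesh_faces \<T>"
  shows "AE x in surface_measure e. x \<in> rel_interior e"
proof -
  note fe = mesh_face_facts[OF e]
  have bd: "e - rel_interior e = \<Union>{F. F facet_of e}"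
    by (rule rel_boundary_of_polyhedron) (simp add: fe(1) polytope_imp_polyhedron)
  have finF: "finite {F. F facet_of e}" using fe(1) by (rule finite_polytope_facets)
  have "AE x in surface_measure e. \<forall>F\<in>{F. F facet_of e}. x \<notin> F"
  proof (rule AE_finite_allI[OF finF])
    fix F assume "F \<in> {F. F facet_of e}"
    then have F: "F facet_of e" by simp
    have "closed F" using polytope_imp_closed[OF face_of_polytope_polytope[OF fe(1) facet_of_imp_face_of[OF F]]] .
    moreover have "aff_dim F \<le> int DIM('a) - 2" using F fe(6) by (simp add: facet_of_def)
    ultimately show "AE x in surface_measure e. x \<notin> F"
      by (rule AE_surface_measure_not_mem[OF fe(2,3,6)])
  qed
  with fe(8) show ?thesis
  proof eventually_elim
    case (elim x)
    then show ?case using bd by blast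
  qed
qed

text \<open>The cells that have \<open>e\<close> as a facet.\<close>

definition adjacent_cells :: "'a set \<Rightarrow> 'a set set" where
  "adjacent_cells e = {K \<in> \<T>. e \<in> facets K}"

lemma finite_adjacent_cells: "finite (adjacent_cells e)" using finite_cells by (simp add: adjacent_cells_def)

text \<open>The half balls of two distinct cells at a common point are disjoint, which forces their normals
  to be opposite.\<close>

lemma normals_opposite:
  assumes K: "K \<in> \<T>" "K' \<in> \<T>" "K \<noteq> K'" and n: "norm n = 1" "norm n' = 1" and r: "r > 0" "r' > 0"
    and h: "\<And>y. dist x y < r \<and> n \<bullet> (y - x) < 0 \<Longrightarrow> y \<in> interior K"
    and h': "\<And>y. dist x y < r' \<and> n' \<bullet> (y - x) < 0 \<Longrightarrow> y \<in> interior K'"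
  shows "n' = - n"
proof (rule ccontr)
  assume "n' \<noteq> - n"
  then have "0 < (n + n') \<bullet> (n + n')" by (simp add: add_eq_0_iff)
  then have pos: "1 + n \<bullet> n' > 0"
    using n by (simp add: inner_add_left inner_add_right inner_commute norm_eq_1)
  let ?s = "min r r' / 3"
  let ?y = "x - ?s *\<^sub>R (n + n')"
  have s: "?s > 0" using r by simp
  have "dist x ?y = ?s * norm (n + n')" using s by (simp add: dist_norm)
  also have "\<dots> \<le> ?s * 2" using norm_triangle_ineq[of n n'] n s by (intro mult_left_mono) auto
  also have "\<dots> < min r r'" using r by (auto simp: min_def)
  finally have d: "dist x ?y < r" "dist x ?y < r'" by auto
  have "n \<bullet> (?y - x) = - (?s * (1 + n \<bullet> n'))" using n by (simp add: inner_add_right norm_eq_1)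
  also have "\<dots> < 0" using mult_pos_pos[OF s pos] by simp
  finally have "?y \<in> interior K" using d(1) h by blast
  moreover have "n' \<bullet> (?y - x) = - (?s * (1 + n \<bullet> n'))"
    using n by (simp add: inner_add_right norm_eq_1 inner_commute[of n' n])
  then have "n' \<bullet> (?y - x) < 0" using mult_pos_pos[OF s pos] by linarith
  then have "?y \<in> interior K'" using d(2) h' by blast
  ultimately show False using inter_disjoint_interior[OF K] interior_subset by blast
qed

lemma at_most_two_adjacent_cells:
  assumes "K1 \<in> adjacent_cells e" "K2 \<in> adjacent_cells e" "K3 \<in> adjacent_cells e" "K1 \<noteq> K2" "K2 \<noteq> K3" "K1 \<noteq> K3"
  shows False
proof -
  have "e \<in> mesh_faces \<T>" using assms by (auto simp: adjacent_cells_def mesh_faces_def)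
  then obtain x where x: "x \<in> rel_interior e"
    using mesh_face_facts(3,4) rel_interior_eq_empty by blast
  have hb: "\<exists>n r. norm n = 1 \<and> r > 0 \<and> (\<forall>y. dist x y < r \<and> n \<bullet> (y - x) < 0 \<longrightarrow> y \<in> interior K)"
    if "K \<in> adjacent_cells e" for K
    using that cell.half_ball[OF cell_of_mesh _ x] by (auto simp: adjacent_cells_def)
  obtain n1 r1 where 1: "norm n1 = 1" "r1 > 0" "\<And>y. dist x y < r1 \<and> n1 \<bullet> (y - x) < 0 \<Longrightarrow> y \<in> interior K1"
    using hb[OF assms(1)] by blast
  obtain n2 r2 where 2: "norm n2 = 1" "r2 > 0" "\<And>y. dist x y < r2 \<and> n2 \<bullet> (y - x) < 0 \<Longrightarrow> y \<in> interior K2"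
    using hb[OF assms(2)] by blast
  obtain n3 r3 where 3: "norm n3 = 1" "r3 > 0" "\<And>y. dist x y < r3 \<and> n3 \<bullet> (y - x) < 0 \<Longrightarrow> y \<in> interior K3"
    using hb[OF assms(3)] by blast
  have T: "K1 \<in> \<T>" "K2 \<in> \<T>" "K3 \<in> \<T>" using assms by (auto simp: adjacent_cells_def)
  have "n2 = - n1" by (rule normals_opposite[OF T(1,2) assms(4) 1(1) 2(1) 1(2) 2(2) 1(3) 2(3)])
  moreover have "n3 = - n2" by (rule normals_opposite[OF T(2,3) assms(5) 2(1) 3(1) 2(2) 3(2) 2(3) 3(3)])
  moreover have "n3 = - n1" by (rule normals_opposite[OF T(1,3) assms(6) 1(1) 3(1) 1(2) 3(2) 1(3) 3(3)])
  ultimately have "n1 = - n1" by simp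
  then have "2 *\<^sub>R n1 = 0" unfolding scaleR_2 by (metis add.right_inverse)
  then show False using 1(1) by simp
qed

text \<open>The half balls of the two cells fill a ball up to a hyperplane, so the ball lies in the closure of
  \<open>\<Omega>\<close>, and its centre in \<open>\<Omega>\<close>.\<close>

lemma two_cells_rel_interior:
  assumes "K \<in> adjacent_cells e" "K' \<in> adjacent_cells e" "K \<noteq> K'"
  shows "rel_interior e \<subseteq> \<Omega>"
proof
  have K: "K \<in> \<T>" "e \<in> facets K" and K': "K' \<in> \<T>" "K' \<noteq> K" and eK': "e \<in> facets K'"
    using assms by (auto simp: adjacent_cells_def)
  interpret K: cell K by (rule cell_of_mesh) fact
  fix z assume z: "z \<in> rel_interior e"
  obtain n r where 1: "norm n = 1" "r > 0" "\<And>y. dist z y < r \<and> n \<bullet> (y - z) < 0 \<Longrightarrow> y \<in> interior K"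
    using K.half_ball[OF K(2) z] by blast
  obtain n' r' where 2: "norm n' = 1" "r' > 0" "\<And>y. dist z y < r' \<and> n' \<bullet> (y - z) < 0 \<Longrightarrow> y \<in> interior K'"
    using cell.half_ball[OF cell_of_mesh[OF K'(1)] eK' z] by blast
  have n': "n' = - n"
    by (rule normals_opposite[OF K(1) K'(1) K'(2)[symmetric] 1(1) 2(1) 1(2) 2(2) 1(3) 2(3)])
  let ?B = "ball z (min r r')"
  have off: "y \<in> K \<union> K'" if "y \<in> ?B" "n \<bullet> (y - z) \<noteq> 0" for y
  proof (cases "n \<bullet> (y - z) < 0")
    case True
    then show ?thesis using 1(3)[of y] that interior_subset by auto
  next
    case False
    then have "n' \<bullet> (y - z) < 0" using that n' by simp
    then show ?thesis using 2(3)[of y] that interior_subset by auto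
  qed
  have "y \<in> K \<union> K'" if y: "y \<in> ?B" for y
  proof (rule ccontr)
    assume ny: "y \<notin> K \<union> K'"
    have "open (?B - (K \<union> K'))"
      using K.closed_cell cell.closed_cell[OF cell_of_mesh[OF K'(1)]] by auto
    moreover have "?B - (K \<union> K') \<subseteq> {y. n \<bullet> y = n \<bullet> z}"
    proof
      fix y assume "y \<in> ?B - (K \<union> K')"
      then have "n \<bullet> (y - z) = 0" using off by blast
      then show "y \<in> {y. n \<bullet> y = n \<bullet> z}" by (simp add: inner_diff_right)
    qed
    moreover have "negligible {y. n \<bullet> y = n \<bullet> z}" using 1(1) by (intro negligible_hyperplane) auto
    ultimately show False
      using y ny open_not_negligible[of "?B - (K \<union> K')"] negligible_subset by blast
  qed
  then have "?B \<subseteq> closure \<Omega>" using Union_cells K(1) K'(1) by blast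
  then have "z \<in> interior (closure \<Omega>)" using 1(2) 2(2) by (intro interiorI[of ?B]) auto
  then show "z \<in> \<Omega>" using Lipschitz_domain_interior_closure[OF dom] by simp
qed

lemma interior_face_two_cells:
  assumes e: "e \<in> interior_faces \<Omega> \<T>"
  obtains K K' where "K \<noteq> K'" "adjacent_cells e = {K, K'}" "rel_interior e \<subseteq> \<Omega>"
proof -
  have em: "e \<in> mesh_faces \<T>" and nf: "\<not> e \<subseteq> frontier \<Omega>" using e by (auto simp: interior_faces_def)
  note fe = mesh_face_facts[OF em]
  obtain K where K: "K \<in> \<T>" "e \<in> facets K" using em by (rule mesh_faceE)
  interpret K: cell K by (rule cell_of_mesh) fact
  have sub: "e \<subseteq> closure \<Omega>" using K.facet_facts(8)[OF K(2)] K(1) Union_cells by blast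
  obtain x0 where x0: "x0 \<in> e" "x0 \<in> \<Omega>" using nf sub open_dom by (auto simp: frontier_def interior_open)
  have "closure (rel_interior e) = e"
    using fe(4,5) by (simp add: convex_closure_rel_interior closure_closed)
  then have "\<Omega> \<inter> closure (rel_interior e) \<noteq> {}" using x0 by blast
  then obtain x where x: "x \<in> rel_interior e" "x \<in> \<Omega>"
    using open_Int_closure_eq_empty[OF open_dom] by blast
  have xe: "x \<in> e" using x rel_interior_subset by blast
  \<comment> \<open>If no other cell contained \<open>x\<close>, a neighbourhood of \<open>x\<close> would lie in \<open>K\<close> alone.\<close>
  let ?C = "\<Union>(\<T> - {K})"
  have clC: "closed ?C" using finite_cells cell_of_mesh cell.closed_cell by (intro closed_Union) auto
  have "x \<in> ?C"
  proof (rule ccontr)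
    assume "x \<notin> ?C"
    then have "x \<in> \<Omega> - ?C" using x by blast
    moreover have "open (\<Omega> - ?C)" using open_dom clC by (rule open_Diff)
    moreover have "\<Omega> - ?C \<subseteq> K" using Union_cells closure_subset by blast
    ultimately have "x \<in> interior K" by (rule_tac interiorI)
    then show False using K.frontier_cell K(2) xe by (auto simp: frontier_def)
  qed
  then obtain K' where K': "K' \<in> \<T>" "K' \<noteq> K" "x \<in> K'" by blast
  have "(K \<inter> K') \<inter> rel_interior e \<noteq> {}" using x K' xe K.facet_facts(8)[OF K(2)] by blast
  then have "e \<subseteq> K \<inter> K'"
    using subset_of_face_of[OF inter_face_of[OF K(1) K'(1)] K.facet_facts(8)[OF K(2)]] by blast
  then have "e \<inter> (K \<inter> K') = e" by blast
  then have eK: "e = K \<inter> K'"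
    using K.facet_eq_face[OF K(2) inter_face_of[OF K(1) K'(1)] inter_ne_cell[OF K(1) K'(1) K'(2)[symmetric]]] fe(6) by simp
  have "e \<in> facets K'"
    using inter_facet[OF K'(1) K(1) K'(2)] eK fe(6) by (simp add: Int_commute)
  then have a: "K \<in> adjacent_cells e" "K' \<in> adjacent_cells e" using K K' by (auto simp: adjacent_cells_def)
  then have adjacent_cells: "adjacent_cells e = {K, K'}" using at_most_two_adjacent_cells[OF a] K'(2) by blast
  have "rel_interior e \<subseteq> \<Omega>"
    by (rule two_cells_rel_interior[OF a]) (use K'(2) in simp)
  then show ?thesis using that K'(2) adjacent_cells by blast
qed

lemma two_cells_interior_face:
  assumes "K \<in> adjacent_cells e" "K' \<in> adjacent_cells e" "K \<noteq> K'"
  shows "e \<in> interior_faces \<Omega> \<T>"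
proof -
  have e: "e \<in> mesh_faces \<T>" using assms by (auto simp: adjacent_cells_def mesh_faces_def)
  obtain x where "x \<in> rel_interior e"
    using mesh_face_facts(3,4)[OF e] rel_interior_eq_empty by blast
  then have "x \<in> e" "x \<in> \<Omega>" using rel_interior_subset two_cells_rel_interior[OF assms] by blast+
  then show ?thesis using e open_dom by (auto simp: interior_faces_def frontier_def interior_open)
qed

lemma frontier_dom: "frontier \<Omega> \<subseteq> (\<Union>K\<in>\<T>. frontier K)"
proof
  fix x assume x: "x \<in> frontier \<Omega>"
  then have "x \<in> closure \<Omega>" "x \<notin> \<Omega>" using open_dom by (auto simp: frontier_def interior_open)
  then obtain K where "K \<in> \<T>" "x \<in> K" using Union_cells by blast
  moreover from this have "x \<notin> interior K" using interior_cell_subset \<open>x \<notin> \<Omega>\<close> by blast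
  ultimately show "x \<in> (\<Union>K\<in>\<T>. frontier K)" using closure_subset by (fastforce simp: frontier_def)
qed

lemma negligible_frontier_dom: "negligible (frontier \<Omega>)"
proof -
  have "negligible (\<Union>K\<in>\<T>. frontier K)"
    using finite_cells cell_of_mesh cell.convex_cell negligible_convex_frontier by (intro negligible_Union) auto
  then show ?thesis using frontier_dom negligible_subset by blast
qed

text \<open>Otherwise the frontier of \<open>\<Omega>\<close> would be contained in a finite union of sets of codimension two,
  whose complement is connected but meets both \<open>\<Omega>\<close> and its exterior.\<close>

lemma ex_boundary_face: "boundary_faces \<Omega> \<T> \<noteq> {}"
proof
  assume "boundary_faces \<Omega> \<T> = {}"
  then have int: "e \<in> interior_faces \<Omega> \<T>" if "e \<in> mesh_faces \<T>" for e
    using that by (auto simp: interior_faces_def boundary_faces_def)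
  let ?\<A> = "\<Union>e\<in>mesh_faces \<T>. {F. F facet_of e}"
  have fA: "finite ?\<A>" using finite_mesh_faces mesh_face_facts(1) finite_polytope_facets by blast
  have dA: "aff_dim F \<le> int DIM('a) - 2" if "F \<in> ?\<A>" for F
    using that mesh_face_facts(6) by (auto simp: facet_of_def)
  have neg: "negligible (\<Union>?\<A>)"
    using fA dA by (intro negligible_Union) (force intro: negligible_aff_dim)+
  have conn: "connected (UNIV - \<Union>?\<A>)"
    by (rule connected_diff_lowdim[OF connected_UNIV open_UNIV fA dA])
  have "frontier \<Omega> \<subseteq> \<Union>?\<A>"
  proof
    fix x assume x: "x \<in> frontier \<Omega>"
    then obtain K where K: "K \<in> \<T>" "x \<in> frontier K" using frontier_dom by blast
    then obtain e where e: "e \<in> facets K" "x \<in> e" using cell.frontier_cell[OF cell_of_mesh] by blast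
    have em: "e \<in> mesh_faces \<T>" using K e by (auto simp: mesh_faces_def)
    have "x \<notin> rel_interior e"
      using interior_face_two_cells[OF int[OF em]] x open_dom by (metis DiffD2 frontier_def interior_open subsetD)
    then show "x \<in> \<Union>?\<A>"
      using e(2) em rel_boundary_of_polyhedron[OF polytope_imp_polyhedron[OF mesh_face_facts(1)[OF em]]] by blast
  qed
  moreover have "(UNIV - \<Union>?\<A>) \<inter> \<Omega> \<noteq> {}"
    using neg open_not_negligible[OF open_dom dom_nonempty] negligible_subset[OF neg, of \<Omega>] by blast
  moreover have "(UNIV - \<Union>?\<A>) - \<Omega> \<noteq> {}"
  proof -
    have "open (- closure \<Omega>)" by (rule open_Compl[OF closed_closure])
    moreover have "- closure \<Omega> \<noteq> {}"
      using bdd bounded_closure not_bounded_UNIV by (metis Compl_empty_eq double_complement)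
    ultimately have "\<not> negligible (- closure \<Omega>)" by (rule open_not_negligible)
    then have "\<not> - closure \<Omega> \<subseteq> \<Union>?\<A>" using neg negligible_subset by blast
    then show ?thesis using closure_subset by blast
  qed
  ultimately show False using connected_Int_frontier[OF conn, of \<Omega>] by blast
qed

text \<open>A piecewise constant function that has equal values on both sides of every interior face and vanishes
  on the cells with a boundary face is zero: after removal of the pairwise intersections of
  codimension two, cells with zero and cells with nonzero value would have to meet in a common facet.\<close>

lemma cell_values_zero:
  fixes P :: "'a set \<Rightarrow> real"
  assumes jump: "\<And>e K K'. e \<in> interior_faces \<Omega> \<T> \<Longrightarrow> K \<in> adjacent_cells e \<Longrightarrow> K' \<in> adjacent_cells e \<Longrightarrow> P K = P K'"
    and bd: "\<And>e K. e \<in> boundary_faces \<Omega> \<T> \<Longrightarrow> K \<in> adjacent_cells e \<Longrightarrow> P K = 0"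
    and K: "K \<in> \<T>"
  shows "P K = 0"
proof -
  obtain eb where eb: "eb \<in> boundary_faces \<Omega> \<T>" using ex_boundary_face by blast
  then obtain K0 where K0: "K0 \<in> \<T>" "eb \<in> facets K0" by (auto simp: boundary_faces_def elim: mesh_faceE)
  then have P0: "P K0 = 0" using bd[OF eb] by (auto simp: adjacent_cells_def)
  let ?\<A> = "{K1 \<inter> K2 |K1 K2. K1 \<in> \<T> \<and> K2 \<in> \<T> \<and> K1 \<noteq> K2 \<and> aff_dim (K1 \<inter> K2) \<le> int DIM('a) - 2}"
  let ?S = "\<Union>?\<A>"
  have fA: "finite ?\<A>"
    by (rule finite_subset[of _ "(\<lambda>(K1, K2). K1 \<inter> K2) ` (\<T> \<times> \<T>)"]) (use finite_cells in auto)
  define S where "S = ?S"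
  have inS: "x \<in> S \<longleftrightarrow> (\<exists>K1\<in>\<T>. \<exists>K2\<in>\<T>. K1 \<noteq> K2 \<and> aff_dim (K1 \<inter> K2) \<le> int DIM('a) - 2 \<and> x \<in> K1 \<and> x \<in> K2)" for x
    unfolding S_def by auto
  have conn: "connected (\<Omega> - S)"
    unfolding S_def by (rule connected_diff_lowdim[OF conn_dom open_dom fA]) auto
  let ?U = "\<Union>{K \<in> \<T>. P K = 0}" and ?V = "\<Union>{K \<in> \<T>. P K \<noteq> 0}"
  have cl: "closed ?U" "closed ?V"
    using finite_cells cell.closed_cell[OF cell_of_mesh] by (intro closed_Union; simp)+
  have int: "interior L \<noteq> {} \<and> interior L \<subseteq> \<Omega> - S" if L: "L \<in> \<T>" for L
  proof
    show "interior L \<noteq> {}" using cell.interior_ne[OF cell_of_mesh[OF L]] .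
    show "interior L \<subseteq> \<Omega> - S"
    proof
      fix x assume x: "x \<in> interior L"
      have "x \<notin> S"
      proof
        assume "x \<in> S"
        then obtain K1 K2 where "K1 \<in> \<T>" "K2 \<in> \<T>" "K1 \<noteq> K2" "x \<in> K1" "x \<in> K2" unfolding inS by blast
        then show False using x inter_disjoint_interior[OF L, of K1] inter_disjoint_interior[OF L, of K2] by blast
      qed
      then show "x \<in> \<Omega> - S" using x interior_cell_subset[OF L] by blast
    qed
  qed
  show ?thesis
  proof (rule ccontr)
    assume nz: "P K \<noteq> 0"
    have "?U \<inter> (\<Omega> - S) \<noteq> {}" using int[OF K0(1)] K0(1) P0 interior_subset by blast
    moreover have "?V \<inter> (\<Omega> - S) \<noteq> {}" using int[OF K] K nz interior_subset by blast
    moreover have "\<Omega> - S \<subseteq> ?U \<union> ?V" using Union_cells closure_subset by blast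
    ultimately have "?U \<inter> ?V \<inter> (\<Omega> - S) \<noteq> {}"
      using conn cl unfolding connected_closed by blast
    then obtain w where w: "w \<in> ?U" "w \<in> ?V" "w \<in> \<Omega>" "w \<notin> S" by blast
    obtain K1 where K1: "K1 \<in> \<T>" "P K1 = 0" "w \<in> K1" using w(1) by blast
    obtain K2 where K2: "K2 \<in> \<T>" "P K2 \<noteq> 0" "w \<in> K2" using w(2) by blast
    have ne: "K1 \<noteq> K2" using K1 K2 by auto
    have d: "aff_dim (K1 \<inter> K2) \<ge> int DIM('a) - 1"
    proof (rule ccontr)
      assume "\<not> ?thesis"
      then have "w \<in> S" unfolding inS using K1 K2 ne by (intro bexI[of _ K1] bexI[of _ K2]) auto
      then show False using w(4) by blast
    qed
    let ?e = "K1 \<inter> K2"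
    have f: "?e \<in> facets K1" "?e \<in> facets K2"
      using inter_facet[OF K1(1) K2(1) ne d] inter_facet[OF K2(1) K1(1) ne[symmetric]] d by (auto simp: Int_commute)
    have ei: "?e \<in> interior_faces \<Omega> \<T>"
      using f K1 K2 w(3) open_dom by (auto simp: interior_faces_def mesh_faces_def frontier_def interior_open)
    have "P K1 = P K2"
      by (rule jump[OF ei]) (use f K1(1) K2(1) in \<open>simp_all add: adjacent_cells_def\<close>)
    then show False using K1 K2 by simp
  qed
qed

section \<open>Integration over the mesh and the jump condition\<close>

lemma sets_dom: "\<Omega> \<in> sets lebesgue"
  using open_dom by (simp add: borel_open)

lemma sets_mesh_cell: "K \<in> \<T> \<Longrightarrow> K \<in> sets lebesgue"
  using cell.sets_cell[OF cell_of_mesh] .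

lemma finite_measure_dom: "finite_measure (lebesgue_on \<Omega>)"
  using bounded_set_imp_lmeasurable[OF bdd sets_dom] by (rule finite_measure_lebesgue_on)

text \<open>Almost every point lies on no frontier, hence in \<open>\<Omega>\<close> exactly if it lies in some cell, and then in
  only one.\<close>

lemma AE_generic:
  "AE x in lebesgue. x \<notin> frontier \<Omega> \<and> (\<forall>K\<in>\<T>. x \<notin> frontier K)"
proof -
  have "AE x in lebesgue. x \<notin> frontier \<Omega>"
    using negligible_frontier_dom by (auto simp: negligible_iff_null_sets intro: AE_not_in)
  moreover have "AE x in lebesgue. \<forall>K\<in>\<T>. x \<notin> frontier K"
  proof (rule AE_finite_allI[OF finite_cells])
    fix K assume "K \<in> \<T>"
    then have "negligible (frontier K)" using cell.convex_cell[OF cell_of_mesh] negligible_convex_frontier by blast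
    then show "AE x in lebesgue. x \<notin> frontier K"
      by (auto simp: negligible_iff_null_sets intro: AE_not_in)
  qed
  ultimately show ?thesis by eventually_elim auto
qed

lemma generic_mem_dom:
  assumes "x \<notin> frontier \<Omega>"
  shows "x \<in> \<Omega> \<longleftrightarrow> (\<exists>K\<in>\<T>. x \<in> K)"
proof -
  have "x \<in> closure \<Omega> \<longleftrightarrow> x \<in> \<Omega>" using assms open_dom closure_subset by (auto simp: frontier_def interior_open)
  then show ?thesis using Union_cells by blast
qed

lemma generic_unique_cell:
  assumes "\<forall>K\<in>\<T>. x \<notin> frontier K" "K \<in> \<T>" "K' \<in> \<T>" "x \<in> K" "x \<in> K'"
  shows "K = K'"
proof (rule ccontr)
  assume ne: "K \<noteq> K'"
  have "x \<in> interior K" using assms closure_subset by (force simp: frontier_def)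
  then show False using inter_disjoint_interior[OF assms(2,3) ne] assms(5) by blast
qed

lemma generic_sum_cells:
  fixes F :: "'a set \<Rightarrow> 'b::real_vector"
  assumes "\<forall>K\<in>\<T>. x \<notin> frontier K" "K \<in> \<T>" "x \<in> K"
  shows "(\<Sum>K'\<in>\<T>. indicator K' x *\<^sub>R F K') = F K"
proof -
  have "(\<Sum>K'\<in>\<T>. indicator K' x *\<^sub>R F K') = (\<Sum>K'\<in>\<T>. if K' = K then F K else 0)"
  proof (rule sum.cong[OF refl])
    fix K' assume "K' \<in> \<T>"
    then have "x \<in> K' \<longleftrightarrow> K' = K" using generic_unique_cell[OF assms(1) assms(2) _ assms(3)] assms(3) by blast
    then show "indicator K' x *\<^sub>R F K' = (if K' = K then F K else 0)" by (auto simp: indicator_def)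
  qed
  also have "\<dots> = F K" using finite_cells assms(2) by simp
  finally show ?thesis .
qed

lemma AE_dom_iff:
  "(AE x in lebesgue_on \<Omega>. P x) \<longleftrightarrow> (\<forall>K\<in>\<T>. AE x in lebesgue_on K. P x)"
proof
  assume "AE x in lebesgue_on \<Omega>. P x"
  then have "AE x in lebesgue. x \<in> \<Omega> \<longrightarrow> P x" using sets_dom by (simp add: AE_restrict_space_iff)
  then have "AE x in lebesgue. \<forall>K\<in>\<T>. x \<in> K \<longrightarrow> P x"
    using AE_generic by eventually_elim (use generic_mem_dom in blast)
  then show "\<forall>K\<in>\<T>. AE x in lebesgue_on K. P x"
    using sets_mesh_cell by (auto simp: AE_restrict_space_iff elim: eventually_mono)
next
  assume "\<forall>K\<in>\<T>. AE x in lebesgue_on K. P x"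
  then have "\<forall>K\<in>\<T>. AE x in lebesgue. x \<in> K \<longrightarrow> P x"
    using sets_mesh_cell by (auto simp: AE_restrict_space_iff)
  then have "AE x in lebesgue. \<forall>K\<in>\<T>. x \<in> K \<longrightarrow> P x" using finite_cells by (intro AE_finite_allI) auto
  then have "AE x in lebesgue. x \<in> \<Omega> \<longrightarrow> P x"
    using AE_generic by eventually_elim (use generic_mem_dom in blast)
  then show "AE x in lebesgue_on \<Omega>. P x" using sets_dom by (simp add: AE_restrict_space_iff)
qed

lemma AE_indicator_dom:
  fixes f :: "'a \<Rightarrow> 'b::real_vector"
  shows "AE x in lebesgue. (\<Sum>K\<in>\<T>. indicator K x *\<^sub>R f x) = indicator \<Omega> x *\<^sub>R f x"
  using AE_generic
proof eventually_elim
  case (elim x)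
  show ?case
  proof (cases "x \<in> \<Omega>")
    case True
    then obtain K where "K \<in> \<T>" "x \<in> K" using elim generic_mem_dom by blast
    then show ?thesis using generic_sum_cells[of x K "\<lambda>_. f x"] elim True by simp
  next
    case False
    then have "\<forall>K\<in>\<T>. x \<notin> K" using elim generic_mem_dom by blast
    then show ?thesis using False by (simp add: sum.neutral)
  qed
qed

lemma measurable_dom_cell:
  fixes v :: "'a \<Rightarrow> 'b::euclidean_space"
  assumes v: "v \<in> borel_measurable (lebesgue_on \<Omega>)" and K: "K \<in> \<T>"
  shows "v \<in> borel_measurable (lebesgue_on K)"
proof -
  have "(\<lambda>x. indicator \<Omega> x *\<^sub>R v x) \<in> borel_measurable lebesgue"
    using v sets_dom by (simp add: borel_measurable_restrict_space_iff)
  moreover have "(\<lambda>x. indicator K x :: real) \<in> borel_measurable lebesgue"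
    using sets_mesh_cell[OF K] by simp
  ultimately have "(\<lambda>x. indicator K x *\<^sub>R (indicator \<Omega> x *\<^sub>R v x)) \<in> borel_measurable lebesgue"
    by (rule borel_measurable_scaleR[rotated])
  moreover have "AE x in lebesgue. indicator K x *\<^sub>R (indicator \<Omega> x *\<^sub>R v x) = indicator K x *\<^sub>R v x"
    using AE_generic
  proof eventually_elim
    case (elim x)
    then show ?case using generic_mem_dom[of x] K by (auto simp: indicator_def)
  qed
  ultimately have "(\<lambda>x. indicator K x *\<^sub>R v x) \<in> borel_measurable lebesgue"
    by (rule borel_measurable_AE)
  then show ?thesis using sets_mesh_cell[OF K] by (simp add: borel_measurable_restrict_space_iff)
qed

lemma integrable_dom_cell:
  fixes f :: "'a \<Rightarrow> real"
  assumes f: "integrable (lebesgue_on \<Omega>) f" and K: "K \<in> \<T>"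
  shows "integrable (lebesgue_on K) f"
proof -
  have "integrable lebesgue (\<lambda>x. indicator \<Omega> x *\<^sub>R f x)"
    using f sets_dom by (simp add: integrable_restrict_space)
  then have "integrable lebesgue (\<lambda>x. indicator K x *\<^sub>R (indicator \<Omega> x *\<^sub>R f x))"
    by (rule integrable_mult_indicator[OF sets_mesh_cell[OF K]])
  moreover have "AE x in lebesgue. indicator K x *\<^sub>R (indicator \<Omega> x *\<^sub>R f x) = indicator K x *\<^sub>R f x"
    using AE_generic
  proof eventually_elim
    case (elim x)
    then show ?case using generic_mem_dom[of x] K by (auto simp: indicator_def)
  qed
  moreover have "(\<lambda>x. indicator K x *\<^sub>R f x) \<in> borel_measurable lebesgue"
    using measurable_dom_cell[OF _ K, of f] f sets_mesh_cell[OF K]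
    by (simp add: borel_measurable_restrict_space_iff borel_measurable_integrable)
  ultimately have "integrable lebesgue (\<lambda>x. indicator K x *\<^sub>R f x)"
    by (rule_tac integrable_cong_AE_imp) (auto elim!: eventually_mono)
  then show ?thesis using sets_mesh_cell[OF K] by (simp add: integrable_restrict_space)
qed

lemma integral_dom_cells:
  fixes f :: "'a \<Rightarrow> real"
  assumes f: "\<And>K. K \<in> \<T> \<Longrightarrow> integrable (lebesgue_on K) f"
    and m: "f \<in> borel_measurable (lebesgue_on \<Omega>)"
  shows "integrable (lebesgue_on \<Omega>) f"
    and "(LINT x|lebesgue_on \<Omega>. f x) = (\<Sum>K\<in>\<T>. LINT x|lebesgue_on K. f x)"
proof -
  have i: "integrable lebesgue (\<lambda>x. indicator K x *\<^sub>R f x)" if "K \<in> \<T>" for K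
    using f[OF that] sets_mesh_cell[OF that] by (simp add: integrable_restrict_space)
  have s: "integrable lebesgue (\<lambda>x. \<Sum>K\<in>\<T>. indicator K x *\<^sub>R f x)"
    by (rule Bochner_Integration.integrable_sum) (rule i)
  have m': "(\<lambda>x. indicator \<Omega> x *\<^sub>R f x) \<in> borel_measurable lebesgue"
    using m sets_dom by (simp add: borel_measurable_restrict_space_iff)
  have "integrable lebesgue (\<lambda>x. indicator \<Omega> x *\<^sub>R f x)"
    by (rule integrable_cong_AE_imp[OF s m']) (use AE_indicator_dom[of f] in \<open>auto elim: eventually_mono\<close>)
  then show "integrable (lebesgue_on \<Omega>) f" using sets_dom by (simp add: integrable_restrict_space)
  have "(LINT x|lebesgue_on \<Omega>. f x) = (LINT x|lebesgue. indicator \<Omega> x *\<^sub>R f x)"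
    using sets_dom by (simp add: integral_restrict_space)
  also have "\<dots> = (LINT x|lebesgue. (\<Sum>K\<in>\<T>. indicator K x *\<^sub>R f x))"
    by (rule integral_cong_AE[OF m' borel_measurable_integrable[OF s]])
       (use AE_indicator_dom[of f] in \<open>auto elim: eventually_mono\<close>)
  also have "\<dots> = (\<Sum>K\<in>\<T>. LINT x|lebesgue. indicator K x *\<^sub>R f x)"
    by (rule Bochner_Integration.integral_sum) (rule i)
  also have "\<dots> = (\<Sum>K\<in>\<T>. LINT x|lebesgue_on K. f x)"
    using sets_mesh_cell by (intro sum.cong refl) (simp add: integral_restrict_space)
  finally show "(LINT x|lebesgue_on \<Omega>. f x) = (\<Sum>K\<in>\<T>. LINT x|lebesgue_on K. f x)" .
qed

lemma integral_dom:
  fixes f :: "'a \<Rightarrow> real"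
  assumes f: "integrable (lebesgue_on \<Omega>) f"
  shows "(LINT x|lebesgue_on \<Omega>. f x) = (\<Sum>K\<in>\<T>. LINT x|lebesgue_on K. f x)"
  by (rule integral_dom_cells(2)) (use f integrable_dom_cell in auto)

lemma square_integrable_dom_cell:
  fixes v :: "'a \<Rightarrow> 'b::euclidean_space"
  assumes "square_integrable (lebesgue_on \<Omega>) v" "K \<in> \<T>"
  shows "square_integrable (lebesgue_on K) v"
  using assms measurable_dom_cell[of v K] integrable_dom_cell[of "\<lambda>x. (norm (v x))\<^sup>2" K]
  unfolding square_integrable_def by blast

lemma square_integrable_dom_iff:
  fixes v :: "'a \<Rightarrow> 'b::euclidean_space"
  shows "square_integrable (lebesgue_on \<Omega>) v \<longleftrightarrow>
    v \<in> borel_measurable (lebesgue_on \<Omega>) \<and> (\<forall>K\<in>\<T>. square_integrable (lebesgue_on K) v)"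
proof (intro iffI conjI ballI)
  assume "v \<in> borel_measurable (lebesgue_on \<Omega>) \<and> (\<forall>K\<in>\<T>. square_integrable (lebesgue_on K) v)"
  then show "square_integrable (lebesgue_on \<Omega>) v"
    unfolding square_integrable_def by (auto intro!: integral_dom_cells(1))
qed (auto simp: square_integrable_dom_cell, simp add: square_integrable_def)

text \<open>The function that is \<open>F K\<close> on each cell \<open>K\<close>.  On the null set where cells overlap the values are
  added, which does not matter.\<close>

definition glue :: "('a set \<Rightarrow> 'a \<Rightarrow> 'b::euclidean_space) \<Rightarrow> 'a \<Rightarrow> 'b" where
  "glue F x = (\<Sum>K\<in>\<T>. indicator K x *\<^sub>R F K x)"

lemma glue_AE:
  assumes "K \<in> \<T>"
  shows "AE x in lebesgue_on K. glue F x = F K x"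
proof -
  have "AE x in lebesgue. x \<in> K \<longrightarrow> glue F x = F K x"
    using AE_generic
  proof eventually_elim
    case (elim x)
    then show ?case using generic_sum_cells[of x K "\<lambda>K. F K x"] assms by (auto simp: glue_def)
  qed
  then show ?thesis using sets_mesh_cell[OF assms] by (simp add: AE_restrict_space_iff)
qed

lemma glue_square_integrable:
  assumes F: "\<And>K. K \<in> \<T> \<Longrightarrow> square_integrable (lebesgue_on K) (F K)"
  shows "square_integrable (lebesgue_on \<Omega>) (glue F)"
proof -
  have m: "glue F \<in> borel_measurable lebesgue"
    unfolding glue_def[abs_def]
  proof (rule borel_measurable_sum)
    fix K assume K: "K \<in> \<T>"
    then show "(\<lambda>x. indicator K x *\<^sub>R F K x) \<in> borel_measurable lebesgue"
      using F[OF K] sets_mesh_cell[OF K]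
      by (simp add: square_integrable_def borel_measurable_restrict_space_iff)
  qed
  have "square_integrable (lebesgue_on K) (glue F)" if K: "K \<in> \<T>" for K
    by (rule square_integrable_cong_AE[OF F[OF K]])
       (use m glue_AE[OF K, of F] in \<open>auto intro: measurable_restrict_space1 elim: eventually_mono\<close>)
  then show ?thesis
    unfolding square_integrable_dom_iff using m by (auto intro: measurable_restrict_space1)
qed

lemma sum_cells_faces:
  fixes f :: "'a set \<Rightarrow> 'a set \<Rightarrow> real"
  shows "(\<Sum>K\<in>\<T>. \<Sum>e\<in>facets K. f K e) = (\<Sum>e\<in>mesh_faces \<T>. \<Sum>K\<in>adjacent_cells e. f K e)"
proof -
  have "(\<Sum>K\<in>\<T>. \<Sum>e\<in>facets K. f K e) = (\<Sum>K\<in>\<T>. \<Sum>e\<in>{e \<in> mesh_faces \<T>. e \<in> facets K}. f K e)"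
    by (rule sum.cong[OF refl], rule sum.cong[OF _ refl]) (auto simp: mesh_faces_def)
  also have "\<dots> = (\<Sum>e\<in>mesh_faces \<T>. \<Sum>K\<in>adjacent_cells e. f K e)"
    unfolding adjacent_cells_def by (rule sum.swap_restrict[OF finite_cells finite_mesh_faces])
  finally show ?thesis .
qed

lemma has_weak_div_cell:
  assumes v: "has_weak_div \<Omega> v w" and K: "K \<in> \<T>"
  shows "has_weak_div K v w"
  unfolding has_weak_div_def
proof (intro conjI allI impI)
  have sq: "square_integrable (lebesgue_on \<Omega>) v" "square_integrable (lebesgue_on \<Omega>) w"
    using v by (auto simp: has_weak_div_def)
  then show "square_integrable (lebesgue_on K) v" "square_integrable (lebesgue_on K) w"
    using square_integrable_dom_cell K by auto
  fix \<phi> :: "'a \<Rightarrow> real" and D assume t: "test_function K \<phi> D"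
  have t': "test_function \<Omega> \<phi> D"
    using t interior_cell_subset[OF K] interior_open[OF open_dom] by (auto simp: test_function_def)
  have sD: "square_integrable (lebesgue_on \<Omega>) D" "square_integrable (lebesgue_on \<Omega>) \<phi>"
    using test_functionD(2,3)[OF t] bdd sets_dom square_integrable_lebesgue_on_continuous by blast+
  have only: "(LINT x|lebesgue_on \<Omega>. g x) = (LINT x|lebesgue_on K. g x)"
    if g: "integrable (lebesgue_on \<Omega>) g" "\<And>x. x \<notin> interior K \<Longrightarrow> g x = 0" for g :: "'a \<Rightarrow> real"
  proof -
    have "(LINT x|lebesgue_on K'. g x) = 0" if "K' \<in> \<T> - {K}" for K'
    proof -
      have "g x = 0" if "x \<in> K'" for x
        using inter_disjoint_interior[OF K, of K'] \<open>K' \<in> \<T> - {K}\<close> that g(2) by blast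
      then have "AE x in lebesgue_on K'. g x = 0" by (intro AE_I2) (auto simp: space_restrict_space)
      then show ?thesis by (rule integral_eq_zero_AE)
    qed
    then show ?thesis
      unfolding integral_dom[OF g(1)] using sum.remove[OF finite_cells K, of "\<lambda>K. LINT x|lebesgue_on K. g x"] by simp
  qed
  have "(LINT x|lebesgue_on \<Omega>. v x \<bullet> D x) = (LINT x|lebesgue_on K. v x \<bullet> D x)"
    by (rule only) (use square_integrable_inner[OF sq(1) sD(1)] test_functionD(5)[OF t] in auto)
  moreover have "(LINT x|lebesgue_on \<Omega>. w x * \<phi> x) = (LINT x|lebesgue_on K. w x * \<phi> x)"
    by (rule only) (use square_integrable_mult[OF sq(2) sD(2)] test_functionD(4)[OF t] in auto)
  ultimately show "(LINT x|lebesgue_on K. v x \<bullet> D x) = - (LINT x|lebesgue_on K. w x * \<phi> x)"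
    using v t' by (simp add: has_weak_div_def)
qed

text \<open>The sum of the outward normal traces of \<open>u\<close> from the cells at \<open>e\<close>.  At an interior face this is the
  jump of the normal component; at a boundary face it is the trace itself.\<close>

definition jump :: "('a \<Rightarrow> 'a) \<Rightarrow> 'a set \<Rightarrow> 'a \<Rightarrow> real" where
  "jump u e x = (\<Sum>K\<in>adjacent_cells e. normal_trace K u e x)"

text \<open>Square-integrable fields with a square-integrable normal trace on every cell, without any continuity
  between the cells.\<close>

definition has_traces :: "('a \<Rightarrow> 'a) \<Rightarrow> bool" where
  "has_traces u \<longleftrightarrow> square_integrable (lebesgue_on \<Omega>) u \<and> (\<forall>K\<in>\<T>. \<exists>\<gamma>. has_normal_trace K u \<gamma>)"

lemma has_traces_green:
  "has_traces u \<Longrightarrow> K \<in> \<T> \<Longrightarrow> green_data K u (wdiv K u) (normal_trace K u)"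
  using cell.green_of_trace[OF cell_of_mesh] by (auto simp: has_traces_def)

lemma has_traces_square_integrable:
  assumes "has_traces u" "K \<in> \<T>"
  shows "square_integrable (lebesgue_on K) u" "square_integrable (lebesgue_on K) (wdiv K u)"
    "e \<in> facets K \<Longrightarrow> square_integrable (surface_measure e) (normal_trace K u e)"
  using has_traces_green[OF assms] by (auto simp: green_data_def has_weak_div_def)

lemma jump_square_integrable:
  assumes "has_traces u"
  shows "square_integrable (surface_measure e) (jump u e)"
  unfolding jump_def[abs_def]
  by (rule square_integrable_sum) (use has_traces_square_integrable(3)[OF assms] in \<open>auto simp: adjacent_cells_def\<close>)

lemma sum_integral_adj:
  assumes u: "has_traces u" and g: "\<And>e. e \<in> mesh_faces \<T> \<Longrightarrow> square_integrable (surface_measure e) (g e)"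
  shows "(\<Sum>K\<in>\<T>. \<Sum>e\<in>facets K. LINT x|surface_measure e. normal_trace K u e x * g e x)
    = (\<Sum>e\<in>mesh_faces \<T>. LINT x|surface_measure e. jump u e x * g e x)"
  unfolding sum_cells_faces
proof (rule sum.cong[OF refl])
  fix e assume e: "e \<in> mesh_faces \<T>"
  have i: "integrable (surface_measure e) (\<lambda>x. normal_trace K u e x * g e x)" if "K \<in> adjacent_cells e" for K
    using square_integrable_mult[OF has_traces_square_integrable(3)[OF u] g[OF e]] that by (auto simp: adjacent_cells_def)
  show "(\<Sum>K\<in>adjacent_cells e. LINT x|surface_measure e. normal_trace K u e x * g e x)
      = (LINT x|surface_measure e. jump u e x * g e x)"
    unfolding jump_def sum_distrib_right
    by (rule Bochner_Integration.integral_sum[symmetric]) (rule i)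
qed

text \<open>Green's formula on \<open>\<Omega>\<close> for a piecewise divergence: the defect is the sum of the jumps.\<close>

lemma green_mesh:
  assumes u: "has_traces u" and w: "square_integrable (lebesgue_on \<Omega>) w"
    and wK: "\<And>K. K \<in> \<T> \<Longrightarrow> AE x in lebesgue_on K. w x = wdiv K u x" and t: "C1_gradient \<phi> D"
  shows "(LINT x|lebesgue_on \<Omega>. u x \<bullet> D x) + (LINT x|lebesgue_on \<Omega>. w x * \<phi> x)
    = (\<Sum>e\<in>mesh_faces \<T>. LINT x|surface_measure e. jump u e x * \<phi> x)"
proof -
  have cont: "continuous_on UNIV \<phi>" "continuous_on UNIV D"
    using t C1_gradient_continuous by (auto simp: C1_gradient_def)
  have sD: "square_integrable (lebesgue_on \<Omega>) D" "square_integrable (lebesgue_on \<Omega>) \<phi>"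
    using cont bdd sets_dom square_integrable_lebesgue_on_continuous by blast+
  have su: "square_integrable (lebesgue_on \<Omega>) u" using u by (simp add: has_traces_def)
  have "(LINT x|lebesgue_on \<Omega>. u x \<bullet> D x) + (LINT x|lebesgue_on \<Omega>. w x * \<phi> x)
    = (\<Sum>K\<in>\<T>. (LINT x|lebesgue_on K. u x \<bullet> D x) + (LINT x|lebesgue_on K. w x * \<phi> x))"
    unfolding integral_dom[OF square_integrable_inner[OF su sD(1)]]
      integral_dom[OF square_integrable_mult[OF w sD(2)]] by (rule sum.distrib[symmetric])
  also have "\<dots> = (\<Sum>K\<in>\<T>. \<Sum>e\<in>facets K. LINT x|surface_measure e. normal_trace K u e x * \<phi> x)"
  proof (rule sum.cong[OF refl])
    fix K assume K: "K \<in> \<T>"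
    have "(LINT x|lebesgue_on K. w x * \<phi> x) = (LINT x|lebesgue_on K. wdiv K u x * \<phi> x)"
    proof (rule integral_cong_lebesgue_on_AE)
      show "integrable (lebesgue_on K) (\<lambda>x. w x * \<phi> x)"
        using square_integrable_mult[OF w sD(2)] K by (rule integrable_dom_cell)
      show "integrable (lebesgue_on K) (\<lambda>x. wdiv K u x * \<phi> x)"
        by (rule square_integrable_mult[OF has_traces_square_integrable(2)[OF u K] square_integrable_dom_cell[OF sD(2) K]])
      show "AE x in lebesgue_on K. w x * \<phi> x = wdiv K u x * \<phi> x" using wK[OF K] by eventually_elim simp
    qed
    then show "(LINT x|lebesgue_on K. u x \<bullet> D x) + (LINT x|lebesgue_on K. w x * \<phi> x)
      = (\<Sum>e\<in>facets K. LINT x|surface_measure e. normal_trace K u e x * \<phi> x)"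
      using has_traces_green[OF u K] t by (simp add: green_data_def)
  qed
  also have "\<dots> = (\<Sum>e\<in>mesh_faces \<T>. LINT x|surface_measure e. jump u e x * \<phi> x)"
    by (rule sum_integral_adj[OF u])
       (use mesh_face_facts cont square_integrable_surface_continuous in blast)
  finally show ?thesis .
qed

text \<open>If \<open>u\<close> lies in \<open>Hdiv \<Omega>\<close>, its divergence is the piecewise one, and its jumps vanish on interior faces.\<close>

lemma Hdiv_jump:
  assumes u: "has_traces u" and H: "u \<in> Hdiv \<Omega>"
  shows "\<And>K. K \<in> \<T> \<Longrightarrow> AE x in lebesgue_on K. wdiv \<Omega> u x = wdiv K u x"
    and "\<And>e. e \<in> interior_faces \<Omega> \<T> \<Longrightarrow> AE x in surface_measure e. jump u e x = 0"
    and "has_weak_div \<Omega> u (wdiv \<Omega> u)"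
proof -
  show w: "has_weak_div \<Omega> u (wdiv \<Omega> u)"
  proof -
    obtain w where "has_weak_div \<Omega> u w" using H by (auto simp: Hdiv_def)
    then show ?thesis unfolding wdiv_def by (rule someI[of "has_weak_div \<Omega> u"])
  qed
  show eq: "AE x in lebesgue_on K. wdiv \<Omega> u x = wdiv K u x" if K: "K \<in> \<T>" for K
    using cell.wdiv_cell_AE[OF cell_of_mesh[OF K] has_weak_div_cell[OF w K]] by eventually_elim simp
  fix e assume e: "e \<in> interior_faces \<Omega> \<T>"
  then have em: "e \<in> mesh_faces \<T>" by (simp add: interior_faces_def)
  have "AE x in surface_measure e. x \<in> \<Omega> \<longrightarrow> jump u e x = 0"
  proof (rule facet_densities_vanish[where E = "mesh_faces \<T>"])
    fix \<phi> :: "'a \<Rightarrow> real" and D assume t: "test_function \<Omega> \<phi> D"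
    have "(\<Sum>e\<in>mesh_faces \<T>. LINT x|surface_measure e. jump u e x * \<phi> x)
        = (LINT x|lebesgue_on \<Omega>. u x \<bullet> D x) + (LINT x|lebesgue_on \<Omega>. wdiv \<Omega> u x * \<phi> x)"
      by (rule green_mesh[symmetric, OF u _ eq test_functionD(1)[OF t]])
         (use w in \<open>auto simp: has_weak_div_def\<close>)
    also have "\<dots> = 0" using w t by (simp add: has_weak_div_def)
    finally show "(\<Sum>e\<in>mesh_faces \<T>. LINT x|surface_measure e. jump u e x * \<phi> x) = 0" .
  qed (use finite_mesh_faces mesh_face_facts AE_mesh_face_other jump_square_integrable[OF u] open_dom em in auto)
  moreover have "rel_interior e \<subseteq> \<Omega>" using interior_face_two_cells[OF e] by blast
  ultimately show "AE x in surface_measure e. jump u e x = 0"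
    using AE_rel_interior[OF em] by (auto elim: eventually_elim2)
qed

lemma Hdiv_of_jump:
  assumes u: "has_traces u"
    and j: "\<And>e. e \<in> interior_faces \<Omega> \<T> \<Longrightarrow> AE x in surface_measure e. jump u e x = 0"
  shows "u \<in> Hdiv \<Omega>"
proof -
  let ?w = "glue (\<lambda>K. wdiv K u)"
  have w: "square_integrable (lebesgue_on \<Omega>) ?w"
    by (rule glue_square_integrable) (rule has_traces_square_integrable(2)[OF u])
  have "has_weak_div \<Omega> u ?w"
    unfolding has_weak_div_def
  proof (intro conjI allI impI w)
    show "square_integrable (lebesgue_on \<Omega>) u" using u by (simp add: has_traces_def)
    fix \<phi> :: "'a \<Rightarrow> real" and D assume t: "test_function \<Omega> \<phi> D"
    have "(LINT x|surface_measure e. jump u e x * \<phi> x) = 0" if e: "e \<in> mesh_faces \<T>" for e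
    proof -
      have "AE x in surface_measure e. jump u e x * \<phi> x = 0"
      proof (cases "e \<subseteq> frontier \<Omega>")
        case True
        have "\<phi> x = 0" if "x \<in> e" for x
          using that True test_functionD(4)[OF t, of x] by (auto simp: frontier_def)
        then show ?thesis using mesh_face_facts(8)[OF e] by (auto elim!: eventually_mono)
      next
        case False
        then show ?thesis using j[of e] e by (auto simp: interior_faces_def elim!: eventually_mono)
      qed
      then show ?thesis by (rule integral_eq_zero_AE)
    qed
    then have "(LINT x|lebesgue_on \<Omega>. u x \<bullet> D x) + (LINT x|lebesgue_on \<Omega>. ?w x * \<phi> x) = 0"
      using green_mesh[OF u w glue_AE test_functionD(1)[OF t]] by simp
    then show "(LINT x|lebesgue_on \<Omega>. u x \<bullet> D x) = - (LINT x|lebesgue_on \<Omega>. ?w x * \<phi> x)" by simp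
  qed
  then show ?thesis by (auto simp: Hdiv_def)
qed

end

section \<open>A finite alternative and measurability almost everywhere\<close>

text \<open>If \<open>b\<close> vanishes on the common kernel of finitely many linear functionals \<open>r j\<close>, it is a linear
  combination of them.  The vector space is given by a set \<open>Y\<close> and an operation \<open>add y c z\<close> that stands
  for \<open>y + c z\<close>.\<close>

lemma functional_in_span:
  fixes r :: "'j \<Rightarrow> 'y \<Rightarrow> real" and b :: "'y \<Rightarrow> real" and add :: "'y \<Rightarrow> real \<Rightarrow> 'y \<Rightarrow> 'y"
  assumes "finite J"
    and closed: "\<And>y c z. y \<in> Y \<Longrightarrow> z \<in> Y \<Longrightarrow> add y c z \<in> Y"
    and "\<And>j y c z. j \<in> J \<Longrightarrow> y \<in> Y \<Longrightarrow> z \<in> Y \<Longrightarrow> r j (add y c z) = r j y + c * r j z"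
    and "\<And>y c z. y \<in> Y \<Longrightarrow> z \<in> Y \<Longrightarrow> b (add y c z) = b y + c * b z"
    and "\<And>y. y \<in> Y \<Longrightarrow> (\<And>j. j \<in> J \<Longrightarrow> r j y = 0) \<Longrightarrow> b y = 0"
  shows "\<exists>x. \<forall>y\<in>Y. b y = (\<Sum>j\<in>J. x j * r j y)"
  using assms(1,3-)
proof (induction J arbitrary: b rule: finite_induct)
  case empty
  then show ?case by simp
next
  case (insert i J)
  show ?case
  proof (cases "\<forall>y\<in>Y. (\<forall>j\<in>J. r j y = 0) \<longrightarrow> r i y = 0")
    case True
    have "\<exists>x. \<forall>y\<in>Y. b y = (\<Sum>j\<in>J. x j * r j y)"
    proof (rule insert.IH)
      show "b y = 0" if y: "y \<in> Y" "\<And>j. j \<in> J \<Longrightarrow> r j y = 0" for y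
      proof (rule insert.prems(3)[OF y(1)])
        fix j assume "j \<in> insert i J"
        then show "r j y = 0" using True y by blast
      qed
    qed (use insert.prems in auto)
    then obtain x where x: "\<forall>y\<in>Y. b y = (\<Sum>j\<in>J. x j * r j y)" by blast
    have "(\<Sum>j\<in>J. (x(i := 0)) j * r j y) = (\<Sum>j\<in>J. x j * r j y)" for y
      by (rule sum.cong) (use insert.hyps in auto)
    then have "\<forall>y\<in>Y. b y = (\<Sum>j\<in>insert i J. (x(i := 0)) j * r j y)"
      using x insert.hyps by simp
    then show ?thesis by blast
  next
    case False
    then obtain y0 where y0: "y0 \<in> Y" "\<And>j. j \<in> J \<Longrightarrow> r j y0 = 0" "r i y0 \<noteq> 0" by blast
    let ?t = "b y0 / r i y0"
    have "\<exists>x. \<forall>y\<in>Y. b y - ?t * r i y = (\<Sum>j\<in>J. x j * r j y)"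
    proof (rule insert.IH)
      show "r j (add y c z) = r j y + c * r j z" if "j \<in> J" "y \<in> Y" "z \<in> Y" for j y c z
        using insert.prems(1) that by simp
      show "b (add y c z) - ?t * r i (add y c z) = b y - ?t * r i y + c * (b z - ?t * r i z)"
        if "y \<in> Y" "z \<in> Y" for y c z
        using insert.prems(1)[of i y z c] insert.prems(2)[of y z c] that by (simp add: algebra_simps)
      fix y assume y: "y \<in> Y" "\<And>j. j \<in> J \<Longrightarrow> r j y = 0"
      let ?z = "add y (- (r i y / r i y0)) y0"
      have "b ?z = 0"
      proof (rule insert.prems(3))
        show "?z \<in> Y" using closed y(1) y0(1) .
        fix j assume "j \<in> insert i J"
        then show "r j ?z = 0"
          using insert.prems(1)[of j y y0 "- (r i y / r i y0)"] y y0 by auto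
      qed
      then show "b y - ?t * r i y = 0"
        using insert.prems(2)[OF y(1) y0(1), of "- (r i y / r i y0)"] by simp
    qed
    then obtain x where x: "\<forall>y\<in>Y. b y - ?t * r i y = (\<Sum>j\<in>J. x j * r j y)" by blast
    have "(\<Sum>j\<in>J. (x(i := ?t)) j * r j y) = (\<Sum>j\<in>J. x j * r j y)" for y
      by (rule sum.cong) (use insert.hyps in auto)
    then have "\<forall>y\<in>Y. b y = (\<Sum>j\<in>insert i J. (x(i := ?t)) j * r j y)"
      using x insert.hyps by (auto simp: algebra_simps)
    then show ?thesis by blast
  qed
qed

text \<open>The Lebesgue measure is complete, so a function that agrees almost everywhere with a measurable or
  an integrable function is measurable or integrable itself.\<close>

lemma borel_measurable_lebesgue_on_AE:
  fixes f g :: "'a::euclidean_space \<Rightarrow> 'b::euclidean_space"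
  assumes S: "S \<in> sets lebesgue" and f: "f \<in> borel_measurable (lebesgue_on S)"
    and eq: "AE x in lebesgue_on S. f x = g x"
  shows "g \<in> borel_measurable (lebesgue_on S)"
proof -
  have "(\<lambda>x. indicator S x *\<^sub>R f x) \<in> borel_measurable lebesgue"
    using f S by (simp add: borel_measurable_restrict_space_iff)
  moreover have "AE x in lebesgue. x \<in> S \<longrightarrow> f x = g x" using eq S by (simp add: AE_restrict_space_iff)
  then have "AE x in lebesgue. indicator S x *\<^sub>R f x = indicator S x *\<^sub>R g x"
    by eventually_elim (auto simp: indicator_def)
  ultimately have "(\<lambda>x. indicator S x *\<^sub>R g x) \<in> borel_measurable lebesgue"
    by (rule borel_measurable_AE)
  then show ?thesis using S by (simp add: borel_measurable_restrict_space_iff)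
qed

lemma integral_lebesgue_on_AE:
  fixes f g :: "'a::euclidean_space \<Rightarrow> real"
  assumes S: "S \<in> sets lebesgue" and f: "integrable (lebesgue_on S) f"
    and eq: "AE x in lebesgue_on S. f x = g x"
  shows "integrable (lebesgue_on S) g" "(LINT x|lebesgue_on S. g x) = (LINT x|lebesgue_on S. f x)"
proof -
  have g: "g \<in> borel_measurable (lebesgue_on S)"
    using borel_measurable_lebesgue_on_AE[OF S _ eq] f by auto
  show "integrable (lebesgue_on S) g" using integrable_cong_AE_imp[OF f g] eq by (auto elim: eventually_mono)
  show "(LINT x|lebesgue_on S. g x) = (LINT x|lebesgue_on S. f x)"
    by (rule integral_cong_AE[OF g]) (use f eq in \<open>auto elim: eventually_mono\<close>)
qed

context cell
begin

lemma green_cong_data: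
  assumes g: "green_data K v w \<gamma>"
    and w: "AE x in lebesgue_on K. w x = w' x"
    and \<gamma>: "\<And>e. e \<in> facets K \<Longrightarrow> square_integrable (surface_measure e) (\<gamma>' e) \<and> (AE x in surface_measure e. \<gamma> e x = \<gamma>' e x)"
  shows "green_data K v w' \<gamma>'"
proof -
  have sw: "square_integrable (lebesgue_on K) w" using g by (simp add: green_data_def has_weak_div_def)
  then have sw': "square_integrable (lebesgue_on K) w'"
    using square_integrable_cong_AE[OF sw _ w] borel_measurable_lebesgue_on_AE[OF sets_cell _ w]
    by (auto simp: square_integrable_def)
  have W: "(LINT x|lebesgue_on K. w' x * \<phi> x) = (LINT x|lebesgue_on K. w x * \<phi> x)"
    if "continuous_on UNIV \<phi>" for \<phi> :: "'a \<Rightarrow> real"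
    by (rule integral_lebesgue_on_AE(2)[OF sets_cell square_integrable_mult[OF sw square_integrable_cell_continuous[OF that]]])
       (use w in \<open>auto elim: eventually_mono\<close>)
  have G: "(LINT x|surface_measure e. \<gamma>' e x * \<phi> x) = (LINT x|surface_measure e. \<gamma> e x * \<phi> x)"
    if e: "e \<in> facets K" and "continuous_on UNIV \<phi>" for \<phi> :: "'a \<Rightarrow> real" and e
  proof (rule integral_cong_AE)
    have s: "square_integrable (surface_measure e) (\<gamma> e)" using g e by (simp add: green_data_def)
    note s\<phi> = square_integrable_facet_continuous[OF that]
    show "(\<lambda>x. \<gamma>' e x * \<phi> x) \<in> borel_measurable (surface_measure e)"
      using square_integrable_mult[OF _ s\<phi>] \<gamma>[OF e] by (blast intro: borel_measurable_integrable)
    show "(\<lambda>x. \<gamma> e x * \<phi> x) \<in> borel_measurable (surface_measure e)"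
      using square_integrable_mult[OF s s\<phi>] by (rule borel_measurable_integrable)
    have "AE x in surface_measure e. \<gamma> e x = \<gamma>' e x" using \<gamma>[OF e] by simp
    then show "AE x in surface_measure e. \<gamma>' e x * \<phi> x = \<gamma> e x * \<phi> x" by eventually_elim simp
  qed
  show ?thesis
    unfolding green_data_def has_weak_div_def
  proof (intro conjI allI impI ballI)
    fix \<phi> :: "'a \<Rightarrow> real" and D
    show "(LINT x|lebesgue_on K. v x \<bullet> D x) = - (LINT x|lebesgue_on K. w' x * \<phi> x)" if "test_function K \<phi> D"
      unfolding W[OF test_functionD(2)[OF that]] using g that by (simp add: green_data_def has_weak_div_def)
    assume C: "C1_gradient \<phi> D"
    have "(\<Sum>e\<in>facets K. LINT x|surface_measure e. \<gamma>' e x * \<phi> x) = (\<Sum>e\<in>facets K. LINT x|surface_measure e. \<gamma> e x * \<phi> x)"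
      by (rule sum.cong[OF refl]) (rule G[OF _ C1_gradient_continuous[OF C]])
    then show "(LINT x|lebesgue_on K. v x \<bullet> D x) + (LINT x|lebesgue_on K. w' x * \<phi> x)
          = (\<Sum>e\<in>facets K. LINT x|surface_measure e. \<gamma>' e x * \<phi> x)"
      unfolding W[OF C1_gradient_continuous[OF C]] using g C by (simp add: green_data_def)
  qed (use g sw' \<gamma> in \<open>auto simp: green_data_def has_weak_div_def\<close>)
qed

lemma measure_cell_pos: "0 < measure lebesgue K"
proof -
  have "\<not> negligible K" using interior_ne open_not_negligible[OF open_interior] interior_subset negligible_subset by metis
  then have "measure lebesgue K \<noteq> 0"
    using negligible_iff_measure0[of K] lmeasurable_compact[OF compact_cell] by simp
  then show ?thesis using measure_nonneg[of lebesgue K] by linarith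
qed

end

section \<open>The multiscale spaces in coordinates\<close>

text \<open>The coefficient, the global fields and the solutions of the local problems on a mesh.\<close>

locale multiscale = mesh \<sigma> \<Omega> \<T>
  for \<sigma> :: real and \<Omega> :: "(real^'n) set" and \<T> :: "(real^'n) set set" +
  fixes k :: "real^'n \<Rightarrow> real^'n^'n" and kmin :: real and N :: nat
    and ug :: "nat \<Rightarrow> real^'n \<Rightarrow> real^'n"
    and rt :: "(real^'n) set \<Rightarrow> (real^'n) set \<Rightarrow> real^'n \<Rightarrow> real^'n"
    and \<eta> \<psi> :: "nat \<Rightarrow> (real^'n) set \<Rightarrow> (real^'n) set \<Rightarrow> real^'n \<Rightarrow> real^'n"
    and \<phi> :: "nat \<Rightarrow> (real^'n) set \<Rightarrow> (real^'n) set \<Rightarrow> real^'n \<Rightarrow> real"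
  assumes kmin: "0 < kmin"
    and k_ell: "\<And>x \<zeta>. x \<in> \<Omega> \<Longrightarrow> kmin * (norm \<zeta>)\<^sup>2 \<le> \<zeta> \<bullet> (k x *v \<zeta>)"
    and RT: "\<And>K e. K \<in> \<T> \<Longrightarrow> e \<in> facets K \<Longrightarrow> RT0_basis_function K e (rt K e)"
    and N: "1 \<le> N"
    and ug: "\<And>i. i \<in> {1..N} \<Longrightarrow> ug i \<in> Hdiv \<Omega> \<and> (\<forall>K\<in>\<T>. \<exists>\<gamma>. has_normal_trace K (ug i) \<gamma>)"
    and ug_flux: "\<And>i e. i \<in> {1..N} \<Longrightarrow> e \<in> mesh_faces \<T> \<Longrightarrow>
                    (LINT x|surface_measure e. face_trace \<T> (ug i) e x) \<noteq> 0"
    and loc: "\<And>i K e. i \<in> {1..N} \<Longrightarrow> K \<in> \<T> \<Longrightarrow> e \<in> facets K \<Longrightarrow>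
                local_problem k K e (ug i) (rt K e) (\<eta> i K e) (\<psi> i K e) (\<phi> i K e)"
begin

lemma ug_traces: "i \<in> {1..N} \<Longrightarrow> has_traces (ug i)"
  using ug[of i] by (auto simp: has_traces_def Hdiv_def has_weak_div_def)

lemma face_cell_adjacent: "e \<in> mesh_faces \<T> \<Longrightarrow> face_cell \<T> e \<in> adjacent_cells e"
  unfolding face_cell_def adjacent_cells_def mem_Collect_eq by (rule someI_ex) (auto simp: mesh_faces_def)

lemma adjacent_mesh_face: "K \<in> adjacent_cells e \<Longrightarrow> e \<in> mesh_faces \<T>"
  by (auto simp: adjacent_cells_def mesh_faces_def)

text \<open>The trace of a global field changes only its sign when the side of an interior face is changed.\<close>

lemma ug_opposite:
  assumes i: "i \<in> {1..N}" and K: "K \<in> adjacent_cells e" "K' \<in> adjacent_cells e" "K \<noteq> K'"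
  shows "AE x in surface_measure e. normal_trace K' (ug i) e x = - normal_trace K (ug i) e x"
proof -
  have e: "e \<in> interior_faces \<Omega> \<T>" using K by (rule two_cells_interior_face)
  have "AE x in surface_measure e. jump (ug i) e x = 0"
    using Hdiv_jump(2)[OF ug_traces[OF i] _ e] ug[OF i] by simp
  moreover have "adjacent_cells e = {K, K'}" using at_most_two_adjacent_cells[OF K(1,2)] K by blast
  then have "jump (ug i) e x = normal_trace K (ug i) e x + normal_trace K' (ug i) e x" for x
    using K(3) by (simp add: jump_def)
  ultimately show ?thesis by (auto elim: eventually_mono)
qed

text \<open>The outward trace of \<open>ug i\<close> on the facet \<open>e\<close> of \<open>K\<close>, scaled to integral one.\<close>

definition unit_flux :: "nat \<Rightarrow> (real^'n) set \<Rightarrow> (real^'n) set \<Rightarrow> real^'n \<Rightarrow> real" where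
  "unit_flux i K e x = normal_trace K (ug i) e x / (LINT y|surface_measure e. normal_trace K (ug i) e y)"

text \<open>The scaled trace of \<open>ug i\<close> on a face.  The cell used for it is irrelevant up to null sets, see
  \<open>unit_flux_eq\<close>.\<close>

definition flux :: "nat \<Rightarrow> (real^'n) set \<Rightarrow> real^'n \<Rightarrow> real" where
  "flux i e = unit_flux i (face_cell \<T> e) e"

lemma trace_ug_square_integrable:
  "i \<in> {1..N} \<Longrightarrow> K \<in> adjacent_cells e \<Longrightarrow> square_integrable (surface_measure e) (normal_trace K (ug i) e)"
  using has_traces_square_integrable(3)[OF ug_traces] by (simp add: adjacent_cells_def)

lemma flux_square_integrable:
  assumes "i \<in> {1..N}" "e \<in> mesh_faces \<T>"
  shows "square_integrable (surface_measure e) (flux i e)"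
  using square_integrable_cmult[OF trace_ug_square_integrable[OF assms(1) face_cell_adjacent[OF assms(2)]],
      of "1 / (LINT y|surface_measure e. normal_trace (face_cell \<T> e) (ug i) e y)"]
  by (simp add: flux_def unit_flux_def[abs_def])

lemma unit_flux_eq:
  assumes i: "i \<in> {1..N}" and K: "K \<in> adjacent_cells e"
  shows "(LINT x|surface_measure e. normal_trace K (ug i) e x) \<noteq> 0"
    and "AE x in surface_measure e. unit_flux i K e x = flux i e x"
proof -
  let ?K = "face_cell \<T> e" and ?I = "\<lambda>K. LINT x|surface_measure e. normal_trace K (ug i) e x"
  have em: "e \<in> mesh_faces \<T>" by (rule adjacent_mesh_face[OF K])
  have F: "?K \<in> adjacent_cells e" by (rule face_cell_adjacent[OF em])
  have I: "?I ?K \<noteq> 0" using ug_flux[OF i em] by (simp add: face_trace_def)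
  have "?I K \<noteq> 0 \<and> (AE x in surface_measure e. unit_flux i K e x = flux i e x)"
  proof (cases "K = ?K")
    case True
    then show ?thesis using I by (simp add: flux_def)
  next
    case False
    have o: "AE x in surface_measure e. normal_trace K (ug i) e x = - normal_trace ?K (ug i) e x"
      by (rule ug_opposite[OF i F K]) (use False in simp)
    have m: "normal_trace K (ug i) e \<in> borel_measurable (surface_measure e)"
      "normal_trace ?K (ug i) e \<in> borel_measurable (surface_measure e)"
      using trace_ug_square_integrable[OF i] K F by (auto simp: square_integrable_def)
    have "?I K = (LINT x|surface_measure e. - normal_trace ?K (ug i) e x)"
      by (rule integral_cong_AE[OF m(1) borel_measurable_uminus[OF m(2)] o])
    then have "?I K = - ?I ?K" by simp
    moreover from o this have "AE x in surface_measure e. unit_flux i K e x = flux i e x"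
      by (auto simp: unit_flux_def flux_def elim!: eventually_mono)
    ultimately show ?thesis using I by simp
  qed
  then show "?I K \<noteq> 0" "AE x in surface_measure e. unit_flux i K e x = flux i e x" by auto
qed

text \<open>The scaling of the trace follows from Green's formula with \<open>\<phi> = 1\<close>: the divergence \<open>1 / |K|\<close> has
  integral one over the cell, so the flux of \<open>\<psi> i K e\<close> through \<open>e\<close> is one.\<close>

lemma psi_green:
  assumes i: "i \<in> {1..N}" and K: "K \<in> \<T>" and e: "e \<in> facets K"
  shows "green_data K (\<psi> i K e) (\<lambda>_. 1 / measure lebesgue K) (\<lambda>e' x. if e' = e then flux i e x else 0)"
proof -
  interpret cell K by (rule cell_of_mesh[OF K])
  have Ka: "K \<in> adjacent_cells e" using K e by (simp add: adjacent_cells_def)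
  have em: "e \<in> mesh_faces \<T>" by (rule adjacent_mesh_face[OF Ka])
  let ?nt = "normal_trace K (ug i) e"
  let ?I = "LINT y|surface_measure e. ?nt y"
  let ?R = "LINT y|surface_measure e. rt K e y \<bullet> outward_normal K e"
  let ?\<gamma> = "\<lambda>e' x. if e' = e then ?R / ?I * ?nt x else 0"
  have I: "?I \<noteq> 0" and fl: "AE x in surface_measure e. unit_flux i K e x = flux i e x"
    using unit_flux_eq[OF i Ka] by blast+
  have L: "has_weak_div K (\<psi> i K e) (wdiv K (rt K e))"
    "has_normal_trace K (\<psi> i K e) (\<lambda>e' x. if e' = e then ?R / ?I * normal_trace K (ug i) e x else 0)"
    using loc[OF i K e] unfolding local_problem_def by blast+
  have "has_weak_div K (rt K e) (\<lambda>_. 1 / measure lebesgue K)"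
    using RT[OF K e] by (simp add: RT0_basis_function_def)
  then have wrt: "AE x in lebesgue_on K. wdiv K (rt K e) x = 1 / measure lebesgue K"
    by (rule wdiv_cell_AE)
  obtain w where g: "green_data K (\<psi> i K e) w ?\<gamma>" using L(2) has_normal_trace_iff_green by blast
  have "AE x in lebesgue_on K. w x = wdiv K (rt K e) x"
    by (rule weak_div_cell_unique[OF _ L(1)]) (use g in \<open>auto simp: green_data_def\<close>)
  with wrt have w: "AE x in lebesgue_on K. w x = 1 / measure lebesgue K"
    by eventually_elim simp
  have nt: "integrable (surface_measure e) ?nt"
    by (rule square_integrable_imp_integrable[OF finite_measure_facet[OF e] trace_ug_square_integrable[OF i Ka]])
  have g1: "green_data K (\<psi> i K e) (\<lambda>_. 1 / measure lebesgue K) ?\<gamma>"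
    by (rule green_cong_data[OF g w]) (use g in \<open>auto simp: green_data_def\<close>)
  have "C1_gradient (\<lambda>_. 1) (\<lambda>_ :: real^'n. 0)" by (simp add: C1_gradient_def GDERIV_const)
  with g1 have "(LINT x|lebesgue_on K. \<psi> i K e x \<bullet> 0) + (LINT x|lebesgue_on K. 1 / measure lebesgue K * 1)
      = (\<Sum>e'\<in>facets K. LINT x|surface_measure e'. ?\<gamma> e' x * 1)"
    unfolding green_data_def by blast
  moreover have "(LINT x|lebesgue_on K. 1 / measure lebesgue K * 1) = 1"
    using measure_cell_pos sets_cell by (simp add: measure_restrict_space)
  moreover have "(\<Sum>e'\<in>facets K. LINT x|surface_measure e'. ?\<gamma> e' x * 1) = (LINT x|surface_measure e. ?R / ?I * ?nt x)"
  proof -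
    have "(LINT x|surface_measure e'. ?\<gamma> e' x * 1) = (if e' = e then LINT x|surface_measure e. ?R / ?I * ?nt x else 0)" for e'
      by simp
    then show ?thesis using finite_facets e by simp
  qed
  moreover have "(LINT x|surface_measure e. ?R / ?I * ?nt x) = ?R" using I by simp
  \<comment> \<open>The Raviart--Thomas field is prescribed on \<open>K\<close> only, so its normal component need not be measurable on
    the whole space.  Its flux \<open>?R\<close> is therefore obtained from Green's formula, not by evaluation on \<open>e\<close>.\<close>
  ultimately have "?R = 1" by simp
  then have "?\<gamma> = (\<lambda>e' x. if e' = e then unit_flux i K e x else 0)"
    by (intro ext) (simp add: unit_flux_def)
  with g1 have g2: "green_data K (\<psi> i K e) (\<lambda>_. 1 / measure lebesgue K) (\<lambda>e' x. if e' = e then unit_flux i K e x else 0)"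
    by simp
  show ?thesis
  proof (rule green_cong_data[OF g2])
    fix e' assume "e' \<in> facets K"
    show "square_integrable (surface_measure e') (\<lambda>x. if e' = e then flux i e x else 0) \<and>
      (AE x in surface_measure e'. (if e' = e then unit_flux i K e x else 0) = (if e' = e then flux i e x else 0))"
      using fl flux_square_integrable[OF i em] by (cases "e' = e") auto
  qed simp
qed

lemma k_eta: "i \<in> {1..N} \<Longrightarrow> K \<in> \<T> \<Longrightarrow> e \<in> facets K \<Longrightarrow>
    AE x in lebesgue_on K. k x *v \<eta> i K e x = - \<psi> i K e x"
  using loc[of i K e] unfolding local_problem_def by (auto simp: eq_neg_iff_add_eq_0 add.commute elim!: eventually_mono)

lemma eta_square_integrable: "i \<in> {1..N} \<Longrightarrow> K \<in> \<T> \<Longrightarrow> e \<in> facets K \<Longrightarrow> square_integrable (lebesgue_on K) (\<eta> i K e)"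
  using loc[of i K e] unfolding local_problem_def has_weak_grad_def by blast

lemma psi_square_integrable: "i \<in> {1..N} \<Longrightarrow> K \<in> \<T> \<Longrightarrow> e \<in> facets K \<Longrightarrow> square_integrable (lebesgue_on K) (\<psi> i K e)"
  using psi_green[of i K e] by (simp add: green_data_def has_weak_div_def)

text \<open>The linear combination of the local fields \<open>F i K e\<close> on the cell \<open>K\<close> with the coefficients \<open>C K i e\<close>.\<close>

definition local_comb :: "(nat \<Rightarrow> (real^'n) set \<Rightarrow> (real^'n) set \<Rightarrow> real^'n \<Rightarrow> real^'n) \<Rightarrow>
    ((real^'n) set \<Rightarrow> nat \<Rightarrow> (real^'n) set \<Rightarrow> real) \<Rightarrow> (real^'n) set \<Rightarrow> real^'n \<Rightarrow> real^'n" where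
  "local_comb F C K x = (\<Sum>i=1..N. \<Sum>e\<in>facets K. C K i e *\<^sub>R F i K e x)"

text \<open>\<open>C\<close> is a choice of coefficients for the element \<open>v\<close> of the broken space of \<open>F\<close>.  Coefficients need
  not be unique, since the local fields may be linearly dependent.\<close>

definition has_coeffs where
  "has_coeffs F v C \<longleftrightarrow> square_integrable (lebesgue_on \<Omega>) v \<and> (\<forall>K\<in>\<T>. AE x in lebesgue_on K. v x = local_comb F C K x)"

text \<open>The sum of the coefficients on \<open>K\<close>, which is the total outward flux through the boundary of \<open>K\<close> of the
  field with \<open>\<psi>\<close>-coefficients \<open>C\<close>.\<close>

definition total_flux :: "((real^'n) set \<Rightarrow> nat \<Rightarrow> (real^'n) set \<Rightarrow> real) \<Rightarrow> (real^'n) set \<Rightarrow> real" where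
  "total_flux C K = (\<Sum>i=1..N. \<Sum>e\<in>facets K. C K i e)"

lemma broken_space_iff: "v \<in> broken_space \<Omega> \<T> N F \<longleftrightarrow> (\<exists>C. has_coeffs F v C)"
proof
  assume v: "v \<in> broken_space \<Omega> \<T> N F"
  then have "\<forall>K\<in>\<T>. \<exists>c. AE x in lebesgue_on K. v x = (\<Sum>i=1..N. \<Sum>e\<in>facets K. c i e *\<^sub>R F i K e x)"
    by (simp add: broken_space_def)
  then obtain C where "\<forall>K\<in>\<T>. AE x in lebesgue_on K. v x = (\<Sum>i=1..N. \<Sum>e\<in>facets K. C K i e *\<^sub>R F i K e x)"
    by (auto simp: bchoice_iff)
  then show "\<exists>C. has_coeffs F v C" using v by (auto simp: has_coeffs_def local_comb_def broken_space_def)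
next
  assume "\<exists>C. has_coeffs F v C"
  then show "v \<in> broken_space \<Omega> \<T> N F" by (auto simp: has_coeffs_def local_comb_def broken_space_def)
qed

lemma coeffs_in: "has_coeffs F v C \<Longrightarrow> v \<in> broken_space \<Omega> \<T> N F"
  using broken_space_iff by blast

lemma local_comb_linear:
  "local_comb F (\<lambda>K i e. C K i e + c * C' K i e) K x = local_comb F C K x + c *\<^sub>R local_comb F C' K x"
  by (simp add: local_comb_def scaleR_add_left sum.distrib scaleR_sum_right)

lemma total_flux_linear: "total_flux (\<lambda>K i e. C K i e + c * C' K i e) K = total_flux C K + c * total_flux C' K"
  by (simp add: total_flux_def sum.distrib sum_distrib_left)

lemma coeffs_linear:
  assumes "has_coeffs F v C" "has_coeffs F v' C'"
  shows "has_coeffs F (\<lambda>x. v x + c *\<^sub>R v' x) (\<lambda>K i e. C K i e + c * C' K i e)"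
  unfolding has_coeffs_def
proof (intro conjI ballI)
  show "square_integrable (lebesgue_on \<Omega>) (\<lambda>x. v x + c *\<^sub>R v' x)"
    using assms by (intro square_integrable_add square_integrable_scaleR) (auto simp: has_coeffs_def)
  fix K assume "K \<in> \<T>"
  then have "AE x in lebesgue_on K. v x = local_comb F C K x" "AE x in lebesgue_on K. v' x = local_comb F C' K x"
    using assms by (auto simp: has_coeffs_def)
  then show "AE x in lebesgue_on K. v x + c *\<^sub>R v' x = local_comb F (\<lambda>K i e. C K i e + c * C' K i e) K x"
    by eventually_elim (simp add: local_comb_linear)
qed

lemma glue_coeffs:
  assumes "\<And>i K e. i \<in> {1..N} \<Longrightarrow> K \<in> \<T> \<Longrightarrow> e \<in> facets K \<Longrightarrow> square_integrable (lebesgue_on K) (F i K e)"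
  shows "has_coeffs F (glue (local_comb F C)) C"
  unfolding has_coeffs_def
proof
  show "square_integrable (lebesgue_on \<Omega>) (glue (local_comb F C))"
  proof (rule glue_square_integrable)
    fix K assume "K \<in> \<T>"
    then show "square_integrable (lebesgue_on K) (local_comb F C K)"
      unfolding local_comb_def[abs_def] by (intro square_integrable_sum square_integrable_scaleR assms)
  qed
qed (use glue_AE in blast)

lemma psi_coeffs: "has_coeffs \<psi> (glue (local_comb \<psi> C)) C"
  by (rule glue_coeffs) (rule psi_square_integrable)

lemma eta_coeffs: "has_coeffs \<eta> (glue (local_comb \<eta> C)) C"
  by (rule glue_coeffs) (rule eta_square_integrable)

lemma coeffs_square_integrable:
  "has_coeffs F v C \<Longrightarrow> square_integrable (lebesgue_on \<Omega>) v"
  "has_coeffs F v C \<Longrightarrow> K \<in> \<T> \<Longrightarrow> square_integrable (lebesgue_on K) v"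
  using square_integrable_dom_cell by (auto simp: has_coeffs_def)

text \<open>A \<open>\<theta>\<close> and a \<open>u\<close> with the same coefficients satisfy the constitutive law.\<close>

lemma k_coeffs_eta:
  assumes "has_coeffs \<eta> \<theta> C" "has_coeffs \<psi> u C"
  shows "AE x in lebesgue_on \<Omega>. k x *v \<theta> x = - u x"
  unfolding AE_dom_iff
proof
  fix K assume K: "K \<in> \<T>"
  have "AE x in lebesgue_on K. \<forall>i\<in>{1..N}. \<forall>e\<in>facets K. k x *v \<eta> i K e x = - \<psi> i K e x"
    using k_eta K cell.finite_facets[OF cell_of_mesh[OF K]] by (intro AE_finite_allI) auto
  moreover have "AE x in lebesgue_on K. \<theta> x = local_comb \<eta> C K x" "AE x in lebesgue_on K. u x = local_comb \<psi> C K x"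
    using assms K by (auto simp: has_coeffs_def)
  ultimately show "AE x in lebesgue_on K. k x *v \<theta> x = - u x"
  proof eventually_elim
    case (elim x)
    have "k x *v \<theta> x = (\<Sum>i=1..N. \<Sum>e\<in>facets K. C K i e *\<^sub>R (k x *v \<eta> i K e x))"
      unfolding elim(2) local_comb_def
      by (simp add: linear_sum[OF matrix_vector_mul_linear] matrix_vector_mult_scaleR)
    also have "\<dots> = - u x"
      unfolding elim(3) local_comb_def using elim(1) by (simp add: sum_negf)
    finally show ?case .
  qed
qed

text \<open>Divergence and normal traces of a field, read off from its coefficients.\<close>

lemma coeffs_green:
  assumes \<tau>: "has_coeffs \<psi> \<tau> C" and K: "K \<in> \<T>"
  shows "green_data K \<tau> (\<lambda>_. total_flux C K / measure lebesgue K) (\<lambda>e x. \<Sum>i=1..N. C K i e * flux i e x)"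
proof -
  interpret cell K by (rule cell_of_mesh[OF K])
  let ?J = "{1..N} \<times> facets K"
  let ?c = "\<lambda>p. C K (fst p) (snd p)"
  let ?w = "\<lambda>x::real^'n. \<Sum>p\<in>?J. ?c p * (1 / measure lebesgue K)"
  let ?\<gamma> = "\<lambda>e' x. \<Sum>p\<in>?J. ?c p * (if e' = snd p then flux (fst p) (snd p) x else 0)"
  have g: "green_data K (\<lambda>x. \<Sum>p\<in>?J. ?c p *\<^sub>R \<psi> (fst p) K (snd p) x) ?w ?\<gamma>"
  proof (rule green_sum)
    fix p assume "p \<in> ?J"
    then have "fst p \<in> {1..N}" "snd p \<in> facets K" by auto
    then show "green_data K (\<psi> (fst p) K (snd p)) (\<lambda>_. 1 / measure lebesgue K)
        (\<lambda>e' x. if e' = snd p then flux (fst p) (snd p) x else 0)" by (intro psi_green K)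
  qed
  have "(\<lambda>x. \<Sum>p\<in>?J. ?c p *\<^sub>R \<psi> (fst p) K (snd p) x) = local_comb \<psi> C K"
    by (intro ext) (simp add: local_comb_def sum.cartesian_product case_prod_beta')
  with g have g: "green_data K (local_comb \<psi> C K) ?w ?\<gamma>" by simp
  have w: "?w x = total_flux C K / measure lebesgue K" for x
    by (simp add: total_flux_def sum.cartesian_product sum_divide_distrib case_prod_beta')
  have f: "?\<gamma> e' x = (\<Sum>i=1..N. C K i e' * flux i e' x)" if "e' \<in> facets K" for e' x
  proof -
    have "?\<gamma> e' x = (\<Sum>i=1..N. \<Sum>e\<in>facets K. C K i e * (if e' = e then flux i e x else 0))"
      by (simp add: sum.cartesian_product case_prod_beta')
    also have "\<dots> = (\<Sum>i=1..N. \<Sum>e\<in>facets K. if e' = e then C K i e' * flux i e' x else 0)"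
      by (rule sum.cong[OF refl], rule sum.cong[OF refl]) simp
    also have "\<dots> = (\<Sum>i=1..N. C K i e' * flux i e' x)"
      using that finite_facets by (simp add: sum.delta)
    finally show ?thesis .
  qed
  have "green_data K \<tau> ?w ?\<gamma>"
    by (rule green_cong[OF g]) (use \<tau> K square_integrable_dom_cell in \<open>auto simp: has_coeffs_def\<close>)
  then show ?thesis
  proof (rule green_cong_data)
    fix e assume e: "e \<in> facets K"
    have "e \<in> mesh_faces \<T>" using K e by (auto simp: mesh_faces_def)
    then show "square_integrable (surface_measure e) (\<lambda>x. \<Sum>i=1..N. C K i e * flux i e x) \<and>
       (AE x in surface_measure e. ?\<gamma> e x = (\<Sum>i=1..N. C K i e * flux i e x))"
      unfolding f[OF e] by (auto intro!: square_integrable_sum square_integrable_cmult flux_square_integrable)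
  qed (unfold w, simp)
qed

lemma coeffs_traces: "has_coeffs \<psi> \<tau> C \<Longrightarrow> has_traces \<tau>"
  using coeffs_green has_normal_trace_iff_green coeffs_square_integrable(1) unfolding has_traces_def by blast

lemma coeffs_wdiv: "has_coeffs \<psi> \<tau> C \<Longrightarrow> K \<in> \<T> \<Longrightarrow> AE x in lebesgue_on K. wdiv K \<tau> x = total_flux C K / measure lebesgue K"
  using cell.green_normal_trace(3)[OF cell_of_mesh coeffs_green] .

lemma coeffs_trace: "has_coeffs \<psi> \<tau> C \<Longrightarrow> K \<in> adjacent_cells e \<Longrightarrow>
    AE x in surface_measure e. normal_trace K \<tau> e x = (\<Sum>i=1..N. C K i e * flux i e x)"
  using cell.green_normal_trace(2)[OF cell_of_mesh coeffs_green] by (simp add: adjacent_cells_def)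

lemma coeffs_jump:
  assumes \<tau>: "has_coeffs \<psi> \<tau> C"
  shows "AE x in surface_measure e. jump \<tau> e x = (\<Sum>i=1..N. (\<Sum>K\<in>adjacent_cells e. C K i e) * flux i e x)"
proof -
  have "AE x in surface_measure e. \<forall>K\<in>adjacent_cells e. normal_trace K \<tau> e x = (\<Sum>i=1..N. C K i e * flux i e x)"
    using coeffs_trace[OF \<tau>] finite_adjacent_cells by (intro AE_finite_allI) auto
  then show ?thesis
  proof eventually_elim
    case (elim x)
    then have "jump \<tau> e x = (\<Sum>K\<in>adjacent_cells e. \<Sum>i=1..N. C K i e * flux i e x)" by (simp add: jump_def)
    also have "\<dots> = (\<Sum>i=1..N. \<Sum>K\<in>adjacent_cells e. C K i e * flux i e x)" by (rule sum.swap)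
    finally show ?case by (simp add: sum_distrib_right)
  qed
qed

text \<open>If the coefficients from the two sides of each interior face cancel, the field is conforming.\<close>

lemma coeffs_X2:
  assumes \<tau>: "has_coeffs \<psi> \<tau> C" and C: "\<And>e i. e \<in> interior_faces \<Omega> \<T> \<Longrightarrow> i \<in> {1..N} \<Longrightarrow> (\<Sum>K\<in>adjacent_cells e. C K i e) = 0"
  shows "\<tau> \<in> X2 \<Omega> \<T> N \<psi>"
proof -
  have "\<tau> \<in> Hdiv \<Omega>"
  proof (rule Hdiv_of_jump[OF coeffs_traces[OF \<tau>]])
    fix e assume e: "e \<in> interior_faces \<Omega> \<T>"
    show "AE x in surface_measure e. jump \<tau> e x = 0"
      using coeffs_jump[OF \<tau>, of e] by eventually_elim (simp add: C[OF e])
  qed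
  then show ?thesis using coeffs_in[OF \<tau>] by (simp add: X2_def)
qed

text \<open>On an interior face the multipliers are the linear combinations of the functions \<open>flux i e\<close>.  For one
  inclusion a combination on \<open>e\<close> has to be extended to a conforming field: take opposite
  coefficients in the two cells at \<open>e\<close>.\<close>

lemma Pih_iff:
  "\<pi> \<in> Pih \<Omega> \<T> N \<psi> \<longleftrightarrow>
     (\<forall>e\<in>mesh_faces \<T>. square_integrable (surface_measure e) (\<pi> e)) \<and>
     (\<forall>e\<in>interior_faces \<Omega> \<T>. \<exists>d. AE x in surface_measure e. \<pi> e x = (\<Sum>i=1..N. d i * flux i e x)) \<and>
     (\<forall>e\<in>boundary_faces \<Omega> \<T>. AE x in surface_measure e. \<pi> e x = 0)"
proof -
  have "(\<exists>\<tau>\<in>X2 \<Omega> \<T> N \<psi>. AE x in surface_measure e. \<pi> e x = face_trace \<T> \<tau> e x) \<longleftrightarrow>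
     (\<exists>d. AE x in surface_measure e. \<pi> e x = (\<Sum>i=1..N. d i * flux i e x))"
    if e: "e \<in> interior_faces \<Omega> \<T>" for e
  proof
    have em: "e \<in> mesh_faces \<T>" using e by (simp add: interior_faces_def)
    have F: "face_cell \<T> e \<in> adjacent_cells e" by (rule face_cell_adjacent[OF em])
    {
      assume "\<exists>\<tau>\<in>X2 \<Omega> \<T> N \<psi>. AE x in surface_measure e. \<pi> e x = face_trace \<T> \<tau> e x"
      then obtain \<tau> C where \<tau>: "has_coeffs \<psi> \<tau> C" "AE x in surface_measure e. \<pi> e x = face_trace \<T> \<tau> e x"
        by (auto simp: X2_def broken_space_iff)
      from \<tau>(2) coeffs_trace[OF \<tau>(1) F]
      have "AE x in surface_measure e. \<pi> e x = (\<Sum>i=1..N. C (face_cell \<T> e) i e * flux i e x)"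
        by eventually_elim (simp add: face_trace_def)
      then show "\<exists>d. AE x in surface_measure e. \<pi> e x = (\<Sum>i=1..N. d i * flux i e x)"
        by (rule exI[of _ "\<lambda>i. C (face_cell \<T> e) i e"])
    next
      assume "\<exists>d. AE x in surface_measure e. \<pi> e x = (\<Sum>i=1..N. d i * flux i e x)"
      then obtain d where d: "AE x in surface_measure e. \<pi> e x = (\<Sum>i=1..N. d i * flux i e x)" by blast
      define C where "C K i e' = (if e' = e then if K = face_cell \<T> e then d i else - d i else 0)" for K :: "(real^'n) set" and i :: nat and e' :: "(real^'n) set"
      note r = psi_coeffs[of C]
      have "glue (local_comb \<psi> C) \<in> X2 \<Omega> \<T> N \<psi>"
      proof (rule coeffs_X2[OF r])
        fix e' i assume "e' \<in> interior_faces \<Omega> \<T>"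
        show "(\<Sum>K\<in>adjacent_cells e'. C K i e') = 0"
        proof (cases "e' = e")
          case True
          obtain K K' where K: "K \<noteq> K'" "adjacent_cells e = {K, K'}" by (rule interior_face_two_cells[OF e])
          have "face_cell \<T> e = K \<or> face_cell \<T> e = K'" using F unfolding K(2) by simp
          then show ?thesis unfolding True K(2) using K(1) by (elim disjE) (simp_all add: C_def)
        qed (simp add: C_def)
      qed
      moreover have "AE x in surface_measure e. \<pi> e x = face_trace \<T> (glue (local_comb \<psi> C)) e x"
        using d coeffs_trace[OF r F] by eventually_elim (simp add: face_trace_def C_def)
      ultimately show "\<exists>\<tau>\<in>X2 \<Omega> \<T> N \<psi>. AE x in surface_measure e. \<pi> e x = face_trace \<T> \<tau> e x" by blast
    }
  qed
  then show ?thesis unfolding Pih_def ae_eq_def by auto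
qed

text \<open>The moment of a function on the face \<open>e\<close> against \<open>flux i e\<close>.\<close>

definition flux_moment :: "nat \<Rightarrow> (real^'n) set \<Rightarrow> (real^'n \<Rightarrow> real) \<Rightarrow> real" where
  "flux_moment i e q = (LINT x|surface_measure e. flux i e x * q x)"

lemma Ch_jump:
  assumes "has_coeffs \<psi> \<tau> C" "\<And>e. e \<in> mesh_faces \<T> \<Longrightarrow> square_integrable (surface_measure e) (\<pi> e)"
  shows "Ch \<T> \<tau> \<pi> = (\<Sum>e\<in>mesh_faces \<T>. LINT x|surface_measure e. jump \<tau> e x * \<pi> e x)"
  unfolding Ch_def by (rule sum_integral_adj[OF coeffs_traces[OF assms(1)] assms(2)])

lemma integral_flux_comb:
  assumes e: "e \<in> mesh_faces \<T>" and q: "square_integrable (surface_measure e) q"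
    and f: "AE x in surface_measure e. f x = (\<Sum>i=1..N. d i * flux i e x)" and m: "f \<in> borel_measurable (surface_measure e)"
  shows "(LINT x|surface_measure e. f x * q x) = (\<Sum>i=1..N. d i * flux_moment i e q)"
proof -
  have i: "integrable (surface_measure e) (\<lambda>x. d i * (flux i e x * q x))" if "i \<in> {1..N}" for i
    using square_integrable_mult[OF flux_square_integrable[OF that e] q] by simp
  have [measurable]: "q \<in> borel_measurable (surface_measure e)" using q by (simp add: square_integrable_def)
  have "(LINT x|surface_measure e. f x * q x) = (LINT x|surface_measure e. (\<Sum>i=1..N. d i * (flux i e x * q x)))"
  proof (rule integral_cong_AE)
    show "(\<lambda>x. f x * q x) \<in> borel_measurable (surface_measure e)" using m by measurable
    show "(\<lambda>x. \<Sum>i=1..N. d i * (flux i e x * q x)) \<in> borel_measurable (surface_measure e)"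
      using i by (intro borel_measurable_sum borel_measurable_integrable)
    show "AE x in surface_measure e. f x * q x = (\<Sum>i=1..N. d i * (flux i e x * q x))"
      using f by eventually_elim (simp add: sum_distrib_right mult.assoc)
  qed
  also have "\<dots> = (\<Sum>i=1..N. LINT x|surface_measure e. d i * (flux i e x * q x))"
    by (rule Bochner_Integration.integral_sum) (rule i)
  finally show ?thesis by (simp add: flux_moment_def)
qed

lemma Ch_face_sum:
  assumes \<tau>: "has_coeffs \<psi> \<tau> C" and \<pi>: "\<And>e. e \<in> mesh_faces \<T> \<Longrightarrow> square_integrable (surface_measure e) (\<pi> e)"
  shows "Ch \<T> \<tau> \<pi> = (\<Sum>K\<in>\<T>. \<Sum>e\<in>facets K. \<Sum>i=1..N. C K i e * flux_moment i e (\<pi> e))"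
  unfolding Ch_def
proof (intro sum.cong refl)
  fix K e assume K: "K \<in> \<T>" "e \<in> facets K"
  then have Ka: "K \<in> adjacent_cells e" by (simp add: adjacent_cells_def)
  note e = adjacent_mesh_face[OF Ka]
  show "(LINT x|surface_measure e. normal_trace K \<tau> e x * \<pi> e x) = (\<Sum>i=1..N. C K i e * flux_moment i e (\<pi> e))"
    using has_traces_square_integrable(3)[OF coeffs_traces[OF \<tau>] K]
    by (intro integral_flux_comb[OF e \<pi>[OF e] coeffs_trace[OF \<tau> Ka]]) (simp add: square_integrable_def)
qed

text \<open>Tested with the divergence of \<open>\<tau>\<close>, a piecewise constant function sees only the sum of the coefficients.\<close>

lemma div_moment:
  assumes \<tau>: "has_coeffs \<psi> \<tau> C" and K: "K \<in> \<T>" and p: "AE x in lebesgue_on K. p x = c"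
  shows "(LINT x|lebesgue_on K. p x * wdiv K \<tau> x) = c * total_flux C K"
proof -
  interpret cell K by (rule cell_of_mesh[OF K])
  interpret finite_measure "lebesgue_on K" by (rule finite_measure_cell)
  have "integrable (lebesgue_on K) (\<lambda>x. c * (total_flux C K / measure lebesgue K))" by simp
  moreover have "AE x in lebesgue_on K. c * (total_flux C K / measure lebesgue K) = p x * wdiv K \<tau> x"
    using p coeffs_wdiv[OF \<tau> K] by eventually_elim simp
  ultimately have "(LINT x|lebesgue_on K. p x * wdiv K \<tau> x) = (LINT x|lebesgue_on K. c * (total_flux C K / measure lebesgue K))"
    by (rule integral_lebesgue_on_AE(2)[OF sets_cell])
  also have "\<dots> = c * total_flux C K" using measure_cell_pos sets_cell by (simp add: measure_restrict_space)
  finally show ?thesis .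
qed

lemma Qh_iff: "p \<in> Qh \<T> \<longleftrightarrow> (\<exists>P. \<forall>K\<in>\<T>. AE x in lebesgue_on K. p x = P K)"
  unfolding Qh_def by (auto simp: bchoice_iff)

lemma div_dom_moment:
  assumes \<tau>: "has_coeffs \<psi> \<tau> C" and H: "\<tau> \<in> Hdiv \<Omega>" and p: "\<forall>K\<in>\<T>. AE x in lebesgue_on K. p x = P K"
  shows "(LINT x|lebesgue_on \<Omega>. p x * wdiv \<Omega> \<tau> x) = (\<Sum>K\<in>\<T>. P K * total_flux C K)"
proof -
  note J = Hdiv_jump[OF coeffs_traces[OF \<tau>] H]
  let ?g = "glue (\<lambda>K _. P K * (total_flux C K / measure lebesgue K)) :: real^'n \<Rightarrow> real"
  have fm: "finite_measure (lebesgue_on K)" if "K \<in> \<T>" for K using cell.finite_measure_cell[OF cell_of_mesh[OF that]] .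
  have g: "square_integrable (lebesgue_on \<Omega>) ?g"
    by (rule glue_square_integrable) (auto intro: square_integrable_bounded[OF fm])
  have "AE x in lebesgue_on \<Omega>. ?g x = p x * wdiv \<Omega> \<tau> x"
    unfolding AE_dom_iff
  proof
    fix K assume K: "K \<in> \<T>"
    have "AE x in lebesgue_on K. p x = P K" using p K by blast
    with glue_AE[OF K, of "\<lambda>K _. P K * (total_flux C K / measure lebesgue K)"] J(1)[OF K] coeffs_wdiv[OF \<tau> K]
    show "AE x in lebesgue_on K. ?g x = p x * wdiv \<Omega> \<tau> x" by eventually_elim simp
  qed
  then have i: "integrable (lebesgue_on \<Omega>) (\<lambda>x. p x * wdiv \<Omega> \<tau> x)"
    by (rule integral_lebesgue_on_AE(1)[OF sets_dom square_integrable_imp_integrable[OF finite_measure_dom g]])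
  have "(LINT x|lebesgue_on K. p x * wdiv \<Omega> \<tau> x) = P K * total_flux C K" if K: "K \<in> \<T>" for K
  proof -
    have "AE x in lebesgue_on K. p x * wdiv \<Omega> \<tau> x = p x * wdiv K \<tau> x"
      using J(1)[OF K] by eventually_elim simp
    from integral_lebesgue_on_AE(2)[OF sets_mesh_cell[OF K] integrable_dom_cell[OF i K] this]
    show ?thesis using div_moment[OF \<tau> K, of p "P K"] p K by simp
  qed
  then show ?thesis unfolding integral_dom[OF i] by simp
qed

section \<open>Reduction of the equations to coefficients\<close>

lemma zero_of_energy_zero:
  assumes \<theta>: "square_integrable (lebesgue_on \<Omega>) \<theta>" and w: "square_integrable (lebesgue_on \<Omega>) w"
    and k: "AE x in lebesgue_on \<Omega>. k x *v \<theta> x = - w x"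
    and z: "(LINT x|lebesgue_on \<Omega>. \<theta> x \<bullet> w x) = 0"
  shows "AE x in lebesgue_on \<Omega>. \<theta> x = 0" "AE x in lebesgue_on \<Omega>. w x = 0"
proof -
  have "(LINT x|lebesgue_on \<Omega>. kmin * (\<theta> x \<bullet> \<theta> x)) \<le> (LINT x|lebesgue_on \<Omega>. - (\<theta> x \<bullet> w x))"
  proof (rule integral_mono_AE)
    show "integrable (lebesgue_on \<Omega>) (\<lambda>x. kmin * (\<theta> x \<bullet> \<theta> x))"
      "integrable (lebesgue_on \<Omega>) (\<lambda>x. - (\<theta> x \<bullet> w x))"
      using square_integrable_inner[OF \<theta> \<theta>] square_integrable_inner[OF \<theta> w] by auto
    show "AE x in lebesgue_on \<Omega>. kmin * (\<theta> x \<bullet> \<theta> x) \<le> - (\<theta> x \<bullet> w x)"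
      using k AE_space
    proof eventually_elim
      case (elim x)
      then have "x \<in> \<Omega>" by (simp add: space_restrict_space)
      from k_ell[OF this, of "\<theta> x"] show ?case unfolding elim(1) by (simp add: power2_norm_eq_inner)
    qed
  qed
  then have "kmin * (LINT x|lebesgue_on \<Omega>. \<theta> x \<bullet> \<theta> x) \<le> 0" using z by simp
  then have "(LINT x|lebesgue_on \<Omega>. \<theta> x \<bullet> \<theta> x) \<le> 0" using kmin by (simp add: mult_le_0_iff)
  moreover have "0 \<le> (LINT x|lebesgue_on \<Omega>. \<theta> x \<bullet> \<theta> x)" by (rule integral_nonneg_AE) simp
  ultimately show t: "AE x in lebesgue_on \<Omega>. \<theta> x = 0"
    using AE_zero_of_square_integral_zero[OF \<theta>] by simp
  show "AE x in lebesgue_on \<Omega>. w x = 0" using t k by eventually_elim simp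
qed

lemma integral_k_inner:
  assumes "AE x in lebesgue_on \<Omega>. k x *v \<theta> x = - u x"
    and "square_integrable (lebesgue_on \<Omega>) u" "square_integrable (lebesgue_on \<Omega>) \<xi>"
  shows "(LINT x|lebesgue_on \<Omega>. (k x *v \<theta> x) \<bullet> \<xi> x) = - (LINT x|lebesgue_on \<Omega>. u x \<bullet> \<xi> x)"
proof -
  have "integrable (lebesgue_on \<Omega>) (\<lambda>x. - (u x \<bullet> \<xi> x))"
    using square_integrable_inner[OF assms(2,3)] by simp
  moreover have "AE x in lebesgue_on \<Omega>. - (u x \<bullet> \<xi> x) = (k x *v \<theta> x) \<bullet> \<xi> x"
    using assms(1) by eventually_elim simp
  ultimately have "(LINT x|lebesgue_on \<Omega>. (k x *v \<theta> x) \<bullet> \<xi> x) = (LINT x|lebesgue_on \<Omega>. - (u x \<bullet> \<xi> x))"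
    by (rule integral_lebesgue_on_AE(2)[OF sets_dom])
  then show ?thesis by simp
qed

text \<open>The first equation holds in the strong form, because \<open>k \<theta> + u\<close> is \<open>k\<close> applied to an element of the
  first space: subtract from \<open>\<theta>\<close> the combination of the \<open>\<eta>\<close> with the coefficients of \<open>u\<close>, and test with the
  difference.\<close>

lemma constitutive_iff:
  assumes \<theta>: "has_coeffs \<eta> \<theta> A" and u: "has_coeffs \<psi> u B"
  shows "(\<forall>\<xi>\<in>broken_space \<Omega> \<T> N \<eta>.
      (LINT x|lebesgue_on \<Omega>. (k x *v \<theta> x) \<bullet> \<xi> x) + (LINT x|lebesgue_on \<Omega>. u x \<bullet> \<xi> x) = 0)
    \<longleftrightarrow> (AE x in lebesgue_on \<Omega>. k x *v \<theta> x = - u x)"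
proof
  assume "AE x in lebesgue_on \<Omega>. k x *v \<theta> x = - u x"
  then show "\<forall>\<xi>\<in>broken_space \<Omega> \<T> N \<eta>.
      (LINT x|lebesgue_on \<Omega>. (k x *v \<theta> x) \<bullet> \<xi> x) + (LINT x|lebesgue_on \<Omega>. u x \<bullet> \<xi> x) = 0"
    using integral_k_inner coeffs_square_integrable(1)[OF u] by (auto simp: broken_space_def)
next
  assume eq: "\<forall>\<xi>\<in>broken_space \<Omega> \<T> N \<eta>.
      (LINT x|lebesgue_on \<Omega>. (k x *v \<theta> x) \<bullet> \<xi> x) + (LINT x|lebesgue_on \<Omega>. u x \<bullet> \<xi> x) = 0"
  let ?v = "glue (local_comb \<psi> A)" and ?\<zeta> = "glue (local_comb \<eta> B)"
  let ?\<delta> = "\<lambda>x. \<theta> x + (-1) *\<^sub>R ?\<zeta> x" and ?w = "\<lambda>x. ?v x + (-1) *\<^sub>R u x"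
  have k1: "AE x in lebesgue_on \<Omega>. k x *v \<theta> x = - ?v x" by (rule k_coeffs_eta[OF \<theta> psi_coeffs])
  have k2: "AE x in lebesgue_on \<Omega>. k x *v ?\<zeta> x = - u x" by (rule k_coeffs_eta[OF eta_coeffs u])
  have \<delta>: "has_coeffs \<eta> ?\<delta> (\<lambda>K i e. A K i e + (-1) * B K i e)" by (rule coeffs_linear[OF \<theta> eta_coeffs])
  have w: "has_coeffs \<psi> ?w (\<lambda>K i e. A K i e + (-1) * B K i e)" by (rule coeffs_linear[OF psi_coeffs u])
  have k3: "AE x in lebesgue_on \<Omega>. k x *v ?\<delta> x = - ?w x" by (rule k_coeffs_eta[OF \<delta> w])
  note sq = coeffs_square_integrable(1)[OF psi_coeffs[of A]] coeffs_square_integrable(1)[OF u] coeffs_square_integrable(1)[OF \<delta>] coeffs_square_integrable(1)[OF w]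
  have "- (LINT x|lebesgue_on \<Omega>. ?v x \<bullet> ?\<delta> x) + (LINT x|lebesgue_on \<Omega>. u x \<bullet> ?\<delta> x) = 0"
    using bspec[OF eq coeffs_in[OF \<delta>]] unfolding integral_k_inner[OF k1 sq(1,3)] .
  moreover have "(LINT x|lebesgue_on \<Omega>. ?\<delta> x \<bullet> ?w x)
      = (LINT x|lebesgue_on \<Omega>. ?v x \<bullet> ?\<delta> x - u x \<bullet> ?\<delta> x)"
    by (rule Bochner_Integration.integral_cong) (simp_all add: inner_diff_left inner_diff_right inner_commute)
  ultimately have "(LINT x|lebesgue_on \<Omega>. ?\<delta> x \<bullet> ?w x) = 0"
    using square_integrable_inner[OF sq(1,3)] square_integrable_inner[OF sq(2,3)]
    by (simp add: Bochner_Integration.integral_diff)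
  then have "AE x in lebesgue_on \<Omega>. ?w x = 0" by (rule zero_of_energy_zero(2)[OF sq(3,4) k3])
  with k1 show "AE x in lebesgue_on \<Omega>. k x *v \<theta> x = - u x" by eventually_elim simp
qed

lemma flux_potential_unique:
  assumes \<theta>: "has_coeffs \<eta> \<theta> A" "has_coeffs \<eta> \<theta>' A'" and u: "has_coeffs \<psi> u C" "has_coeffs \<psi> u' C'"
    and k: "AE x in lebesgue_on \<Omega>. k x *v \<theta> x = - u x" "AE x in lebesgue_on \<Omega>. k x *v \<theta>' x = - u' x"
    and z: "(LINT x|lebesgue_on \<Omega>. \<theta> x \<bullet> (u x + (-1) *\<^sub>R u' x)) = (LINT x|lebesgue_on \<Omega>. \<theta>' x \<bullet> (u x + (-1) *\<^sub>R u' x))"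
  shows "AE x in lebesgue_on \<Omega>. \<theta> x = \<theta>' x" "AE x in lebesgue_on \<Omega>. u x = u' x"
proof -
  let ?\<delta> = "\<lambda>x. \<theta> x + (-1) *\<^sub>R \<theta>' x" and ?w = "\<lambda>x. u x + (-1) *\<^sub>R u' x"
  have sq: "square_integrable (lebesgue_on \<Omega>) ?\<delta>" "square_integrable (lebesgue_on \<Omega>) ?w"
    using coeffs_square_integrable(1)[OF coeffs_linear[OF \<theta>]] coeffs_square_integrable(1)[OF coeffs_linear[OF u]] by blast+
  have kd: "AE x in lebesgue_on \<Omega>. k x *v ?\<delta> x = - ?w x"
    using k by eventually_elim (simp add: matrix_vector_mult_diff_distrib)
  have "(LINT x|lebesgue_on \<Omega>. ?\<delta> x \<bullet> ?w x) = (LINT x|lebesgue_on \<Omega>. \<theta> x \<bullet> ?w x - \<theta>' x \<bullet> ?w x)"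
    by (rule Bochner_Integration.integral_cong) (simp_all add: inner_diff_left)
  also have "\<dots> = 0"
    using square_integrable_inner[OF coeffs_square_integrable(1)[OF \<theta>(1)] sq(2)]
      square_integrable_inner[OF coeffs_square_integrable(1)[OF \<theta>(2)] sq(2)] z
    by (subst Bochner_Integration.integral_diff) auto
  finally have z': "(LINT x|lebesgue_on \<Omega>. ?\<delta> x \<bullet> ?w x) = 0" .
  show "AE x in lebesgue_on \<Omega>. \<theta> x = \<theta>' x" using zero_of_energy_zero(1)[OF sq kd z'] by eventually_elim simp
  show "AE x in lebesgue_on \<Omega>. u x = u' x" using zero_of_energy_zero(2)[OF sq kd z'] by eventually_elim simp
qed

text \<open>The coefficients of the single local field with index \<open>i0\<close> and face \<open>e0\<close> on the cell \<open>K0\<close>.\<close>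

definition unit_coeff where
  "unit_coeff K0 i0 e0 = (\<lambda>K i e. if K = K0 \<and> i = i0 \<and> e = e0 then 1 else (0::real))"

lemma unit_coeff_sum:
  fixes W :: "(real^'n) set \<Rightarrow> nat \<Rightarrow> (real^'n) set \<Rightarrow> real"
  assumes "K0 \<in> \<T>" "i0 \<in> {1..N}" "e0 \<in> facets K0"
  shows "(\<Sum>i=1..N. \<Sum>e\<in>facets K. unit_coeff K0 i0 e0 K i e * W K i e) = (if K = K0 then W K0 i0 e0 else 0)"
    and "(\<Sum>K\<in>\<T>. \<Sum>e\<in>facets K. \<Sum>i=1..N. unit_coeff K0 i0 e0 K i e * W K i e) = W K0 i0 e0"
proof -
  have f: "finite (facets K0)" using cell.finite_facets[OF cell_of_mesh[OF assms(1)]] .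
  show 1: "(\<Sum>i=1..N. \<Sum>e\<in>facets K. unit_coeff K0 i0 e0 K i e * W K i e) = (if K = K0 then W K0 i0 e0 else 0)" for K
  proof (cases "K = K0")
    case True
    have "(\<Sum>i=1..N. \<Sum>e\<in>facets K. unit_coeff K0 i0 e0 K i e * W K i e)
       = (\<Sum>i=1..N. if i = i0 then (\<Sum>e\<in>facets K0. if e = e0 then W K0 i0 e0 else 0) else 0)"
      unfolding True by (rule sum.cong[OF refl]) (auto simp: unit_coeff_def intro!: sum.cong sum.neutral)
    also have "\<dots> = W K0 i0 e0" using assms f by simp
    finally show ?thesis using True by simp
  qed (simp add: unit_coeff_def)
  have "(\<Sum>K\<in>\<T>. \<Sum>e\<in>facets K. \<Sum>i=1..N. unit_coeff K0 i0 e0 K i e * W K i e)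
      = (\<Sum>K\<in>\<T>. \<Sum>i=1..N. \<Sum>e\<in>facets K. unit_coeff K0 i0 e0 K i e * W K i e)"
    by (rule sum.cong[OF refl]) (rule sum.swap)
  also have "\<dots> = W K0 i0 e0" unfolding 1 using assms(1) finite_cells by simp
  finally show "(\<Sum>K\<in>\<T>. \<Sum>e\<in>facets K. \<Sum>i=1..N. unit_coeff K0 i0 e0 K i e * W K i e) = W K0 i0 e0" .
qed

lemma total_flux_unit_coeff:
  assumes "K0 \<in> \<T>" "i0 \<in> {1..N}" "e0 \<in> facets K0"
  shows "total_flux (unit_coeff K0 i0 e0) K = (if K = K0 then 1 else 0)"
  using unit_coeff_sum(1)[OF assms, of K "\<lambda>_ _ _. 1"] by (simp add: total_flux_def)

lemma cell_values_eq:
  fixes P P' :: "(real^'n) set \<Rightarrow> real"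
  assumes m: "\<And>K e. K \<in> \<T> \<Longrightarrow> e \<in> facets K \<Longrightarrow> P K - P' K = M e"
    and b: "\<And>e. e \<in> boundary_faces \<Omega> \<T> \<Longrightarrow> M e = 0" and K: "K \<in> \<T>"
  shows "P K = P' K"
proof -
  have "P K - P' K = 0"
  proof (rule cell_values_zero[where P = "\<lambda>K. P K - P' K", OF _ _ K])
    fix e K K' assume "K \<in> adjacent_cells e" "K' \<in> adjacent_cells e"
    then show "P K - P' K = P K' - P' K'" using m[of K e] m[of K' e] by (simp add: adjacent_cells_def)
  next
    fix e K assume "e \<in> boundary_faces \<Omega> \<T>" "K \<in> adjacent_cells e"
    then show "P K - P' K = 0" using m[of K e] b by (simp add: adjacent_cells_def)
  qed
  then show ?thesis by simp
qed

lemma flux_moment_linear: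
  assumes "i \<in> {1..N}" "e \<in> mesh_faces \<T>" "square_integrable (surface_measure e) q" "square_integrable (surface_measure e) q'"
  shows "flux_moment i e (\<lambda>x. q x + c * q' x) = flux_moment i e q + c * flux_moment i e q'"
proof -
  have "flux_moment i e (\<lambda>x. q x + c * q' x) = (LINT x|surface_measure e. flux i e x * q x + c * (flux i e x * q' x))"
    unfolding flux_moment_def by (rule Bochner_Integration.integral_cong) (simp_all add: algebra_simps)
  also have "\<dots> = flux_moment i e q + c * flux_moment i e q'"
    unfolding flux_moment_def
    using square_integrable_mult[OF flux_square_integrable[OF assms(1,2)] assms(3)]
      square_integrable_mult[OF flux_square_integrable[OF assms(1,2)] assms(4)]
    by (subst Bochner_Integration.integral_add) auto
  finally show ?thesis .
qed

lemma flux_moment_AE_zero: "AE x in surface_measure e. q x = 0 \<Longrightarrow> flux_moment i e q = 0"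
  unfolding flux_moment_def by (rule integral_eq_zero_AE) (auto elim: eventually_mono)

lemma flux_moment_cong:
  assumes "i \<in> {1..N}" "e \<in> mesh_faces \<T>" "square_integrable (surface_measure e) q"
    "square_integrable (surface_measure e) q'" "AE x in surface_measure e. q x = q' x"
  shows "flux_moment i e q = flux_moment i e q'"
  unfolding flux_moment_def
  by (rule integral_cong_AE)
     (use square_integrable_mult[OF flux_square_integrable[OF assms(1,2)] assms(3)]
        square_integrable_mult[OF flux_square_integrable[OF assms(1,2)] assms(4)] assms(5)
      in \<open>auto elim: eventually_mono\<close>)

lemma PihD:
  assumes "\<pi> \<in> Pih \<Omega> \<T> N \<psi>"
  shows "e \<in> mesh_faces \<T> \<Longrightarrow> square_integrable (surface_measure e) (\<pi> e)"
    "e \<in> interior_faces \<Omega> \<T> \<Longrightarrow> \<exists>d. AE x in surface_measure e. \<pi> e x = (\<Sum>i=1..N. d i * flux i e x)"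
    "e \<in> boundary_faces \<Omega> \<T> \<Longrightarrow> AE x in surface_measure e. \<pi> e x = 0"
  using assms by (auto simp: Pih_iff)

lemma Pih_linear:
  assumes "\<pi> \<in> Pih \<Omega> \<T> N \<psi>" "\<pi>' \<in> Pih \<Omega> \<T> N \<psi>"
  shows "(\<lambda>e x. \<pi> e x + c * \<pi>' e x) \<in> Pih \<Omega> \<T> N \<psi>"
  unfolding Pih_iff
proof (intro conjI ballI)
  fix e
  show "square_integrable (surface_measure e) (\<lambda>x. \<pi> e x + c * \<pi>' e x)" if "e \<in> mesh_faces \<T>"
    using PihD(1)[OF assms(1) that] PihD(1)[OF assms(2) that]
    by (intro square_integrable_add square_integrable_cmult)
  show "AE x in surface_measure e. \<pi> e x + c * \<pi>' e x = 0" if "e \<in> boundary_faces \<Omega> \<T>"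
    using PihD(3)[OF assms(1) that] PihD(3)[OF assms(2) that] by eventually_elim simp
  assume e: "e \<in> interior_faces \<Omega> \<T>"
  obtain d d' where "AE x in surface_measure e. \<pi> e x = (\<Sum>i=1..N. d i * flux i e x)"
    "AE x in surface_measure e. \<pi>' e x = (\<Sum>i=1..N. d' i * flux i e x)"
    using PihD(2)[OF assms(1) e] PihD(2)[OF assms(2) e] by auto
  then have "AE x in surface_measure e. \<pi> e x + c * \<pi>' e x = (\<Sum>i=1..N. (d i + c * d' i) * flux i e x)"
    by eventually_elim (simp add: sum.distrib sum_distrib_left algebra_simps)
  then show "\<exists>d. AE x in surface_measure e. \<pi> e x + c * \<pi>' e x = (\<Sum>i=1..N. d i * flux i e x)"
    by (rule exI[of _ "\<lambda>i. d i + c * d' i"])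
qed

lemma Pih_zero: "(\<lambda>e x. 0) \<in> Pih \<Omega> \<T> N \<psi>"
  unfolding Pih_iff by (auto intro!: exI[of _ "\<lambda>_. 0"])

lemma Pih_face:
  assumes e: "e \<in> interior_faces \<Omega> \<T>"
  shows "(\<lambda>e' x. if e' = e then \<Sum>i=1..N. d i * flux i e x else 0) \<in> Pih \<Omega> \<T> N \<psi>"
proof -
  have em: "e \<in> mesh_faces \<T>" and "e \<notin> boundary_faces \<Omega> \<T>"
    using e by (auto simp: interior_faces_def boundary_faces_def)
  show ?thesis
    unfolding Pih_iff
  proof (intro conjI ballI)
    fix e'
    show "square_integrable (surface_measure e') (\<lambda>x. if e' = e then \<Sum>i=1..N. d i * flux i e x else 0)"
      if "e' \<in> mesh_faces \<T>"
      by (cases "e' = e") (auto intro!: square_integrable_sum square_integrable_cmult flux_square_integrable em)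
    show "AE x in surface_measure e'. (if e' = e then \<Sum>i=1..N. d i * flux i e x else 0) = 0"
      if "e' \<in> boundary_faces \<Omega> \<T>"
      using that \<open>e \<notin> boundary_faces \<Omega> \<T>\<close> by auto
    show "\<exists>d'. AE x in surface_measure e'. (if e' = e then \<Sum>i=1..N. d i * flux i e x else 0)
        = (\<Sum>i=1..N. d' i * flux i e' x)" if "e' \<in> interior_faces \<Omega> \<T>"
      by (rule exI[of _ "\<lambda>i. if e' = e then d i else 0"]) simp
  qed
qed

lemma mesh_faces_cases:
  "e \<in> mesh_faces \<T> \<Longrightarrow> e \<in> interior_faces \<Omega> \<T> \<or> e \<in> boundary_faces \<Omega> \<T>"
  by (auto simp: interior_faces_def boundary_faces_def)

text \<open>A multiplier is determined by its moments.\<close>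

lemma Pih_moments_zero:
  assumes \<pi>: "\<pi> \<in> Pih \<Omega> \<T> N \<psi>" and e: "e \<in> mesh_faces \<T>" and z: "\<And>i. i \<in> {1..N} \<Longrightarrow> flux_moment i e (\<pi> e) = 0"
  shows "AE x in surface_measure e. \<pi> e x = 0"
  using mesh_faces_cases[OF e]
proof
  assume i: "e \<in> interior_faces \<Omega> \<T>"
  obtain d where d: "AE x in surface_measure e. \<pi> e x = (\<Sum>i=1..N. d i * flux i e x)"
    using PihD(2)[OF \<pi> i] by blast
  note sq = PihD(1)[OF \<pi> e]
  have "(LINT x|surface_measure e. \<pi> e x * \<pi> e x) = (\<Sum>i=1..N. d i * flux_moment i e (\<pi> e))"
    by (rule integral_flux_comb[OF e sq d]) (use sq in \<open>simp add: square_integrable_def\<close>)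
  also have "\<dots> = 0" using z by simp
  finally show ?thesis using AE_zero_of_square_integral_zero[OF sq] by simp
qed (rule PihD(3)[OF \<pi>])

text \<open>The interface term depends on the jumps of \<open>\<tau>\<close> only through their moments.\<close>

lemma Ch_eq_zero:
  assumes \<tau>: "has_coeffs \<psi> \<tau> C" and \<pi>: "\<pi> \<in> Pih \<Omega> \<T> N \<psi>"
    and z: "\<And>e i. e \<in> interior_faces \<Omega> \<T> \<Longrightarrow> i \<in> {1..N} \<Longrightarrow> flux_moment i e (jump \<tau> e) = 0"
  shows "Ch \<T> \<tau> \<pi> = 0"
proof -
  have "Ch \<T> \<tau> \<pi> = (\<Sum>e\<in>mesh_faces \<T>. LINT x|surface_measure e. jump \<tau> e x * \<pi> e x)"
    by (rule Ch_jump[OF \<tau> PihD(1)[OF \<pi>]])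
  also have "\<dots> = 0"
  proof (rule sum.neutral, rule ballI)
    fix e assume e: "e \<in> mesh_faces \<T>"
    show "(LINT x|surface_measure e. jump \<tau> e x * \<pi> e x) = 0"
      using mesh_faces_cases[OF e]
    proof
      assume "e \<in> boundary_faces \<Omega> \<T>"
      then have "AE x in surface_measure e. \<pi> e x = 0" by (rule PihD(3)[OF \<pi>])
      then have "AE x in surface_measure e. jump \<tau> e x * \<pi> e x = 0" by eventually_elim simp
      then show ?thesis by (rule integral_eq_zero_AE)
    next
      assume i: "e \<in> interior_faces \<Omega> \<T>"
      obtain d where d: "AE x in surface_measure e. \<pi> e x = (\<Sum>i=1..N. d i * flux i e x)"
        using PihD(2)[OF \<pi> i] by blast
      have "(LINT x|surface_measure e. \<pi> e x * jump \<tau> e x) = (\<Sum>i=1..N. d i * flux_moment i e (jump \<tau> e))"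
        by (rule integral_flux_comb[OF e jump_square_integrable[OF coeffs_traces[OF \<tau>]] d])
           (use PihD(1)[OF \<pi> e] in \<open>simp add: square_integrable_def\<close>)
      then show ?thesis using z[OF i] by (simp add: mult.commute)
    qed
  qed
  finally show ?thesis .
qed

lemma Ch_X2:
  assumes \<tau>: "has_coeffs \<psi> \<tau> C" and H: "\<tau> \<in> Hdiv \<Omega>" and \<pi>: "\<pi> \<in> Pih \<Omega> \<T> N \<psi>"
  shows "Ch \<T> \<tau> \<pi> = 0"
  by (rule Ch_eq_zero[OF \<tau> \<pi>]) (rule flux_moment_AE_zero[OF Hdiv_jump(2)[OF coeffs_traces[OF \<tau>] H]])

text \<open>The jump of \<open>u\<close> on an interior face, extended by zero, is itself a multiplier, and testing with it
  shows that it vanishes.\<close>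

lemma Hdiv_of_Ch:
  assumes u: "has_coeffs \<psi> u C" and z: "\<And>\<pi>. \<pi> \<in> Pih \<Omega> \<T> N \<psi> \<Longrightarrow> Ch \<T> u \<pi> = 0"
  shows "u \<in> X2 \<Omega> \<T> N \<psi>"
proof -
  have "u \<in> Hdiv \<Omega>"
  proof (rule Hdiv_of_jump[OF coeffs_traces[OF u]])
    fix e assume e: "e \<in> interior_faces \<Omega> \<T>"
    have em: "e \<in> mesh_faces \<T>" using e by (simp add: interior_faces_def)
    let ?d = "\<lambda>i. \<Sum>K\<in>adjacent_cells e. C K i e"
    let ?\<pi> = "\<lambda>e' x. if e' = e then \<Sum>i=1..N. ?d i * flux i e x else 0"
    note \<pi> = Pih_face[OF e, of ?d]
    note sj = jump_square_integrable[OF coeffs_traces[OF u], of e]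
    have "0 = (\<Sum>e'\<in>mesh_faces \<T>. LINT x|surface_measure e'. jump u e' x * ?\<pi> e' x)"
      using Ch_jump[OF u PihD(1)[OF \<pi>]] z[OF \<pi>] by simp
    also have "\<dots> = (\<Sum>e'\<in>mesh_faces \<T>. if e' = e then LINT x|surface_measure e. jump u e x * (\<Sum>i=1..N. ?d i * flux i e x) else 0)"
      by (rule sum.cong) auto
    also have "\<dots> = (LINT x|surface_measure e. jump u e x * (\<Sum>i=1..N. ?d i * flux i e x))"
      using em finite_mesh_faces by simp
    also have "\<dots> = (LINT x|surface_measure e. jump u e x \<bullet> jump u e x)"
    proof (rule integral_cong_AE)
      have s: "square_integrable (surface_measure e) (\<lambda>x. \<Sum>i=1..N. ?d i * flux i e x)"
        by (intro square_integrable_sum square_integrable_cmult flux_square_integrable em)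
      show "(\<lambda>x. jump u e x * (\<Sum>i=1..N. ?d i * flux i e x)) \<in> borel_measurable (surface_measure e)"
        using square_integrable_mult[OF sj s] by (rule borel_measurable_integrable)
      show "(\<lambda>x. jump u e x \<bullet> jump u e x) \<in> borel_measurable (surface_measure e)"
        using square_integrable_inner[OF sj sj] by (rule borel_measurable_integrable)
      show "AE x in surface_measure e. jump u e x * (\<Sum>i=1..N. ?d i * flux i e x) = jump u e x \<bullet> jump u e x"
        using coeffs_jump[OF u, of e] by eventually_elim simp
    qed
    finally show "AE x in surface_measure e. jump u e x = 0"
      using AE_zero_of_square_integral_zero[OF sj] by simp
  qed
  then show ?thesis using coeffs_in[OF u] by (simp add: X2_def)
qed

lemma f_moment:
  fixes Q :: "(real^'n) set \<Rightarrow> real"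
  assumes f: "square_integrable (lebesgue_on \<Omega>) f" and q: "\<forall>K\<in>\<T>. AE x in lebesgue_on K. q x = Q K"
  shows "(LINT x|lebesgue_on \<Omega>. f x * q x) = (\<Sum>K\<in>\<T>. Q K * (LINT x|lebesgue_on K. f x))"
proof -
  let ?g = "glue (\<lambda>K _. Q K) :: real^'n \<Rightarrow> real"
  have g: "square_integrable (lebesgue_on \<Omega>) ?g"
    by (rule glue_square_integrable) (auto intro: square_integrable_bounded[OF cell.finite_measure_cell[OF cell_of_mesh]])
  have "AE x in lebesgue_on \<Omega>. f x * ?g x = f x * q x"
    unfolding AE_dom_iff
  proof
    fix K assume K: "K \<in> \<T>"
    have "AE x in lebesgue_on K. q x = Q K" using q K by blast
    with glue_AE[OF K, of "\<lambda>K _. Q K"] show "AE x in lebesgue_on K. f x * ?g x = f x * q x"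
      by eventually_elim simp
  qed
  then have i: "integrable (lebesgue_on \<Omega>) (\<lambda>x. f x * q x)"
    by (rule integral_lebesgue_on_AE(1)[OF sets_dom square_integrable_mult[OF f g]])
  have "(LINT x|lebesgue_on K. f x * q x) = Q K * (LINT x|lebesgue_on K. f x)" if K: "K \<in> \<T>" for K
  proof -
    have "AE x in lebesgue_on K. q x = Q K" using q K by blast
    then have "AE x in lebesgue_on K. f x * q x = Q K * f x" by eventually_elim simp
    from integral_lebesgue_on_AE(2)[OF sets_mesh_cell[OF K] integrable_dom_cell[OF i K] this]
    show ?thesis by simp
  qed
  then show ?thesis unfolding integral_dom[OF i] by simp
qed

lemma cell_indicator_values:
  assumes "K0 \<in> \<T>"
  shows "\<forall>K\<in>\<T>. AE x in lebesgue_on K. glue (\<lambda>K _. if K = K0 then 1 else 0) x = (if K = K0 then 1 else (0::real))"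
  using glue_AE by blast

lemma balance_HG_iff:
  assumes f: "square_integrable (lebesgue_on \<Omega>) f" and u: "has_coeffs \<psi> u C"
  shows "(\<forall>q\<in>Qh \<T>. (\<Sum>K\<in>\<T>. LINT x|lebesgue_on K. wdiv K u x * q x) = (LINT x|lebesgue_on \<Omega>. f x * q x))
    \<longleftrightarrow> (\<forall>K\<in>\<T>. total_flux C K = (LINT x|lebesgue_on K. f x))"
proof -
  have *: "((\<Sum>K\<in>\<T>. LINT x|lebesgue_on K. wdiv K u x * q x) = (LINT x|lebesgue_on \<Omega>. f x * q x)) \<longleftrightarrow>
     (\<Sum>K\<in>\<T>. Q K * total_flux C K) = (\<Sum>K\<in>\<T>. Q K * (LINT x|lebesgue_on K. f x))"
    if q: "\<forall>K\<in>\<T>. AE x in lebesgue_on K. q x = Q K" for q Q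
  proof -
    have "(\<Sum>K\<in>\<T>. LINT x|lebesgue_on K. wdiv K u x * q x) = (\<Sum>K\<in>\<T>. Q K * total_flux C K)"
      by (rule sum.cong[OF refl]) (use div_moment[OF u] q in \<open>simp add: mult.commute\<close>)
    then show ?thesis using f_moment[OF f q] by simp
  qed
  show ?thesis
  proof
    assume L: "\<forall>q\<in>Qh \<T>. (\<Sum>K\<in>\<T>. LINT x|lebesgue_on K. wdiv K u x * q x) = (LINT x|lebesgue_on \<Omega>. f x * q x)"
    show "\<forall>K\<in>\<T>. total_flux C K = (LINT x|lebesgue_on K. f x)"
    proof
      fix K0 assume K0: "K0 \<in> \<T>"
      note v = cell_indicator_values[OF K0]
      have delta: "(\<Sum>K\<in>\<T>. (if K = K0 then 1 else 0) * h K) = h K0" for h :: "(real^'n) set \<Rightarrow> real"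
      proof -
        have "(\<Sum>K\<in>\<T>. (if K = K0 then 1 else 0) * h K) = (\<Sum>K\<in>\<T>. if K = K0 then h K0 else 0)"
          by (rule sum.cong) auto
        then show ?thesis using finite_cells K0 by simp
      qed
      let ?q = "glue (\<lambda>K _. if K = K0 then 1 else 0) :: real^'n \<Rightarrow> real"
      have "?q \<in> Qh \<T>" unfolding Qh_iff by (rule exI) (rule v)
      from bspec[OF L this] have "(\<Sum>K\<in>\<T>. (if K = K0 then 1 else 0) * total_flux C K) = (\<Sum>K\<in>\<T>. (if K = K0 then 1 else 0) * (LINT x|lebesgue_on K. f x))"
        unfolding *[OF v] .
      then show "total_flux C K0 = (LINT x|lebesgue_on K0. f x)"
        unfolding delta .
    qed
  next
    assume "\<forall>K\<in>\<T>. total_flux C K = (LINT x|lebesgue_on K. f x)"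
    then show "\<forall>q\<in>Qh \<T>. (\<Sum>K\<in>\<T>. LINT x|lebesgue_on K. wdiv K u x * q x) = (LINT x|lebesgue_on \<Omega>. f x * q x)"
      using * by (auto simp: Qh_iff)
  qed
qed

lemma balance_G_iff:
  assumes f: "square_integrable (lebesgue_on \<Omega>) f" and u: "has_coeffs \<psi> u C" and H: "u \<in> Hdiv \<Omega>"
  shows "(\<forall>q\<in>Qh \<T>. (LINT x|lebesgue_on \<Omega>. wdiv \<Omega> u x * q x) = (LINT x|lebesgue_on \<Omega>. f x * q x))
    \<longleftrightarrow> (\<forall>K\<in>\<T>. total_flux C K = (LINT x|lebesgue_on K. f x))"
proof -
  have "(LINT x|lebesgue_on \<Omega>. wdiv \<Omega> u x * q x) = (\<Sum>K\<in>\<T>. LINT x|lebesgue_on K. wdiv K u x * q x)"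
    if q: "q \<in> Qh \<T>" for q
  proof -
    obtain Q where Q: "\<forall>K\<in>\<T>. AE x in lebesgue_on K. q x = Q K" using q by (auto simp: Qh_iff)
    have "(\<Sum>K\<in>\<T>. LINT x|lebesgue_on K. wdiv K u x * q x) = (\<Sum>K\<in>\<T>. Q K * total_flux C K)"
      by (rule sum.cong[OF refl]) (use div_moment[OF u] Q in \<open>simp add: mult.commute\<close>)
    then show ?thesis using div_dom_moment[OF u H Q] by (simp add: mult.commute)
  qed
  then show ?thesis using balance_HG_iff[OF f u] by simp
qed

lemma pressure_HG:
  assumes \<tau>: "has_coeffs \<psi> \<tau> D" and p: "\<forall>K\<in>\<T>. AE x in lebesgue_on K. p x = P K"
  shows "(\<Sum>K\<in>\<T>. LINT x|lebesgue_on K. p x * wdiv K \<tau> x) = (\<Sum>K\<in>\<T>. P K * total_flux D K)"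
  by (rule sum.cong[OF refl]) (use div_moment[OF \<tau>] p in simp)

lemma inner_comb:
  assumes \<theta>: "has_coeffs \<eta> \<theta> C" and \<tau>: "square_integrable (lebesgue_on \<Omega>) \<tau>"
  shows "(LINT x|lebesgue_on \<Omega>. \<theta> x \<bullet> \<tau> x)
    = (\<Sum>K\<in>\<T>. \<Sum>i=1..N. \<Sum>e\<in>facets K. C K i e * (LINT x|lebesgue_on K. \<eta> i K e x \<bullet> \<tau> x))"
  unfolding integral_dom[OF square_integrable_inner[OF coeffs_square_integrable(1)[OF \<theta>] \<tau>]]
proof (rule sum.cong[OF refl])
  fix K assume K: "K \<in> \<T>"
  note \<tau>K = square_integrable_dom_cell[OF \<tau> K]
  have i: "integrable (lebesgue_on K) (\<lambda>x. C K i e * (\<eta> i K e x \<bullet> \<tau> x))" if "i \<in> {1..N}" "e \<in> facets K" for i e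
    using square_integrable_inner[OF eta_square_integrable[OF that(1) K that(2)] \<tau>K] by simp
  have "integrable (lebesgue_on K) (\<lambda>x. \<theta> x \<bullet> \<tau> x)"
    by (rule square_integrable_inner[OF coeffs_square_integrable(2)[OF \<theta> K] \<tau>K])
  moreover have "AE x in lebesgue_on K. \<theta> x \<bullet> \<tau> x = (\<Sum>i=1..N. \<Sum>e\<in>facets K. C K i e * (\<eta> i K e x \<bullet> \<tau> x))"
  proof -
    have "AE x in lebesgue_on K. \<theta> x = local_comb \<eta> C K x" using \<theta> K by (simp add: has_coeffs_def)
    then show ?thesis by eventually_elim (simp add: local_comb_def inner_sum_left)
  qed
  ultimately have "(LINT x|lebesgue_on K. \<theta> x \<bullet> \<tau> x)
      = (LINT x|lebesgue_on K. (\<Sum>i=1..N. \<Sum>e\<in>facets K. C K i e * (\<eta> i K e x \<bullet> \<tau> x)))"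
    by (rule integral_lebesgue_on_AE(2)[OF sets_mesh_cell[OF K], symmetric])
  also have "\<dots> = (\<Sum>i=1..N. LINT x|lebesgue_on K. (\<Sum>e\<in>facets K. C K i e * (\<eta> i K e x \<bullet> \<tau> x)))"
    by (rule Bochner_Integration.integral_sum) (use i in \<open>auto intro!: Bochner_Integration.integrable_sum\<close>)
  also have "\<dots> = (\<Sum>i=1..N. \<Sum>e\<in>facets K. LINT x|lebesgue_on K. C K i e * (\<eta> i K e x \<bullet> \<tau> x))"
    by (rule sum.cong[OF refl], rule Bochner_Integration.integral_sum) (rule i)
  finally show "(LINT x|lebesgue_on K. \<theta> x \<bullet> \<tau> x)
    = (\<Sum>i=1..N. \<Sum>e\<in>facets K. C K i e * (LINT x|lebesgue_on K. \<eta> i K e x \<bullet> \<tau> x))" by simp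
qed

section \<open>Existence, uniqueness and equivalence\<close>

text \<open>The hybrid problem in terms of coefficients \<open>A\<close> of \<open>\<theta>\<close> and \<open>C\<close> of \<open>u\<close>, and of the cell values \<open>P\<close> of \<open>p\<close>.\<close>

lemma solves_HG_iff:
  assumes f: "square_integrable (lebesgue_on \<Omega>) f"
  shows "solves_HG \<Omega> k f \<T> N \<eta> \<psi> \<theta> u p lam \<longleftrightarrow>
    (\<exists>A C P. has_coeffs \<eta> \<theta> A \<and> has_coeffs \<psi> u C \<and> (\<forall>K\<in>\<T>. AE x in lebesgue_on K. p x = P K) \<and> lam \<in> Pih \<Omega> \<T> N \<psi> \<and>
       (AE x in lebesgue_on \<Omega>. k x *v \<theta> x = - u x) \<and>
       (\<forall>\<tau> D. has_coeffs \<psi> \<tau> D \<longrightarrow> (LINT x|lebesgue_on \<Omega>. \<theta> x \<bullet> \<tau> x) + (\<Sum>K\<in>\<T>. P K * total_flux D K) = Ch \<T> \<tau> lam) \<and>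
       (\<forall>K\<in>\<T>. total_flux C K = (LINT x|lebesgue_on K. f x)) \<and>
       (\<forall>\<pi>\<in>Pih \<Omega> \<T> N \<psi>. Ch \<T> u \<pi> = 0))"
    (is "?L \<longleftrightarrow> (\<exists>A C P. ?R A C P)")
proof
  assume L: ?L
  obtain A where A: "has_coeffs \<eta> \<theta> A" using L by (auto simp: solves_HG_def broken_space_iff)
  obtain C where C: "has_coeffs \<psi> u C" using L by (auto simp: solves_HG_def broken_space_iff)
  obtain P where P: "\<forall>K\<in>\<T>. AE x in lebesgue_on K. p x = P K" using L by (auto simp: solves_HG_def Qh_iff)
  have "?R A C P"
  proof (intro conjI allI impI A C P)
    show "AE x in lebesgue_on \<Omega>. k x *v \<theta> x = - u x"
      using L unfolding constitutive_iff[OF A C, symmetric] by (simp add: solves_HG_def)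
    show "\<forall>K\<in>\<T>. total_flux C K = (LINT x|lebesgue_on K. f x)"
      using L unfolding balance_HG_iff[OF f C, symmetric] by (simp add: solves_HG_def)
    fix \<tau> D assume \<tau>: "has_coeffs \<psi> \<tau> D"
    have "(LINT x|lebesgue_on \<Omega>. \<theta> x \<bullet> \<tau> x) + (\<Sum>K\<in>\<T>. LINT x|lebesgue_on K. p x * wdiv K \<tau> x) = Ch \<T> \<tau> lam"
      using L coeffs_in[OF \<tau>] unfolding solves_HG_def by blast
    then show "(LINT x|lebesgue_on \<Omega>. \<theta> x \<bullet> \<tau> x) + (\<Sum>K\<in>\<T>. P K * total_flux D K) = Ch \<T> \<tau> lam"
      unfolding pressure_HG[OF \<tau> P] .
  qed (use L in \<open>simp_all add: solves_HG_def\<close>)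
  then show "\<exists>A C P. ?R A C P" by blast
next
  assume "\<exists>A C P. ?R A C P"
  then obtain A C P where A: "has_coeffs \<eta> \<theta> A" and C: "has_coeffs \<psi> u C" and P: "\<forall>K\<in>\<T>. AE x in lebesgue_on K. p x = P K"
    and lam: "lam \<in> Pih \<Omega> \<T> N \<psi>" and k: "AE x in lebesgue_on \<Omega>. k x *v \<theta> x = - u x"
    and m: "\<And>\<tau> D. has_coeffs \<psi> \<tau> D \<Longrightarrow> (LINT x|lebesgue_on \<Omega>. \<theta> x \<bullet> \<tau> x) + (\<Sum>K\<in>\<T>. P K * total_flux D K) = Ch \<T> \<tau> lam"
    and b: "\<forall>K\<in>\<T>. total_flux C K = (LINT x|lebesgue_on K. f x)" and c: "\<forall>\<pi>\<in>Pih \<Omega> \<T> N \<psi>. Ch \<T> u \<pi> = 0"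
    by blast
  show ?L
    unfolding solves_HG_def constitutive_iff[OF A C] balance_HG_iff[OF f C]
  proof (intro conjI coeffs_in[OF A] coeffs_in[OF C] lam k b c)
    show "p \<in> Qh \<T>" unfolding Qh_iff by (rule exI) (rule P)
    show "\<forall>\<tau>\<in>broken_space \<Omega> \<T> N \<psi>. (LINT x|lebesgue_on \<Omega>. \<theta> x \<bullet> \<tau> x)
        + (\<Sum>K\<in>\<T>. LINT x|lebesgue_on K. p x * wdiv K \<tau> x) = Ch \<T> \<tau> lam"
    proof
      fix \<tau> assume "\<tau> \<in> broken_space \<Omega> \<T> N \<psi>"
      then obtain D where \<tau>: "has_coeffs \<psi> \<tau> D" by (auto simp: broken_space_iff)
      show "(LINT x|lebesgue_on \<Omega>. \<theta> x \<bullet> \<tau> x)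
        + (\<Sum>K\<in>\<T>. LINT x|lebesgue_on K. p x * wdiv K \<tau> x) = Ch \<T> \<tau> lam"
        unfolding pressure_HG[OF \<tau> P] by (rule m[OF \<tau>])
    qed
  qed
qed

lemma solves_G_iff:
  assumes f: "square_integrable (lebesgue_on \<Omega>) f"
  shows "solves_G \<Omega> k f \<T> N \<eta> \<psi> \<theta> u p \<longleftrightarrow>
    (\<exists>A C P. has_coeffs \<eta> \<theta> A \<and> has_coeffs \<psi> u C \<and> u \<in> Hdiv \<Omega> \<and> (\<forall>K\<in>\<T>. AE x in lebesgue_on K. p x = P K) \<and>
       (AE x in lebesgue_on \<Omega>. k x *v \<theta> x = - u x) \<and>
       (\<forall>\<tau> D. has_coeffs \<psi> \<tau> D \<and> \<tau> \<in> Hdiv \<Omega> \<longrightarrow> (LINT x|lebesgue_on \<Omega>. \<theta> x \<bullet> \<tau> x) + (\<Sum>K\<in>\<T>. P K * total_flux D K) = 0) \<and>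
       (\<forall>K\<in>\<T>. total_flux C K = (LINT x|lebesgue_on K. f x)))"
    (is "?L \<longleftrightarrow> (\<exists>A C P. ?R A C P)")
proof
  assume L: ?L
  obtain A where A: "has_coeffs \<eta> \<theta> A" using L by (auto simp: solves_G_def broken_space_iff)
  obtain C where C: "has_coeffs \<psi> u C" using L by (auto simp: solves_G_def broken_space_iff X2_def)
  have H: "u \<in> Hdiv \<Omega>" using L by (simp add: solves_G_def X2_def)
  obtain P where P: "\<forall>K\<in>\<T>. AE x in lebesgue_on K. p x = P K" using L by (auto simp: solves_G_def Qh_iff)
  have "?R A C P"
  proof (intro conjI allI impI A C P H)
    show "AE x in lebesgue_on \<Omega>. k x *v \<theta> x = - u x"
      using L unfolding constitutive_iff[OF A C, symmetric] by (simp add: solves_G_def)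
    show "\<forall>K\<in>\<T>. total_flux C K = (LINT x|lebesgue_on K. f x)"
      using L unfolding balance_G_iff[OF f C H, symmetric] by (simp add: solves_G_def)
    fix \<tau> D assume \<tau>: "has_coeffs \<psi> \<tau> D \<and> \<tau> \<in> Hdiv \<Omega>"
    then have "\<tau> \<in> X2 \<Omega> \<T> N \<psi>" using coeffs_in[of \<psi> \<tau> D] by (simp add: X2_def)
    then have "(LINT x|lebesgue_on \<Omega>. \<theta> x \<bullet> \<tau> x) + (LINT x|lebesgue_on \<Omega>. p x * wdiv \<Omega> \<tau> x) = 0"
      using L unfolding solves_G_def by blast
    then show "(LINT x|lebesgue_on \<Omega>. \<theta> x \<bullet> \<tau> x) + (\<Sum>K\<in>\<T>. P K * total_flux D K) = 0"
      unfolding div_dom_moment[OF conjunct1[OF \<tau>] conjunct2[OF \<tau>] P] .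
  qed
  then show "\<exists>A C P. ?R A C P" by blast
next
  assume "\<exists>A C P. ?R A C P"
  then obtain A C P where A: "has_coeffs \<eta> \<theta> A" and C: "has_coeffs \<psi> u C" and H: "u \<in> Hdiv \<Omega>"
    and P: "\<forall>K\<in>\<T>. AE x in lebesgue_on K. p x = P K"
    and k: "AE x in lebesgue_on \<Omega>. k x *v \<theta> x = - u x"
    and m: "\<And>\<tau> D. has_coeffs \<psi> \<tau> D \<Longrightarrow> \<tau> \<in> Hdiv \<Omega> \<Longrightarrow> (LINT x|lebesgue_on \<Omega>. \<theta> x \<bullet> \<tau> x) + (\<Sum>K\<in>\<T>. P K * total_flux D K) = 0"
    and b: "\<forall>K\<in>\<T>. total_flux C K = (LINT x|lebesgue_on K. f x)"
    by blast
  show ?L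
    unfolding solves_G_def constitutive_iff[OF A C] balance_G_iff[OF f C H]
  proof (intro conjI coeffs_in[OF A] k b)
    show "u \<in> X2 \<Omega> \<T> N \<psi>" using coeffs_in[OF C] H by (simp add: X2_def)
    show "p \<in> Qh \<T>" unfolding Qh_iff by (rule exI) (rule P)
    show "\<forall>\<tau>\<in>X2 \<Omega> \<T> N \<psi>. (LINT x|lebesgue_on \<Omega>. \<theta> x \<bullet> \<tau> x) + (LINT x|lebesgue_on \<Omega>. p x * wdiv \<Omega> \<tau> x) = 0"
    proof
      fix \<tau> assume "\<tau> \<in> X2 \<Omega> \<T> N \<psi>"
      then obtain D where \<tau>: "has_coeffs \<psi> \<tau> D" "\<tau> \<in> Hdiv \<Omega>" by (auto simp: broken_space_iff X2_def)
      show "(LINT x|lebesgue_on \<Omega>. \<theta> x \<bullet> \<tau> x) + (LINT x|lebesgue_on \<Omega>. p x * wdiv \<Omega> \<tau> x) = 0"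
        unfolding div_dom_moment[OF \<tau> P] by (rule m[OF \<tau>])
    qed
  qed
qed

lemma HG_imp_G:
  assumes f: "square_integrable (lebesgue_on \<Omega>) f" and s: "solves_HG \<Omega> k f \<T> N \<eta> \<psi> \<theta> u p lam"
  shows "solves_G \<Omega> k f \<T> N \<eta> \<psi> \<theta> u p"
proof -
  obtain A C P where R: "has_coeffs \<eta> \<theta> A" "has_coeffs \<psi> u C" "\<forall>K\<in>\<T>. AE x in lebesgue_on K. p x = P K"
    "lam \<in> Pih \<Omega> \<T> N \<psi>" "AE x in lebesgue_on \<Omega>. k x *v \<theta> x = - u x"
    "\<And>\<tau> D. has_coeffs \<psi> \<tau> D \<Longrightarrow> (LINT x|lebesgue_on \<Omega>. \<theta> x \<bullet> \<tau> x) + (\<Sum>K\<in>\<T>. P K * total_flux D K) = Ch \<T> \<tau> lam"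
    "\<forall>K\<in>\<T>. total_flux C K = (LINT x|lebesgue_on K. f x)" "\<And>\<pi>. \<pi> \<in> Pih \<Omega> \<T> N \<psi> \<Longrightarrow> Ch \<T> u \<pi> = 0"
    using s unfolding solves_HG_iff[OF f] by blast
  have "u \<in> Hdiv \<Omega>" using Hdiv_of_Ch[OF R(2,8)] by (simp add: X2_def)
  moreover have "(LINT x|lebesgue_on \<Omega>. \<theta> x \<bullet> \<tau> x) + (\<Sum>K\<in>\<T>. P K * total_flux D K) = 0"
    if "has_coeffs \<psi> \<tau> D \<and> \<tau> \<in> Hdiv \<Omega>" for \<tau> D
    using R(6)[of \<tau> D] Ch_X2[OF _ _ R(4), of \<tau> D] that by simp
  ultimately show ?thesis unfolding solves_G_iff[OF f] using R by blast
qed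

lemma inner_integral_cong:
  assumes "AE x in lebesgue_on \<Omega>. \<theta> x = \<theta>' x" "square_integrable (lebesgue_on \<Omega>) \<theta>" "square_integrable (lebesgue_on \<Omega>) \<tau>"
  shows "(LINT x|lebesgue_on \<Omega>. \<theta>' x \<bullet> \<tau> x) = (LINT x|lebesgue_on \<Omega>. \<theta> x \<bullet> \<tau> x)"
  by (rule integral_lebesgue_on_AE(2)[OF sets_dom square_integrable_inner[OF assms(2,3)]])
     (use assms(1) in \<open>auto elim: eventually_mono\<close>)

lemma AE_eq_of_cell_values:
  assumes "\<forall>K\<in>\<T>. AE x in lebesgue_on K. p x = P K" "\<forall>K\<in>\<T>. AE x in lebesgue_on K. p' x = P' K"
    and "\<And>K. K \<in> \<T> \<Longrightarrow> P K = P' K"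
  shows "AE x in lebesgue_on \<Omega>. p x = (p' x :: real)"
  unfolding AE_dom_iff
proof
  fix K assume K: "K \<in> \<T>"
  have "AE x in lebesgue_on K. p x = P K" "AE x in lebesgue_on K. p' x = P' K" using assms K by blast+
  then show "AE x in lebesgue_on K. p x = p' x" by eventually_elim (simp add: assms(3)[OF K])
qed

text \<open>The pressure difference is tested with conforming fields: the single field \<open>\<psi> 1 K e\<close> if \<open>e\<close> is a boundary
  face, and the difference of the two fields \<open>\<psi> 1 K e\<close> and \<open>\<psi> 1 K' e\<close> if \<open>e\<close> is an interior face of both cells.\<close>

lemma G_unique:
  assumes f: "square_integrable (lebesgue_on \<Omega>) f"
    and s: "solves_G \<Omega> k f \<T> N \<eta> \<psi> \<theta> u p" "solves_G \<Omega> k f \<T> N \<eta> \<psi> \<theta>' u' p'"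
  shows "AE x in lebesgue_on \<Omega>. \<theta>' x = \<theta> x" "AE x in lebesgue_on \<Omega>. u' x = u x" "AE x in lebesgue_on \<Omega>. p' x = p x"
proof -
  obtain A C P where R: "has_coeffs \<eta> \<theta> A" "has_coeffs \<psi> u C" "u \<in> Hdiv \<Omega>" "\<forall>K\<in>\<T>. AE x in lebesgue_on K. p x = P K"
    "AE x in lebesgue_on \<Omega>. k x *v \<theta> x = - u x"
    "\<And>\<tau> D. has_coeffs \<psi> \<tau> D \<Longrightarrow> \<tau> \<in> Hdiv \<Omega> \<Longrightarrow> (LINT x|lebesgue_on \<Omega>. \<theta> x \<bullet> \<tau> x) + (\<Sum>K\<in>\<T>. P K * total_flux D K) = 0"
    "\<forall>K\<in>\<T>. total_flux C K = (LINT x|lebesgue_on K. f x)"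
    using s(1) unfolding solves_G_iff[OF f] by blast
  obtain A' C' P' where R': "has_coeffs \<eta> \<theta>' A'" "has_coeffs \<psi> u' C'" "u' \<in> Hdiv \<Omega>" "\<forall>K\<in>\<T>. AE x in lebesgue_on K. p' x = P' K"
    "AE x in lebesgue_on \<Omega>. k x *v \<theta>' x = - u' x"
    "\<And>\<tau> D. has_coeffs \<psi> \<tau> D \<Longrightarrow> \<tau> \<in> Hdiv \<Omega> \<Longrightarrow> (LINT x|lebesgue_on \<Omega>. \<theta>' x \<bullet> \<tau> x) + (\<Sum>K\<in>\<T>. P' K * total_flux D K) = 0"
    "\<forall>K\<in>\<T>. total_flux C' K = (LINT x|lebesgue_on K. f x)"
    using s(2) unfolding solves_G_iff[OF f] by blast
  let ?w = "\<lambda>x. u' x + (-1) *\<^sub>R u x" and ?D = "\<lambda>K i e. C' K i e + (-1) * C K i e"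
  have w: "has_coeffs \<psi> ?w ?D" by (rule coeffs_linear[OF R'(2) R(2)])
  have wH: "?w \<in> Hdiv \<Omega>"
  proof (rule Hdiv_of_jump[OF coeffs_traces[OF w]])
    fix e assume e: "e \<in> interior_faces \<Omega> \<T>"
    show "AE x in surface_measure e. jump ?w e x = 0"
      using coeffs_jump[OF w, of e] coeffs_jump[OF R(2), of e] coeffs_jump[OF R'(2), of e]
        Hdiv_jump(2)[OF coeffs_traces[OF R(2)] R(3) e] Hdiv_jump(2)[OF coeffs_traces[OF R'(2)] R'(3) e]
      by eventually_elim (simp add: sum_subtractf left_diff_distrib)
  qed
  have tD: "total_flux ?D K = 0" if "K \<in> \<T>" for K using R(7) R'(7) that unfolding total_flux_linear by simp
  have z: "(LINT x|lebesgue_on \<Omega>. \<theta>' x \<bullet> ?w x) = (LINT x|lebesgue_on \<Omega>. \<theta> x \<bullet> ?w x)"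
    using R(6)[OF w wH] R'(6)[OF w wH] tD by simp
  show t: "AE x in lebesgue_on \<Omega>. \<theta>' x = \<theta> x" and "AE x in lebesgue_on \<Omega>. u' x = u x"
    using flux_potential_unique[OF R'(1) R(1) R'(2) R(2) R'(5) R(5) z] by blast+
  have test: "(\<Sum>K\<in>\<T>. P K * total_flux D K) = (\<Sum>K\<in>\<T>. P' K * total_flux D K)"
    if "has_coeffs \<psi> \<tau> D" "\<tau> \<in> Hdiv \<Omega>" for \<tau> D
    using R(6)[OF that] R'(6)[OF that] inner_integral_cong[OF t coeffs_square_integrable(1)[OF R'(1)] coeffs_square_integrable(1)[OF that(1)]] by simp
  have sum_unit: "(\<Sum>K\<in>\<T>. Q K * total_flux (unit_coeff K0 1 e) K) = Q K0" if "K0 \<in> \<T>" "e \<in> facets K0" for Q :: "(real^'n) set \<Rightarrow> real" and K0 e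
  proof -
    have "(\<Sum>K\<in>\<T>. Q K * total_flux (unit_coeff K0 1 e) K) = (\<Sum>K\<in>\<T>. if K = K0 then Q K0 else 0)"
      by (rule sum.cong[OF refl]) (use total_flux_unit_coeff[OF that(1) _ that(2), of 1] N in simp)
    then show ?thesis using finite_cells that by simp
  qed
  have PP: "P' K - P K = 0" if K: "K \<in> \<T>" for K
  proof (rule cell_values_zero[where P = "\<lambda>K. P' K - P K", OF _ _ K])
    fix e K assume e: "e \<in> boundary_faces \<Omega> \<T>" and K: "K \<in> adjacent_cells e"
    note r = psi_coeffs[of "unit_coeff K 1 e"]
    have "glue (local_comb \<psi> (unit_coeff K 1 e)) \<in> X2 \<Omega> \<T> N \<psi>"
    proof (rule coeffs_X2[OF r])
      fix e' i assume "e' \<in> interior_faces \<Omega> \<T>"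
      then have "e' \<noteq> e" using e by (auto simp: interior_faces_def boundary_faces_def)
      then show "(\<Sum>K'\<in>adjacent_cells e'. unit_coeff K 1 e K' i e') = 0" by (simp add: unit_coeff_def)
    qed
    then have "glue (local_comb \<psi> (unit_coeff K 1 e)) \<in> Hdiv \<Omega>" by (simp add: X2_def)
    from test[OF r this] show "P' K - P K = 0" using sum_unit[of K e] K by (simp add: adjacent_cells_def)
  next
    fix e K K' assume e: "e \<in> interior_faces \<Omega> \<T>" and K: "K \<in> adjacent_cells e" "K' \<in> adjacent_cells e"
    show "P' K - P K = P' K' - P K'"
    proof (cases "K = K'")
      case False
      let ?E = "\<lambda>L i e'. unit_coeff K 1 e L i e' + (-1) * unit_coeff K' 1 e L i e'"
      note r = psi_coeffs[of ?E]
      have "glue (local_comb \<psi> ?E) \<in> X2 \<Omega> \<T> N \<psi>"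
      proof (rule coeffs_X2[OF r])
        fix e' i
        have s: "(\<Sum>L\<in>adjacent_cells e'. unit_coeff K0 1 e L i e') = (if i = 1 \<and> e' = e then 1 else 0)" if "K0 \<in> adjacent_cells e" for K0
        proof -
          have "(\<Sum>L\<in>adjacent_cells e'. unit_coeff K0 1 e L i e') = (\<Sum>L\<in>adjacent_cells e'. if L = K0 then (if i = 1 \<and> e' = e then 1 else 0) else 0)"
            by (rule sum.cong) (auto simp: unit_coeff_def)
          then show ?thesis using finite_adjacent_cells that by auto
        qed
        show "(\<Sum>L\<in>adjacent_cells e'. ?E L i e') = 0"
          using s[OF K(1)] s[OF K(2)] by (simp add: sum_subtractf)
      qed
      then have "glue (local_comb \<psi> ?E) \<in> Hdiv \<Omega>" by (simp add: X2_def)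
      from test[OF r this] show ?thesis
        using sum_unit[of K e] sum_unit[of K' e] K
        by (simp add: adjacent_cells_def total_flux_linear[of _ "-1", simplified] right_diff_distrib sum_subtractf)
    qed simp
  qed
  show "AE x in lebesgue_on \<Omega>. p' x = p x"
    by (rule AE_eq_of_cell_values[OF R'(4) R(4)]) (use PP in simp)
qed

text \<open>The first three components also solve the conforming problem.  For the multiplier, test with
  the single field \<open>\<psi> i K e\<close>: the moment of the difference against \<open>flux i e\<close> is the pressure
  difference on \<open>K\<close>, which is zero.\<close>

lemma HG_unique:
  assumes f: "square_integrable (lebesgue_on \<Omega>) f"
    and s: "solves_HG \<Omega> k f \<T> N \<eta> \<psi> \<theta> u p lam" "solves_HG \<Omega> k f \<T> N \<eta> \<psi> \<theta>' u' p' lam'"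
  shows "AE x in lebesgue_on \<Omega>. \<theta>' x = \<theta> x" "AE x in lebesgue_on \<Omega>. u' x = u x" "AE x in lebesgue_on \<Omega>. p' x = p x"
    "\<And>e. e \<in> mesh_faces \<T> \<Longrightarrow> AE x in surface_measure e. lam' e x = lam e x"
proof -
  note G = G_unique[OF f HG_imp_G[OF f s(1)] HG_imp_G[OF f s(2)]]
  show t: "AE x in lebesgue_on \<Omega>. \<theta>' x = \<theta> x" and "AE x in lebesgue_on \<Omega>. u' x = u x"
    and pp: "AE x in lebesgue_on \<Omega>. p' x = p x"
    using G by blast+
  obtain A P where R: "has_coeffs \<eta> \<theta> A" "\<forall>K\<in>\<T>. AE x in lebesgue_on K. p x = P K" "lam \<in> Pih \<Omega> \<T> N \<psi>"
    "\<And>\<tau> D. has_coeffs \<psi> \<tau> D \<Longrightarrow> (LINT x|lebesgue_on \<Omega>. \<theta> x \<bullet> \<tau> x) + (\<Sum>K\<in>\<T>. P K * total_flux D K) = Ch \<T> \<tau> lam"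
    using s(1) unfolding solves_HG_iff[OF f] by blast
  obtain A' P' where R': "has_coeffs \<eta> \<theta>' A'" "\<forall>K\<in>\<T>. AE x in lebesgue_on K. p' x = P' K" "lam' \<in> Pih \<Omega> \<T> N \<psi>"
    "\<And>\<tau> D. has_coeffs \<psi> \<tau> D \<Longrightarrow> (LINT x|lebesgue_on \<Omega>. \<theta>' x \<bullet> \<tau> x) + (\<Sum>K\<in>\<T>. P' K * total_flux D K) = Ch \<T> \<tau> lam'"
    using s(2) unfolding solves_HG_iff[OF f] by blast
  have P: "P' K = P K" if K: "K \<in> \<T>" for K
  proof -
    interpret cell K by (rule cell_of_mesh[OF K])
    have "AE x in lebesgue_on K. p' x = p x" using pp K unfolding AE_dom_iff by blast
    moreover have "AE x in lebesgue_on K. p x = P K" "AE x in lebesgue_on K. p' x = P' K" using R R' K by blast+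
    ultimately have "AE x in lebesgue_on K. P' K = P K" by eventually_elim simp
    then have "\<not> (AE x in lebesgue_on K. False) \<Longrightarrow> ?thesis" by (cases "P' K = P K") auto
    moreover have "\<not> (AE x in lebesgue_on K. False)"
    proof
      assume "AE x in lebesgue_on K. False"
      then have "(LINT x|lebesgue_on K. 1 :: real) = 0" by (intro integral_eq_zero_AE) (auto elim: eventually_mono)
      then show False using measure_cell_pos sets_cell by (simp add: measure_restrict_space)
    qed
    ultimately show ?thesis by blast
  qed
  let ?\<delta> = "\<lambda>e x. lam' e x + (-1) * lam e x"
  have \<delta>: "?\<delta> \<in> Pih \<Omega> \<T> N \<psi>" by (rule Pih_linear[OF R'(3) R(3)])
  fix e assume e: "e \<in> mesh_faces \<T>"
  have "AE x in surface_measure e. ?\<delta> e x = 0"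
  proof (rule Pih_moments_zero[OF \<delta> e])
    fix i assume i: "i \<in> {1..N}"
    obtain K where K: "K \<in> \<T>" "e \<in> facets K" using e by (rule mesh_faceE)
    note r = psi_coeffs[of "unit_coeff K i e"]
    have "Ch \<T> (glue (local_comb \<psi> (unit_coeff K i e))) lam' = Ch \<T> (glue (local_comb \<psi> (unit_coeff K i e))) lam"
      using R(4)[OF r] R'(4)[OF r] P inner_integral_cong[OF t coeffs_square_integrable(1)[OF R'(1)] coeffs_square_integrable(1)[OF r]] by simp
    moreover have "Ch \<T> (glue (local_comb \<psi> (unit_coeff K i e))) \<pi> = flux_moment i e (\<pi> e)" if "\<pi> \<in> Pih \<Omega> \<T> N \<psi>" for \<pi>
      using Ch_face_sum[OF r PihD(1)[OF that]] unit_coeff_sum(2)[OF K(1) i K(2), of "\<lambda>K i e. flux_moment i e (\<pi> e)"]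
      by simp
    ultimately have "flux_moment i e (lam' e) = flux_moment i e (lam e)" using R(3) R'(3) by simp
    then show "flux_moment i e (?\<delta> e) = 0"
      unfolding flux_moment_linear[OF i e PihD(1)[OF R'(3) e] PihD(1)[OF R(3) e]] by simp
  qed
  then show "AE x in surface_measure e. lam' e x = lam e x" by eventually_elim simp
qed

lemma flux_moment_jump_linear:
  assumes "has_coeffs \<psi> \<tau> C" "has_coeffs \<psi> \<tau>' C'" "e \<in> mesh_faces \<T>" "i \<in> {1..N}"
  shows "flux_moment i e (jump (\<lambda>x. \<tau> x + c *\<^sub>R \<tau>' x) e) = flux_moment i e (jump \<tau> e) + c * flux_moment i e (jump \<tau>' e)"
proof -
  note r = coeffs_linear[OF assms(1,2), of c]
  note s = jump_square_integrable[OF coeffs_traces[OF assms(1)], of e] jump_square_integrable[OF coeffs_traces[OF assms(2)], of e]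
  have "AE x in surface_measure e. jump (\<lambda>x. \<tau> x + c *\<^sub>R \<tau>' x) e x = jump \<tau> e x + c * jump \<tau>' e x"
    using coeffs_jump[OF r, of e] coeffs_jump[OF assms(1), of e] coeffs_jump[OF assms(2), of e]
    by eventually_elim (simp only: sum.distrib sum_distrib_left[symmetric] distrib_right mult.assoc)
  then have "flux_moment i e (jump (\<lambda>x. \<tau> x + c *\<^sub>R \<tau>' x) e) = flux_moment i e (\<lambda>x. jump \<tau> e x + c * jump \<tau>' e x)"
    by (intro flux_moment_cong[OF assms(4,3)] jump_square_integrable[OF coeffs_traces[OF r]] square_integrable_add square_integrable_cmult s)
  also have "\<dots> = flux_moment i e (jump \<tau> e) + c * flux_moment i e (jump \<tau>' e)"
    by (rule flux_moment_linear[OF assms(4,3) s])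
  finally show ?thesis .
qed

lemma Ch_moments:
  assumes \<tau>: "has_coeffs \<psi> \<tau> D" and \<pi>: "\<pi> \<in> Pih \<Omega> \<T> N \<psi>"
  shows "Ch \<T> \<tau> \<pi> = (\<Sum>K\<in>\<T>. \<Sum>i=1..N. \<Sum>e\<in>facets K. D K i e * flux_moment i e (\<pi> e))"
proof -
  have "Ch \<T> \<tau> \<pi> = (\<Sum>K\<in>\<T>. \<Sum>e\<in>facets K. \<Sum>i=1..N. D K i e * flux_moment i e (\<pi> e))"
    by (rule Ch_face_sum[OF \<tau> PihD(1)[OF \<pi>]])
  also have "\<dots> = (\<Sum>K\<in>\<T>. \<Sum>i=1..N. \<Sum>e\<in>facets K. D K i e * flux_moment i e (\<pi> e))"
    by (rule sum.cong[OF refl]) (rule sum.swap)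
  finally show ?thesis .
qed

lemma coeffs_zero: "has_coeffs F (\<lambda>x. 0) (\<lambda>_ _ _. 0)"
  by (simp add: has_coeffs_def local_comb_def)

text \<open>The unknowns are the common coefficients \<open>C\<close> of \<open>\<theta>\<close> and \<open>u\<close> (which take care of the constitutive law), the cell
  values \<open>P\<close> of \<open>p\<close>, and the coefficients of the multiplier with respect to \<open>flux i e\<close>.  A test \<open>(\<tau>, D, Q, \<pi>)\<close>
  consists of a field \<open>\<tau>\<close> with coefficients \<open>D\<close>, cell values \<open>Q\<close> and a multiplier \<open>\<pi>\<close>.  The three remaining
  equations are added up to one linear form in the test; \<open>r j\<close> is its part that goes with the
  \<open>j\<close>-th unknown, and \<open>b\<close> is the load.\<close>

lemma HG_exists:
  assumes f: "square_integrable (lebesgue_on \<Omega>) f"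
  shows "\<exists>\<theta> u p lam. solves_HG \<Omega> k f \<T> N \<eta> \<psi> \<theta> u p lam"
proof -
  define fK where "fK K = (LINT x|lebesgue_on K. f x)" for K
  define E where "E K i e \<tau> = (LINT x|lebesgue_on K. \<eta> i K e x \<bullet> \<tau> x)" for K i e and \<tau> :: "real^'n \<Rightarrow> real^'n"
  define J1 where "J1 = (SIGMA K:\<T>. {1..N} \<times> facets K)"
  define J3 where "J3 = interior_faces \<Omega> \<T> \<times> {1..N}"
  define r where "r j y = (case y of (\<tau>, D, Q, \<pi>) \<Rightarrow> (case j of
      Inl (K, i, e) \<Rightarrow> E K i e \<tau> - Q K - flux_moment i e (\<pi> e)
    | Inr (Inl K) \<Rightarrow> total_flux D K
    | Inr (Inr (e, i)) \<Rightarrow> flux_moment i e (jump \<tau> e)))"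
    for j and y :: "(real^'n \<Rightarrow> real^'n) \<times> ((real^'n) set \<Rightarrow> nat \<Rightarrow> (real^'n) set \<Rightarrow> real)
        \<times> ((real^'n) set \<Rightarrow> real) \<times> ((real^'n) set \<Rightarrow> real^'n \<Rightarrow> real)"
  define b where "b y = (case y of (\<tau>, D, Q, \<pi>) \<Rightarrow> - (\<Sum>K\<in>\<T>. Q K * fK K))"
    for y :: "(real^'n \<Rightarrow> real^'n) \<times> ((real^'n) set \<Rightarrow> nat \<Rightarrow> (real^'n) set \<Rightarrow> real)
        \<times> ((real^'n) set \<Rightarrow> real) \<times> ((real^'n) set \<Rightarrow> real^'n \<Rightarrow> real)"
  define add where "add y c z = (case y of (\<tau>, D, Q, \<pi>) \<Rightarrow> case z of (\<tau>', D', Q', \<pi>') \<Rightarrow>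
      (\<lambda>x. \<tau> x + c *\<^sub>R \<tau>' x, \<lambda>K i e. D K i e + c * D' K i e, \<lambda>K. Q K + c * Q' K, \<lambda>e x. \<pi> e x + c * \<pi>' e x))"
    for c and y z :: "(real^'n \<Rightarrow> real^'n) \<times> ((real^'n) set \<Rightarrow> nat \<Rightarrow> (real^'n) set \<Rightarrow> real)
        \<times> ((real^'n) set \<Rightarrow> real) \<times> ((real^'n) set \<Rightarrow> real^'n \<Rightarrow> real)"
  define Y where "Y = {(\<tau>, D, Q :: (real^'n) set \<Rightarrow> real, \<pi>). has_coeffs \<psi> \<tau> D \<and> \<pi> \<in> Pih \<Omega> \<T> N \<psi>}"
  let ?J = "J1 <+> (\<T> <+> J3)"
  have fin_int: "finite (interior_faces \<Omega> \<T>)"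
    using finite_mesh_faces by (rule rev_finite_subset) (auto simp: interior_faces_def)
  have finF: "finite (facets K)" if "K \<in> \<T>" for K using cell.finite_facets[OF cell_of_mesh[OF that]] .
  have fin1: "finite J1" and fin3: "finite J3"
    using finite_cells finF fin_int by (auto simp: J1_def J3_def)
  have im: "e \<in> mesh_faces \<T>" if "e \<in> interior_faces \<Omega> \<T>" for e using that by (simp add: interior_faces_def)
  have fm: "e \<in> mesh_faces \<T>" if "K \<in> \<T>" "e \<in> facets K" for K e using that by (auto simp: mesh_faces_def)
  have E_linear: "E K i e (\<lambda>x. \<tau> x + c *\<^sub>R \<tau>' x) = E K i e \<tau> + c * E K i e \<tau>'"
    if "K \<in> \<T>" "i \<in> {1..N}" "e \<in> facets K" "has_coeffs \<psi> \<tau> D" "has_coeffs \<psi> \<tau>' D'" for K i e \<tau> \<tau>' D D' c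
  proof -
    note s = eta_square_integrable[OF that(2,1,3)]
    show ?thesis
      using square_integrable_inner[OF s coeffs_square_integrable(2)[OF that(4,1)]] square_integrable_inner[OF s coeffs_square_integrable(2)[OF that(5,1)]]
      by (simp add: E_def inner_add_right)
  qed
  have "\<exists>x. \<forall>y\<in>Y. b y = (\<Sum>j\<in>?J. x j * r j y)"
  proof (rule functional_in_span[where add = add])
    show "finite ?J" using finite_cells fin1 fin3 by simp
    show "add y c z \<in> Y" if "y \<in> Y" "z \<in> Y" for y c z
      using that coeffs_linear Pih_linear by (auto simp: Y_def add_def)
    show "b (add y c z) = b y + c * b z" if "y \<in> Y" "z \<in> Y" for y c z
      by (auto simp: b_def add_def sum.distrib sum_distrib_left algebra_simps split: prod.splits)
    show "r j (add y c z) = r j y + c * r j z" if j: "j \<in> ?J" and y: "y \<in> Y" and z: "z \<in> Y" for j y c z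
    proof -
      obtain \<tau> D Q \<pi> where y': "y = (\<tau>, D, Q, \<pi>)" "has_coeffs \<psi> \<tau> D" "\<pi> \<in> Pih \<Omega> \<T> N \<psi>" using y by (auto simp: Y_def)
      obtain \<tau>' D' Q' \<pi>' where z': "z = (\<tau>', D', Q', \<pi>')" "has_coeffs \<psi> \<tau>' D'" "\<pi>' \<in> Pih \<Omega> \<T> N \<psi>" using z by (auto simp: Y_def)
      from j consider (a) K i e where "j = Inl (K, i, e)" "K \<in> \<T>" "i \<in> {1..N}" "e \<in> facets K"
        | (b) K where "j = Inr (Inl K)" | (c) e i where "j = Inr (Inr (e, i))" "e \<in> interior_faces \<Omega> \<T>" "i \<in> {1..N}"
        by (auto simp: J1_def J3_def)
      then show ?thesis
      proof cases
        case a
        show ?thesis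
          using E_linear[OF a(2-4) y'(2) z'(2), of c]
            flux_moment_linear[OF a(3) fm[OF a(2,4)] PihD(1)[OF y'(3) fm[OF a(2,4)]] PihD(1)[OF z'(3) fm[OF a(2,4)]], of c]
          by (simp add: r_def add_def a y'(1) z'(1) algebra_simps)
      next
        case b
        then show ?thesis by (simp add: r_def add_def y'(1) z'(1) total_flux_linear)
      next
        case c
        then show ?thesis
          using flux_moment_jump_linear[OF y'(2) z'(2) im] by (simp add: r_def add_def y'(1) z'(1))
      qed
    qed
    \<comment> \<open>The adjoint problem: energy makes the field zero, and the first family of equations then equates \<open>Q K\<close> with
      minus the moments of \<open>\<pi>\<close> on all faces of \<open>K\<close>.\<close>
    show "b y = 0" if y: "y \<in> Y" and z: "\<And>j. j \<in> ?J \<Longrightarrow> r j y = 0" for y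
    proof -
      obtain \<tau> D Q \<pi> where y': "y = (\<tau>, D, Q, \<pi>)" and \<tau>: "has_coeffs \<psi> \<tau> D" and \<pi>: "\<pi> \<in> Pih \<Omega> \<T> N \<psi>"
        using y by (auto simp: Y_def)
      have r1: "E K i e \<tau> = Q K + flux_moment i e (\<pi> e)" if "K \<in> \<T>" "i \<in> {1..N}" "e \<in> facets K" for K i e
      proof -
        have "(K, i, e) \<in> J1" using that by (simp add: J1_def)
        from z[OF InlI[OF this]] show ?thesis by (simp add: r_def y')
      qed
      have r2: "total_flux D K = 0" if "K \<in> \<T>" for K
        using z[OF InrI[OF InlI[OF that]]] by (simp add: r_def y')
      have r3: "flux_moment i e (jump \<tau> e) = 0" if "e \<in> interior_faces \<Omega> \<T>" "i \<in> {1..N}" for i e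
      proof -
        have "(e, i) \<in> J3" using that by (simp add: J3_def)
        from z[OF InrI[OF InrI[OF this]]] show ?thesis by (simp add: r_def y')
      qed
      note \<theta> = eta_coeffs[of D]
      let ?\<theta> = "glue (local_comb \<eta> D)"
      have "(LINT x|lebesgue_on \<Omega>. ?\<theta> x \<bullet> \<tau> x) = (\<Sum>K\<in>\<T>. \<Sum>i=1..N. \<Sum>e\<in>facets K. D K i e * E K i e \<tau>)"
        unfolding E_def by (rule inner_comb[OF \<theta> coeffs_square_integrable(1)[OF \<tau>]])
      also have "\<dots> = (\<Sum>K\<in>\<T>. \<Sum>i=1..N. \<Sum>e\<in>facets K. D K i e * Q K + D K i e * flux_moment i e (\<pi> e))"
        by (intro sum.cong refl) (simp add: r1 distrib_left)
      also have "\<dots> = (\<Sum>K\<in>\<T>. Q K * total_flux D K) + (\<Sum>K\<in>\<T>. \<Sum>i=1..N. \<Sum>e\<in>facets K. D K i e * flux_moment i e (\<pi> e))"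
        by (simp add: sum.distrib total_flux_def sum_distrib_left mult.commute)
      also have "(\<Sum>K\<in>\<T>. \<Sum>i=1..N. \<Sum>e\<in>facets K. D K i e * flux_moment i e (\<pi> e)) = Ch \<T> \<tau> \<pi>"
        by (rule Ch_moments[OF \<tau> \<pi>, symmetric])
      also have "Ch \<T> \<tau> \<pi> = 0" by (rule Ch_eq_zero[OF \<tau> \<pi> r3])
      also have "(\<Sum>K\<in>\<T>. Q K * total_flux D K) + 0 = 0" using r2 by simp
      finally have "AE x in lebesgue_on \<Omega>. \<tau> x = 0"
        by (rule zero_of_energy_zero(2)[OF coeffs_square_integrable(1)[OF \<theta>] coeffs_square_integrable(1)[OF \<tau>] k_coeffs_eta[OF \<theta> \<tau>]])
      then have "E K i e \<tau> = 0" if "K \<in> \<T>" for K i e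
        unfolding E_def using that AE_dom_iff[of "\<lambda>x. \<tau> x = 0"]
        by (intro integral_eq_zero_AE) (auto elim: eventually_mono)
      then have Qm: "Q K - 0 = - flux_moment 1 e (\<pi> e)" if "K \<in> \<T>" "e \<in> facets K" for K e
        using r1[of K 1 e] that N by simp
      have "Q K = 0" if "K \<in> \<T>" for K
      proof (rule cell_values_eq[where P = Q and P' = "\<lambda>_. 0", OF Qm _ that])
        fix e assume "e \<in> boundary_faces \<Omega> \<T>"
        then show "- flux_moment 1 e (\<pi> e) = 0" using flux_moment_AE_zero[OF PihD(3)[OF \<pi>]] by simp
      qed
      then show "b y = 0" by (simp add: b_def y')
    qed
  qed
  then obtain x where x: "\<And>y. y \<in> Y \<Longrightarrow> b y = (\<Sum>j\<in>?J. x j * r j y)" by blast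
  define C where "C K i e = x (Inl (K, i, e))" for K i e
  define P where "P K = x (Inr (Inl K))" for K
  define L where "L e i = x (Inr (Inr (e, i)))" for e i
  have main: "- (\<Sum>K\<in>\<T>. Q K * fK K) =
      (\<Sum>K\<in>\<T>. \<Sum>i=1..N. \<Sum>e\<in>facets K. C K i e * (E K i e \<tau> - Q K - flux_moment i e (\<pi> e)))
      + ((\<Sum>K\<in>\<T>. P K * total_flux D K) + (\<Sum>e\<in>interior_faces \<Omega> \<T>. \<Sum>i=1..N. L e i * flux_moment i e (jump \<tau> e)))"
    if "has_coeffs \<psi> \<tau> D" "\<pi> \<in> Pih \<Omega> \<T> N \<psi>" for \<tau> D Q \<pi>
  proof -
    let ?y = "(\<tau>, D, Q, \<pi>)"
    have "- (\<Sum>K\<in>\<T>. Q K * fK K) = b ?y" by (simp add: b_def)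
    also have "\<dots> = (\<Sum>j\<in>?J. x j * r j ?y)" by (rule x) (use that in \<open>simp add: Y_def\<close>)
    also have "\<dots> = (\<Sum>j\<in>J1. x (Inl j) * r (Inl j) ?y)
        + ((\<Sum>K\<in>\<T>. x (Inr (Inl K)) * r (Inr (Inl K)) ?y) + (\<Sum>j\<in>J3. x (Inr (Inr j)) * r (Inr (Inr j)) ?y))"
      using finite_cells fin1 fin3 by (simp add: sum.Plus)
    also have "(\<Sum>j\<in>J1. x (Inl j) * r (Inl j) ?y)
        = (\<Sum>K\<in>\<T>. \<Sum>i=1..N. \<Sum>e\<in>facets K. C K i e * (E K i e \<tau> - Q K - flux_moment i e (\<pi> e)))"
    proof -
      have "(\<Sum>K\<in>\<T>. \<Sum>i=1..N. \<Sum>e\<in>facets K. C K i e * (E K i e \<tau> - Q K - flux_moment i e (\<pi> e)))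
        = (\<Sum>K\<in>\<T>. \<Sum>(i, e)\<in>{1..N} \<times> facets K. C K i e * (E K i e \<tau> - Q K - flux_moment i e (\<pi> e)))"
        by (simp only: sum.cartesian_product)
      also have "\<dots> = (\<Sum>(K, p)\<in>J1. case p of (i, e) \<Rightarrow> C K i e * (E K i e \<tau> - Q K - flux_moment i e (\<pi> e)))"
        unfolding J1_def by (rule sum.Sigma) (use finite_cells finF in auto)
      also have "\<dots> = (\<Sum>j\<in>J1. x (Inl j) * r (Inl j) ?y)"
        by (rule sum.cong[OF refl]) (auto simp: C_def r_def)
      finally show ?thesis by simp
    qed
    also have "(\<Sum>j\<in>J3. x (Inr (Inr j)) * r (Inr (Inr j)) ?y)
        = (\<Sum>e\<in>interior_faces \<Omega> \<T>. \<Sum>i=1..N. L e i * flux_moment i e (jump \<tau> e))"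
      unfolding J3_def sum.cartesian_product by (rule sum.cong[OF refl]) (auto simp: L_def r_def)
    finally show ?thesis by (simp add: P_def r_def)
  qed
  have mom0: "flux_moment i e (\<lambda>x. 0) = 0" for i e by (simp add: flux_moment_def)
  have jump0: "flux_moment i e (jump (\<lambda>x. 0) e) = 0" for i e
    by (rule flux_moment_AE_zero) (use coeffs_jump[OF coeffs_zero, of e] in simp)
  have E0: "E K i e (\<lambda>x. 0) = 0" for K i e by (simp add: E_def)
  \<comment> \<open>The sign accounts for the multiplier term standing on the right-hand side of its equation.\<close>
  define lam where "lam e x = (if e \<in> interior_faces \<Omega> \<T> then \<Sum>i=1..N. (- L e i) * flux i e x else 0)" for e x
  have lam: "lam \<in> Pih \<Omega> \<T> N \<psi>"
    unfolding Pih_iff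
  proof (intro conjI ballI)
    fix e
    show "square_integrable (surface_measure e) (lam e)" if "e \<in> mesh_faces \<T>"
      using that unfolding lam_def[abs_def]
      by (cases "e \<in> interior_faces \<Omega> \<T>") (auto intro!: square_integrable_sum square_integrable_cmult[of _ _ "- _", simplified] flux_square_integrable)
    show "\<exists>d. AE x in surface_measure e. lam e x = (\<Sum>i=1..N. d i * flux i e x)" if "e \<in> interior_faces \<Omega> \<T>"
      by (rule exI[of _ "\<lambda>i. - L e i"]) (use that in \<open>simp add: lam_def\<close>)
    show "AE x in surface_measure e. lam e x = 0" if "e \<in> boundary_faces \<Omega> \<T>"
      using that by (simp add: lam_def interior_faces_def boundary_faces_def)
  qed
  have Ch_lam: "Ch \<T> \<tau> lam = - (\<Sum>e\<in>interior_faces \<Omega> \<T>. \<Sum>i=1..N. L e i * flux_moment i e (jump \<tau> e))"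
    if \<tau>: "has_coeffs \<psi> \<tau> D" for \<tau> D
  proof -
    have "Ch \<T> \<tau> lam = (\<Sum>e\<in>mesh_faces \<T>. LINT x|surface_measure e. jump \<tau> e x * lam e x)"
      by (rule Ch_jump[OF \<tau> PihD(1)[OF lam]])
    also have "\<dots> = (\<Sum>e\<in>interior_faces \<Omega> \<T>. LINT x|surface_measure e. lam e x * jump \<tau> e x)"
      unfolding mult.commute[of "jump \<tau> _ _"]
      by (rule sum.mono_neutral_right[OF finite_mesh_faces]) (auto simp: im lam_def)
    also have "\<dots> = (\<Sum>e\<in>interior_faces \<Omega> \<T>. \<Sum>i=1..N. (- L e i) * flux_moment i e (jump \<tau> e))"
    proof (rule sum.cong[OF refl])
      fix e assume e: "e \<in> interior_faces \<Omega> \<T>"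
      show "(LINT x|surface_measure e. lam e x * jump \<tau> e x) = (\<Sum>i=1..N. (- L e i) * flux_moment i e (jump \<tau> e))"
      proof (rule integral_flux_comb[OF im[OF e] jump_square_integrable[OF coeffs_traces[OF \<tau>]]])
        show "AE x in surface_measure e. lam e x = (\<Sum>i=1..N. (- L e i) * flux i e x)" using e by (simp add: lam_def)
        show "lam e \<in> borel_measurable (surface_measure e)"
          using PihD(1)[OF lam im[OF e]] by (simp add: square_integrable_def)
      qed
    qed
    finally show ?thesis by (simp add: sum_negf)
  qed
  have "solves_HG \<Omega> k f \<T> N \<eta> \<psi> (glue (local_comb \<eta> C)) (glue (local_comb \<psi> C)) (glue (\<lambda>K _. P K)) lam"
    unfolding solves_HG_iff[OF f]
  proof (intro exI conjI allI impI ballI)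
    show "has_coeffs \<eta> (glue (local_comb \<eta> C)) C" by (rule eta_coeffs)
    show "has_coeffs \<psi> (glue (local_comb \<psi> C)) C" by (rule psi_coeffs)
    show "AE x in lebesgue_on K. glue (\<lambda>K _. P K) x = P K" if "K \<in> \<T>" for K by (rule glue_AE[OF that])
    show "lam \<in> Pih \<Omega> \<T> N \<psi>" by (rule lam)
    show "AE x in lebesgue_on \<Omega>. k x *v glue (local_comb \<eta> C) x = - glue (local_comb \<psi> C) x"
      by (rule k_coeffs_eta[OF eta_coeffs psi_coeffs])
    show "(LINT x|lebesgue_on \<Omega>. glue (local_comb \<eta> C) x \<bullet> \<tau> x) + (\<Sum>K\<in>\<T>. P K * total_flux D K) = Ch \<T> \<tau> lam"
      if \<tau>: "has_coeffs \<psi> \<tau> D" for \<tau> D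
    proof -
      have "(LINT x|lebesgue_on \<Omega>. glue (local_comb \<eta> C) x \<bullet> \<tau> x) = (\<Sum>K\<in>\<T>. \<Sum>i=1..N. \<Sum>e\<in>facets K. C K i e * E K i e \<tau>)"
        unfolding E_def by (rule inner_comb[OF eta_coeffs coeffs_square_integrable(1)[OF \<tau>]])
      then show ?thesis using main[OF \<tau> Pih_zero, of "\<lambda>_. 0"] Ch_lam[OF \<tau>] by (simp add: mom0)
    qed
    show "total_flux C K0 = (LINT x|lebesgue_on K0. f x)" if K0: "K0 \<in> \<T>" for K0
    proof -
      let ?Q = "\<lambda>K. if K = K0 then 1 else (0::real)"
      have d: "(\<Sum>K\<in>\<T>. ?Q K * h K) = h K0" for h :: "(real^'n) set \<Rightarrow> real"
      proof -
        have "(\<Sum>K\<in>\<T>. ?Q K * h K) = (\<Sum>K\<in>\<T>. if K = K0 then h K0 else 0)" by (rule sum.cong) auto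
        then show ?thesis using finite_cells K0 by simp
      qed
      have "- (\<Sum>K\<in>\<T>. ?Q K * fK K) = (\<Sum>K\<in>\<T>. \<Sum>i=1..N. \<Sum>e\<in>facets K. C K i e * (0 - ?Q K - 0))"
        using main[OF coeffs_zero Pih_zero, of ?Q] unfolding mom0 jump0 E0 by (simp add: total_flux_def)
      also have "\<dots> = - (\<Sum>K\<in>\<T>. ?Q K * total_flux C K)"
        unfolding total_flux_def sum_distrib_left sum_negf[symmetric] by (intro sum.cong refl) simp
      finally show ?thesis unfolding d by (simp add: fK_def)
    qed
    show "Ch \<T> (glue (local_comb \<psi> C)) \<pi> = 0" if \<pi>: "\<pi> \<in> Pih \<Omega> \<T> N \<psi>" for \<pi>
    proof -
      have "Ch \<T> (glue (local_comb \<psi> C)) \<pi> = (\<Sum>K\<in>\<T>. \<Sum>i=1..N. \<Sum>e\<in>facets K. C K i e * flux_moment i e (\<pi> e))"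
        by (rule Ch_moments[OF psi_coeffs \<pi>])
      also have "\<dots> = 0"
        using main[OF coeffs_zero \<pi>, of "\<lambda>_. 0"] unfolding jump0 E0 by (simp add: total_flux_def sum_negf)
      finally show ?thesis .
    qed
  qed
  then show ?thesis by blast
qed

end

theorem theorem4p6:
  fixes \<Omega> :: "(real^'n) set"
    and k :: "real^'n \<Rightarrow> real^'n^'n"
    and f :: "real^'n \<Rightarrow> real"
    and kmin kmax \<sigma> :: real
    and \<T> :: "(real^'n) set set"
    and N :: nat
    and ug :: "nat \<Rightarrow> real^'n \<Rightarrow> real^'n"
    and rt :: "(real^'n) set \<Rightarrow> (real^'n) set \<Rightarrow> real^'n \<Rightarrow> real^'n"
    and \<eta> \<psi> :: "nat \<Rightarrow> (real^'n) set \<Rightarrow> (real^'n) set \<Rightarrow> real^'n \<Rightarrow> real^'n"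
    and \<phi> :: "nat \<Rightarrow> (real^'n) set \<Rightarrow> (real^'n) set \<Rightarrow> real^'n \<Rightarrow> real"
  assumes dim: "CARD('n) = 2 \<or> CARD('n) = 3"
    and dom: "Lipschitz_domain \<Omega>" "bounded \<Omega>"
    and f: "square_integrable (lebesgue_on \<Omega>) f"
    and k_meas: "k \<in> borel_measurable (lebesgue_on \<Omega>)"
    and k_sym: "\<forall>x\<in>\<Omega>. transpose (k x) = k x"
    and k_const: "0 < kmin" "kmin \<le> kmax"
    and k_ell: "\<forall>x\<in>\<Omega>. \<forall>\<zeta>. kmin * (norm \<zeta>)\<^sup>2 \<le> \<zeta> \<bullet> (k x *v \<zeta>) \<and>
                              \<zeta> \<bullet> (k x *v \<zeta>) \<le> kmax * (norm \<zeta>)\<^sup>2"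
    and mesh: "quasi_uniform_partition \<sigma> \<Omega> \<T>"
    and RT: "\<forall>K\<in>\<T>. \<forall>e\<in>facets K. RT0_basis_function K e (rt K e)"
    and N: "1 \<le> N"
    and ug: "\<forall>i\<in>{1..N}. ug i \<in> Hdiv \<Omega> \<and> (\<forall>K\<in>\<T>. \<exists>\<gamma>. has_normal_trace K (ug i) \<gamma>)"
    and ug_flux: "\<forall>i\<in>{1..N}. \<forall>e\<in>mesh_faces \<T>.
                    (LINT x|surface_measure e. face_trace \<T> (ug i) e x) \<noteq> 0"
    and loc: "\<forall>i\<in>{1..N}. \<forall>K\<in>\<T>. \<forall>e\<in>facets K.
                local_problem k K e (ug i) (rt K e) (\<eta> i K e) (\<psi> i K e) (\<phi> i K e)"
  shows "\<exists>\<theta> u p lam.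
           solves_HG \<Omega> k f \<T> N \<eta> \<psi> \<theta> u p lam \<and>
           (\<forall>\<theta>' u' p' lam'. solves_HG \<Omega> k f \<T> N \<eta> \<psi> \<theta>' u' p' lam' \<longrightarrow>
              ae_eq (lebesgue_on \<Omega>) \<theta>' \<theta> \<and> ae_eq (lebesgue_on \<Omega>) u' u \<and>
              ae_eq (lebesgue_on \<Omega>) p' p \<and>
              (\<forall>e\<in>mesh_faces \<T>. ae_eq (surface_measure e) (lam' e) (lam e))) \<and>
           solves_G \<Omega> k f \<T> N \<eta> \<psi> \<theta> u p \<and>
           (\<forall>\<theta>' u' p'. solves_G \<Omega> k f \<T> N \<eta> \<psi> \<theta>' u' p' \<longrightarrow>
              ae_eq (lebesgue_on \<Omega>) \<theta>' \<theta> \<and> ae_eq (lebesgue_on \<Omega>) u' u \<and>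
              ae_eq (lebesgue_on \<Omega>) p' p)"
proof -
  interpret multiscale \<sigma> \<Omega> \<T> k kmin N ug rt \<eta> \<psi> \<phi>
    by unfold_locales (use assms in auto)
  obtain \<theta> u p lam where s: "solves_HG \<Omega> k f \<T> N \<eta> \<psi> \<theta> u p lam"
    using HG_exists[OF f] by blast
  note G = HG_imp_G[OF f s]
  show ?thesis
  proof (intro exI conjI allI impI)
    show "solves_HG \<Omega> k f \<T> N \<eta> \<psi> \<theta> u p lam" by (rule s)
    show "solves_G \<Omega> k f \<T> N \<eta> \<psi> \<theta> u p" by (rule G)
  next
    fix \<theta>' u' p' lam' assume s': "solves_HG \<Omega> k f \<T> N \<eta> \<psi> \<theta>' u' p' lam'"
    note U = HG_unique[OF f s s']
    show "ae_eq (lebesgue_on \<Omega>) \<theta>' \<theta>" "ae_eq (lebesgue_on \<Omega>) u' u" "ae_eq (lebesgue_on \<Omega>) p' p"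
      "\<forall>e\<in>mesh_faces \<T>. ae_eq (surface_measure e) (lam' e) (lam e)"
      using U by (simp_all add: ae_eq_def)
  next
    fix \<theta>' u' p' assume s': "solves_G \<Omega> k f \<T> N \<eta> \<psi> \<theta>' u' p'"
    note U = G_unique[OF f G s']
    show "ae_eq (lebesgue_on \<Omega>) \<theta>' \<theta>" "ae_eq (lebesgue_on \<Omega>) u' u" "ae_eq (lebesgue_on \<Omega>) p' p"
      using U by (simp_all add: ae_eq_def)
  qed
qed

end
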